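(* Consider the degraded Gaussian diamond-wiretap channel with parameters $P_1,P_2>0$, $C_1,C_2\ge 0$, $g\in[0,1)$, in the first scenario (a common fictitious message of rate $R'$ is available at the source and at both relays), and let $C_S^{(1)}$ be its secrecy capacity. Let $\rho^*=\sqrt{1+\frac{1}{4P_1P_2}}-\frac{1}{2\sqrt{P_1P_2}}$. Then for every $R'\ge 0$, $$C_S^{(1)}\le \min\bigl(\max(S_1,S_2),\ \max(S_3,S_4)\bigr),$$ where \begin{align*} S_1&=\max_{0\le\rho\le\rho^*}\min\bigl(f_1(\rho),f_2(\rho),f_3(\rho),f_4(\rho)\bigr),\\ S_2&=\max_{\rho^*<\rho\le 1}\min\bigl(f_1(\rho),f_2(\rho),f_3(0),f_4(\rho)\bigr),\\ S_3&=\max_{0\le\rho\le\rho^*}\min\Bigl(f_1(\rho),f_2(\rho),f_3(0),\tfrac{f_3(\rho)+f_4(\rho)}{2},f_4(\rho)-f_5(\rho)\Bigr),\\ S_4&=\max_{\rho^*<\rho\le 1}\min\bigl(f_1(\rho),f_2(\rho),f_3(0),f_4(\rho)-f_5(\rho)\bigr). \end{align*}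
   Context: Channel. A source is connected to relays 1 and 2 by orthogonal noiseless links of capacities $C_1,C_2\ge 0$ (bits per channel use); there is no direct link from the source to the destination or eavesdropper. At each time the relays send real inputs $X_1,X_2$; the legitimate destination receives $Y=X_1+X_2+N_Y$ and the eavesdropper receives $Z=\sqrt{g}\,Y+N_Z$, where $g\in[0,1)$, $N_Y\sim\mathcal N(0,1)$ and $N_Z\sim\mathcal N(0,1-g)$ are independent of each other, of the inputs, and i.i.d. over time. The power constraint at relay $k=1,2$ over $n$ channel uses is $\frac1n\sum_{i=1}^n X_{k,i}^2\le P_k$. Notation: $[i:j]=\{i,i+1,\dots,j\}$; quantities such as $2^{nR}$ are rounded to integers. First scenario. A fictitious message $M\sim\mathrm{Unif}[1:2^{nR'}]$ is available at the source and at both relays (not at the destination or eavesdropper). A $(2^{nR},n)$ secrecy code consists of a message $W\sim\mathrm{Unif}[1:2^{nR}]$ independent of $M$; a (deterministic) encoding function at the source mapping $(W,M)$ to $(J_1,J_2)\in[1:2^{nC_1}]\times[1:2^{nC_2}]$; for $k=1,2$ a (deterministic) encoding function at relay $k$ mapping $(J_k,M)$ to $X_k^n$ satisfying the power constraint; and a decoding function mapping $Y^n$ to $\hat W\in[1:2^{nR}]$. A secrecy rate $R$ is achievable if there is a sequence of $(2^{nR},n)$ codes with $\lim_{n\to\infty}P(\hat W\ne W)=0$ and $\lim_{n\to\infty}\frac1n I(W;Z^n)=0$. $C_S^{(1)}$ is the supremum of all achievable secrecy rates. Functions (logarithms to base 2): $f_1(\rho)=C_1+\frac12\log(1+(1-\rho^2)P_2)$,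 $f_2(\rho)=C_2+\frac12\log(1+(1-\rho^2)P_1)$, $f_3(\rho)=C_1+C_2-\frac12\log\frac{1}{1-\rho^2}$ (equal to $-\infty$ when $|\rho|=1$), $f_4(\rho)=\frac12\log(1+P_1+P_2+2\rho\sqrt{P_1P_2})$, $f_5(\rho)=\frac12\log(1+g(P_1+P_2+2\rho\sqrt{P_1P_2}))$. A maximum over a half-open interval is understood as a supremum. *)

theory Defs
  imports "HOL-Probability.Probability"
begin

text \<open>
  Message and index sets are \<open>{1..M}\<close> with \<open>M\<close> the integer part of \<open>2 powr (n * r)\<close>.
\<close>

definition num_msgs :: "nat \<Rightarrow> real \<Rightarrow> nat" where
  "num_msgs n r = nat \<lfloor>2 powr (real n * r)\<rfloor>"

text \<open>
  A code of block length \<open>n\<close>.  The source encoder maps \<open>(w, m)\<close> to \<open>(j1, j2)\<close>; the encoder of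
  relay \<open>k\<close> maps \<open>j\<^sub>k\<close>, \<open>m\<close> and a time \<open>i \<in> {1..n}\<close> to a channel input.
\<close>

record secrecy_code =
  src_enc :: "nat \<Rightarrow> nat \<Rightarrow> nat \<times> nat"
  relay1 :: "nat \<Rightarrow> nat \<Rightarrow> nat \<Rightarrow> real"
  relay2 :: "nat \<Rightarrow> nat \<Rightarrow> nat \<Rightarrow> real"
  dec :: "(nat \<Rightarrow> real) \<Rightarrow> nat"

definition power_constraint :: "nat \<Rightarrow> real \<Rightarrow> (nat \<Rightarrow> real) \<Rightarrow> bool" where
  "power_constraint n P x \<longleftrightarrow> (1 / real n) * (\<Sum>i=1..n. (x i)\<^sup>2) \<le> P"

text \<open>
  The parameters \<open>R\<close> and \<open>R'\<close> are the rates of the message and of the fictitious message.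
  Measurability of the decoder makes its error probability meaningful.
\<close>

definition is_code ::
  "real \<Rightarrow> real \<Rightarrow> real \<Rightarrow> real \<Rightarrow> real \<Rightarrow> real \<Rightarrow> nat \<Rightarrow> secrecy_code \<Rightarrow> bool" where
  "is_code P1 P2 C1 C2 R' R n c \<longleftrightarrow>
     (\<forall>w\<in>{1..num_msgs n R}. \<forall>m\<in>{1..num_msgs n R'}.
        src_enc c w m \<in> {1..num_msgs n C1} \<times> {1..num_msgs n C2}) \<and>
     (\<forall>j\<in>{1..num_msgs n C1}. \<forall>m\<in>{1..num_msgs n R'}. power_constraint n P1 (relay1 c j m)) \<and>
     (\<forall>j\<in>{1..num_msgs n C2}. \<forall>m\<in>{1..num_msgs n R'}. power_constraint n P2 (relay2 c j m)) \<and>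
     dec c \<in> measurable (\<Pi>\<^sub>M i\<in>{1..n}. borel) (count_space {1..num_msgs n R})"

definition gaussian_noise :: "nat \<Rightarrow> real \<Rightarrow> (nat \<Rightarrow> real) measure" where
  "gaussian_noise n v = (\<Pi>\<^sub>M i\<in>{1..n}. density lborel (normal_density 0 (sqrt v)))"

text \<open>
  The sample points are \<open>(w, m, u, v)\<close>: message, fictitious message, and the noise sequences at
  the destination (variance 1) and at the eavesdropper (variance \<open>1 - g\<close>), all independent.
\<close>

type_synonym sample = "nat \<times> nat \<times> (nat \<Rightarrow> real) \<times> (nat \<Rightarrow> real)"

definition code_space :: "real \<Rightarrow> real \<Rightarrow> real \<Rightarrow> nat \<Rightarrow> sample measure" where
  "code_space g R' R n =
     uniform_count_measure {1..num_msgs n R} \<Otimes>\<^sub>M uniform_count_measure {1..num_msgs n R'} \<Otimes>\<^sub>M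
     gaussian_noise n 1 \<Otimes>\<^sub>M gaussian_noise n (1 - g)"

definition msg :: "sample \<Rightarrow> nat" where
  "msg = (\<lambda>(w, m, u, v). w)"

definition dest_output :: "nat \<Rightarrow> secrecy_code \<Rightarrow> sample \<Rightarrow> nat \<Rightarrow> real" where
  "dest_output n c = (\<lambda>(w, m, u, v). \<lambda>i\<in>{1..n}.
     relay1 c (fst (src_enc c w m)) m i + relay2 c (snd (src_enc c w m)) m i + u i)"

definition eve_output :: "real \<Rightarrow> nat \<Rightarrow> secrecy_code \<Rightarrow> sample \<Rightarrow> nat \<Rightarrow> real" where
  "eve_output g n c = (\<lambda>(w, m, u, v). \<lambda>i\<in>{1..n}.
     sqrt g * dest_output n c (w, m, u, v) i + v i)"

definition error_prob :: "real \<Rightarrow> real \<Rightarrow> real \<Rightarrow> nat \<Rightarrow> secrecy_code \<Rightarrow> real" where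
  "error_prob g R' R n c = measure (code_space g R' R n)
     {\<omega> \<in> space (code_space g R' R n). dec c (dest_output n c \<omega>) \<noteq> msg \<omega>}"

definition leakage :: "real \<Rightarrow> real \<Rightarrow> real \<Rightarrow> nat \<Rightarrow> secrecy_code \<Rightarrow> real" where
  "leakage g R' R n c = prob_space.mutual_information (code_space g R' R n) 2
     (count_space {1..num_msgs n R}) (\<Pi>\<^sub>M i\<in>{1..n}. borel) msg (eve_output g n c)"

definition achievable ::
  "real \<Rightarrow> real \<Rightarrow> real \<Rightarrow> real \<Rightarrow> real \<Rightarrow> real \<Rightarrow> real \<Rightarrow> bool" where
  "achievable P1 P2 C1 C2 g R' R \<longleftrightarrow> R \<ge> 0 \<and>
     (\<exists>c :: nat \<Rightarrow> secrecy_code.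
        (\<forall>n. is_code P1 P2 C1 C2 R' R n (c n)) \<and>
        (\<lambda>n. error_prob g R' R n (c n)) \<longlonglongrightarrow> 0 \<and>
        (\<lambda>n. (1 / real n) * leakage g R' R n (c n)) \<longlonglongrightarrow> 0)"

definition secrecy_capacity ::
  "real \<Rightarrow> real \<Rightarrow> real \<Rightarrow> real \<Rightarrow> real \<Rightarrow> real \<Rightarrow> ereal" where
  "secrecy_capacity P1 P2 C1 C2 g R' =
     (SUP R\<in>{R. achievable P1 P2 C1 C2 g R' R}. ereal R)"

definition f1 :: "real \<Rightarrow> real \<Rightarrow> real \<Rightarrow> ereal" where
  "f1 C1 P2 \<rho> = ereal (C1 + 1/2 * log 2 (1 + (1 - \<rho>\<^sup>2) * P2))"

definition f2 :: "real \<Rightarrow> real \<Rightarrow> real \<Rightarrow> ereal" where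
  "f2 C2 P1 \<rho> = ereal (C2 + 1/2 * log 2 (1 + (1 - \<rho>\<^sup>2) * P1))"

definition f3 :: "real \<Rightarrow> real \<Rightarrow> real \<Rightarrow> ereal" where
  "f3 C1 C2 \<rho> =
     (if \<bar>\<rho>\<bar> = 1 then -\<infinity> else ereal (C1 + C2 - 1/2 * log 2 (1 / (1 - \<rho>\<^sup>2))))"

definition f4 :: "real \<Rightarrow> real \<Rightarrow> real \<Rightarrow> ereal" where
  "f4 P1 P2 \<rho> = ereal (1/2 * log 2 (1 + P1 + P2 + 2 * \<rho> * sqrt (P1 * P2)))"

definition f5 :: "real \<Rightarrow> real \<Rightarrow> real \<Rightarrow> real \<Rightarrow> ereal" where
  "f5 g P1 P2 \<rho> = ereal (1/2 * log 2 (1 + g * (P1 + P2 + 2 * \<rho> * sqrt (P1 * P2))))"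

definition rho_star :: "real \<Rightarrow> real \<Rightarrow> real" where
  "rho_star P1 P2 = sqrt (1 + 1 / (4 * P1 * P2)) - 1 / (2 * sqrt (P1 * P2))"

definition S1 :: "real \<Rightarrow> real \<Rightarrow> real \<Rightarrow> real \<Rightarrow> ereal" where
  "S1 P1 P2 C1 C2 = (SUP \<rho>\<in>{0..rho_star P1 P2}.
     Min {f1 C1 P2 \<rho>, f2 C2 P1 \<rho>, f3 C1 C2 \<rho>, f4 P1 P2 \<rho>})"

definition S2 :: "real \<Rightarrow> real \<Rightarrow> real \<Rightarrow> real \<Rightarrow> ereal" where
  "S2 P1 P2 C1 C2 = (SUP \<rho>\<in>{rho_star P1 P2<..1}.
     Min {f1 C1 P2 \<rho>, f2 C2 P1 \<rho>, f3 C1 C2 0, f4 P1 P2 \<rho>})"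

definition S3 :: "real \<Rightarrow> real \<Rightarrow> real \<Rightarrow> real \<Rightarrow> real \<Rightarrow> ereal" where
  "S3 P1 P2 C1 C2 g = (SUP \<rho>\<in>{0..rho_star P1 P2}.
     Min {f1 C1 P2 \<rho>, f2 C2 P1 \<rho>, f3 C1 C2 0, (f3 C1 C2 \<rho> + f4 P1 P2 \<rho>) / 2,
          f4 P1 P2 \<rho> - f5 g P1 P2 \<rho>})"

definition S4 :: "real \<Rightarrow> real \<Rightarrow> real \<Rightarrow> real \<Rightarrow> real \<Rightarrow> ereal" where
  "S4 P1 P2 C1 C2 g = (SUP \<rho>\<in>{rho_star P1 P2<..1}.
     Min {f1 C1 P2 \<rho>, f2 C2 P1 \<rho>, f3 C1 C2 0, f4 P1 P2 \<rho> - f5 g P1 P2 \<rho>})"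

end

(* Every information inequality of the converse is an instance of Gibbs' inequality: if a
   likelihood ratio L satisfies E L <= 1 then E (ln L) <= 0.  The decoder enters through the
   guess r(w|y) = 1/2 if w is decoded from y and 1/(2N) otherwise, a sub-probability in w, which
   replaces Fano's inequality, and Gaussian test densities replace the entropy bounds.  All codes
   are compared with the correlation coefficient rho of the two inputs averaged over messages and
   time.  Cut-set ratios give f1, f2, f3(0) and f4, and conditioning the legitimate output on the
   degraded one gives f4 - f5.

   For the dependence of the two link indices one passes to a noisier output U = Y + N' (Ozarow's
   device) and needs a lower bound on its entropy.  Bounding the entropy of Y given U yields
   (f3 + f4)/2.  The sharper bound with f3(rho') at the point rho' <= rho where f4(rho') = R
   needs the entropy power inequality for U, which is proved by monotone transport of one
   coordinate at a time; since Y is a finite Gaussian mixture, the transport map is smooth and at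
   bounded distance from the identity. *)

theory Submission
  imports Defs
begin

text \<open>The threshold \<open>rho_star\<close> comes from Ozarow's device. Gaussian inputs of
  powers P1, P2 and correlation x > 0 are independent given their noisy sum exactly when the total
  noise variance is sqrt(P1 P2) (1/x - x). Since Y already carries unit noise, the auxiliary noise
  has this variance minus 1, which is nonnegative exactly for x up to \<open>rho_star\<close>;
  beyond it only the cut f3(0) is left. S1 and S3 differ for the following reason. The entropy power
  inequality gives f3(x) at the point x where f4(x) = R, and x is at most rho. The bounds f1 and f2
  move from rho down to a nonnegative x, but f4 - f5 is increasing and can only move up from rho. So
  S3 is evaluated at rho, with the averaged bound (f3 + f4)/2. The fictitious message is known to
  both relays. It is conditioned on in all bounds for the legitimate link and averaged out only in
  the leakage, so its rate never enters and one bound serves every R'. No differential entropy is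
  ever defined: only expected log-densities occur, and these are integrable because mixtures of
  Gaussian densities lie between a multiple of one component and a constant.\<close>

section \<open>Products of Gaussian densities\<close>

text \<open>Otherwise \<open>{1..n}\<close> is rewritten to \<open>{Suc 0..n}\<close> and the measurability rules no longer apply.\<close>

declare One_nat_def [simp del]

abbreviation Ln :: "nat \<Rightarrow> (nat \<Rightarrow> real) measure" where
  "Ln n \<equiv> Pi\<^sub>M {1..n} (\<lambda>_. lborel)"

abbreviation Ln2 :: "nat \<Rightarrow> ((nat \<Rightarrow> real) \<times> (nat \<Rightarrow> real)) measure" where
  "Ln2 n \<equiv> Ln n \<Otimes>\<^sub>M Ln n"

text \<open>\<open>v\<close> is a variance, and only the coordinates in \<open>{1..n}\<close> of
  \<open>c\<close> and \<open>y\<close> are read.\<close>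

definition phi :: "nat \<Rightarrow> real \<Rightarrow> (nat \<Rightarrow> real) \<Rightarrow> (nat \<Rightarrow> real) \<Rightarrow> real" where
  "phi n v c y = (\<Prod>i\<in>{1..n}. normal_density (c i) (sqrt v) (y i))"

lemma sigma_finite_Ln: "sigma_finite_measure (Ln n)"
proof -
  interpret finite_product_sigma_finite "\<lambda>_::nat. lborel :: real measure" "{1..n}"
    by standard auto
  show ?thesis by (rule sigma_finite_measure_axioms)
qed

lemma pair_sigma_finite_Ln: "pair_sigma_finite (Ln n) (Ln m)"
  using sigma_finite_Ln by (simp add: pair_sigma_finite_def)

lemma sets_Ln_borel: "sets (Ln n) = sets (\<Pi>\<^sub>M i\<in>{1..n}. borel)"
  by (intro sets_PiM_cong) auto

lemma measurable_Ln_component [measurable]: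
  "i \<in> {1..n} \<Longrightarrow> (\<lambda>y. y i) \<in> borel_measurable (Ln n)"
  using measurable_component_singleton[of i "{1..n}" "\<lambda>_. lborel :: real measure"] by simp

lemma measurable_phi [measurable (raw)]:
  assumes "\<And>i. i \<in> {1..n} \<Longrightarrow> (\<lambda>x. c x i) \<in> borel_measurable M"
    and "\<And>i. i \<in> {1..n} \<Longrightarrow> (\<lambda>x. y x i) \<in> borel_measurable M"
  shows "(\<lambda>x. phi n v (c x) (y x)) \<in> borel_measurable M"
proof -
  have "(\<lambda>x. \<Prod>i\<in>{1..n}. normal_density (c x i) (sqrt v) (y x i)) \<in> borel_measurable M"
  proof (rule borel_measurable_prod)
    fix i assume "i \<in> {1..n}"
    note [measurable] = assms[OF this]
    show "(\<lambda>x. normal_density (c x i) (sqrt v) (y x i)) \<in> borel_measurable M"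
      unfolding normal_density_def by measurable
  qed
  then show ?thesis by (simp add: phi_def)
qed

lemma phi_pos: "v > 0 \<Longrightarrow> phi n v c y > 0"
  by (auto simp: phi_def intro!: prod_pos normal_density_pos)

lemma phi_nonneg [simp]: "phi n v c y \<ge> 0"
  by (auto simp: phi_def intro!: prod_nonneg)

lemma ln_normal_density:
  assumes "v > 0"
  shows "ln (normal_density c (sqrt v) y) = - 1/2 * ln (2 * pi * v) - (y - c)\<^sup>2 / (2 * v)"
  using assms by (simp add: normal_density_def ln_mult ln_div ln_sqrt ln_realpow)

lemma ln_phi:
  assumes "v > 0"
  shows "ln (phi n v c y) = - real n / 2 * ln (2 * pi * v) - (\<Sum>i=1..n. (y i - c i)\<^sup>2) / (2 * v)"
proof -
  have "ln (phi n v c y) = (\<Sum>i=1..n. - 1/2 * ln (2 * pi * v) - (y i - c i)\<^sup>2 / (2 * v))"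
    unfolding phi_def using assms
    by (subst ln_prod)
       (auto intro!: sum.cong simp: ln_normal_density normal_density_pos[THEN less_imp_neq, symmetric])
  then show ?thesis by (simp add: sum_subtractf sum_divide_distrib)
qed

lemma phi_le:
  assumes "v > 0"
  shows "phi n v c y \<le> exp (- real n / 2 * ln (2 * pi * v))"
proof -
  have "ln (phi n v c y) \<le> - real n / 2 * ln (2 * pi * v)"
    using assms by (simp add: ln_phi sum_nonneg)
  then show ?thesis using phi_pos[OF assms, of n c y] by (metis exp_le_cancel_iff exp_ln)
qed

lemma nn_integral_normal_density:
  assumes "\<sigma> > 0"
  shows "(\<integral>\<^sup>+x. ennreal (normal_density c \<sigma> x) \<partial>lborel) = 1"
  using integral_normal_density[OF assms, of c] integrable_normal_density[OF assms, of c]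
  by (subst nn_integral_eq_integral) auto

lemma nn_integral_phi:
  assumes "v > 0"
  shows "(\<integral>\<^sup>+y. ennreal (phi n v c y) \<partial>Ln n) = 1"
proof -
  interpret product_sigma_finite "\<lambda>_::nat. lborel :: real measure" by standard
  show ?thesis
    unfolding phi_def using assms
    by (subst prod_ennreal[symmetric], simp, subst product_nn_integral_prod)
       (auto simp: nn_integral_normal_density)
qed

text \<open>Bayes' rule for Y = s + N with unit noise and U = a Y + N' with noise of variance
  \<open>v\<close>: on the right stand the marginal of U and the posterior of Y. The exponents agree
  by completing the square in \<open>y\<close>, the constants because both pairs of variances have
  the same product.\<close>

lemma normal_density_swap:
  fixes a v s y u :: real
  assumes "v > 0"
  defines "\<tau> \<equiv> a\<^sup>2 + v"
  shows "normal_density s (sqrt 1) y * normal_density (a * y) (sqrt v) u =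
    normal_density (a * s) (sqrt \<tau>) u * normal_density (s + a / \<tau> * (u - a * s)) (sqrt (v / \<tau>)) y"
proof -
  have tau: "\<tau> > 0" using assms by (simp add: add_nonneg_pos)
  have "(y - s)\<^sup>2 / 2 + (u - a * y)\<^sup>2 / (2 * v) =
      (u - a * s)\<^sup>2 / (2 * \<tau>) + (y - (s + a / \<tau> * (u - a * s)))\<^sup>2 / (2 * (v / \<tau>))"
  proof -
    \<comment> \<open>In centred variables the shift \<open>s\<close> disappears and a quadratic
      form in two variables remains.\<close>
    define p where "p = y - s"
    define q where "q = u - a * s"
    have 1: "u - a * y = q - a * p" "y - (s + a / \<tau> * (u - a * s)) = p - a / \<tau> * q"
      by (simp_all add: p_def q_def algebra_simps)
    have "p\<^sup>2 / 2 + (q - a * p)\<^sup>2 / (2 * v) = (p\<^sup>2 * \<tau> + q\<^sup>2 - 2 * a * p * q) / (2 * v)"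
      using assms(1) by (simp add: \<tau>_def field_simps power2_eq_square)
    also have "\<dots> = q\<^sup>2 / (2 * \<tau>) + (p - a / \<tau> * q)\<^sup>2 / (2 * (v / \<tau>))"
    proof -
      have "(p - a / \<tau> * q)\<^sup>2 / (2 * (v / \<tau>)) = (p\<^sup>2 * \<tau> - 2 * a * p * q + a\<^sup>2 * q\<^sup>2 / \<tau>) / (2 * v)"
        using tau assms(1) by (simp add: field_simps power2_eq_square)
      moreover have "q\<^sup>2 / (2 * \<tau>) = (q\<^sup>2 - a\<^sup>2 * q\<^sup>2 / \<tau>) / (2 * v)"
      proof -
        have v: "v = \<tau> - a\<^sup>2" by (simp add: \<tau>_def)
        have "q\<^sup>2 * v = (q\<^sup>2 - a\<^sup>2 * q\<^sup>2 / \<tau>) * \<tau>" using tau unfolding v by (simp add: algebra_simps)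
        then show ?thesis using tau assms(1) by (subst frac_eq_eq) auto
      qed
      ultimately show ?thesis by (simp add: add_divide_distrib diff_divide_distrib)
    qed
    finally show ?thesis unfolding 1 unfolding p_def[symmetric] q_def[symmetric] .
  qed
  then have "exp (- ((y - s)\<^sup>2 / 2)) * exp (- ((u - a * y)\<^sup>2 / (2 * v))) =
      exp (- ((u - a * s)\<^sup>2 / (2 * \<tau>))) * exp (- ((y - (s + a / \<tau> * (u - a * s)))\<^sup>2 / (2 * (v / \<tau>))))"
    by (simp add: exp_add[symmetric])
  moreover have "sqrt (2 * pi * 1) * sqrt (2 * pi * v) = sqrt (2 * pi * \<tau>) * sqrt (2 * pi * (v / \<tau>))"
    using tau by (simp add: real_sqrt_mult[symmetric])
  ultimately show ?thesis
    using assms(1) tau unfolding normal_density_def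
    by (simp add: times_divide_times_eq)
qed

text \<open>The conditional mean of Y at time \<open>i\<close> given the output \<open>u\<close> and
  the codeword \<open>s\<close>; \<open>a / (a\<^sup>2 + v)\<close> is the Wiener gain for unit
  input noise.\<close>

definition postmean :: "real \<Rightarrow> real \<Rightarrow> (nat \<Rightarrow> real) \<Rightarrow> (nat \<Rightarrow> real) \<Rightarrow> nat \<Rightarrow> real" where
  "postmean a v s u i = s i + a / (a\<^sup>2 + v) * (u i - a * s i)"

lemma phi_swap:
  assumes "v > 0"
  shows "phi n 1 s y * phi n v (\<lambda>i. a * y i) u =
    phi n (a\<^sup>2 + v) (\<lambda>i. a * s i) u * phi n (v / (a\<^sup>2 + v)) (postmean a v s u) y"
  unfolding phi_def prod.distrib[symmetric] postmean_def using normal_density_swap[OF assms]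
  by (intro prod.cong) auto

text \<open>Expanding about the mean \<open>c\<close> leaves only central moments: the first
  vanishes and the second contributes \<open>\<beta>\<^sup>2 * v\<close>.\<close>

lemma nn_integral_normal_quad:
  assumes "v > 0"
  shows "(\<integral>\<^sup>+x. ennreal (normal_density c (sqrt v) x) * ennreal ((\<alpha> + \<beta> * x)\<^sup>2) \<partial>lborel) =
    ennreal ((\<alpha> + \<beta> * c)\<^sup>2 + \<beta>\<^sup>2 * v)"
proof -
  let ?n = "normal_density c (sqrt v)"
  have s: "sqrt v > 0" using assms by simp
  have 1: "has_bochner_integral lborel (\<lambda>x. ?n x * (x - c)^2) v"
    using normal_moment_even[OF s, of c 1] assms by simp
  have 2: "has_bochner_integral lborel (\<lambda>x. ?n x * (x - c)) 0"
    using normal_moment_odd[OF s, of c 0] by simp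
  have 3: "has_bochner_integral lborel ?n 1"
    using integral_normal_density[OF s] integrable_normal_density[OF s] by (simp add: has_bochner_integral_iff)
  have "has_bochner_integral lborel (\<lambda>x. \<beta>\<^sup>2 * (?n x * (x - c)^2) + (2 * (\<alpha> + \<beta> * c) * \<beta> * (?n x * (x - c)) + (\<alpha> + \<beta> * c)\<^sup>2 * ?n x))
     (\<beta>\<^sup>2 * v + (2 * (\<alpha> + \<beta> * c) * \<beta> * 0 + (\<alpha> + \<beta> * c)\<^sup>2 * 1))"
    using 1 2 3 by (intro has_bochner_integral_add has_bochner_integral_mult_right) auto
  moreover have "(\<lambda>x. \<beta>\<^sup>2 * (?n x * (x - c)^2) + (2 * (\<alpha> + \<beta> * c) * \<beta> * (?n x * (x - c)) + (\<alpha> + \<beta> * c)\<^sup>2 * ?n x))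
     = (\<lambda>x. ?n x * (\<alpha> + \<beta> * x)\<^sup>2)"
    by (intro ext) (simp add: power2_eq_square algebra_simps)
  ultimately have *: "has_bochner_integral lborel (\<lambda>x. ?n x * (\<alpha> + \<beta> * x)\<^sup>2) ((\<alpha> + \<beta> * c)\<^sup>2 + \<beta>\<^sup>2 * v)"
    by (simp add: add.commute)
  have "(\<integral>\<^sup>+x. ennreal (?n x * (\<alpha> + \<beta> * x)\<^sup>2) \<partial>lborel) = ennreal ((\<alpha> + \<beta> * c)\<^sup>2 + \<beta>\<^sup>2 * v)"
    using * by (subst nn_integral_eq_integral) (auto simp: has_bochner_integral_iff)
  then show ?thesis by (simp add: ennreal_mult')
qed

lemma nn_integral_phi_component:
  assumes "v > 0" "i \<in> {1..n}" and [measurable]: "h \<in> borel_measurable borel"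
  shows "(\<integral>\<^sup>+y. ennreal (phi n v c y) * h (y i) \<partial>Ln n) =
    (\<integral>\<^sup>+x. ennreal (normal_density (c i) (sqrt v) x) * h x \<partial>lborel)"
proof -
  interpret product_sigma_finite "\<lambda>_::nat. lborel :: real measure" by standard
  let ?f = "\<lambda>j x. ennreal (normal_density (c j) (sqrt v) x) * (if j = i then h x else 1)"
  have "(\<integral>\<^sup>+y. ennreal (phi n v c y) * h (y i) \<partial>Ln n) = (\<integral>\<^sup>+y. (\<Prod>j\<in>{1..n}. ?f j (y j)) \<partial>Ln n)"
    using assms(2) unfolding phi_def
    by (intro nn_integral_cong) (simp add: prod_ennreal prod.distrib prod.delta)
  also have "\<dots> = (\<Prod>j\<in>{1..n}. \<integral>\<^sup>+x. ?f j x \<partial>lborel)"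
    by (intro product_nn_integral_prod) auto
  also have "\<dots> = (\<Prod>j\<in>{1..n}. if j = i then \<integral>\<^sup>+x. ennreal (normal_density (c i) (sqrt v) x) * h x \<partial>lborel else 1)"
    using assms(1) by (intro prod.cong) (auto simp: nn_integral_normal_density)
  finally show ?thesis using assms(2) by (simp add: prod.delta)
qed

lemma nn_integral_phi_quad:
  assumes "v > 0" "i \<in> {1..n}"
  shows "(\<integral>\<^sup>+y. ennreal (phi n v c y) * ennreal ((\<alpha> + \<beta> * y i)\<^sup>2) \<partial>Ln n) = ennreal ((\<alpha> + \<beta> * c i)\<^sup>2 + \<beta>\<^sup>2 * v)"
  using nn_integral_phi_component[OF assms, of "\<lambda>x. ennreal ((\<alpha> + \<beta> * x)\<^sup>2)" c]
    nn_integral_normal_quad[OF assms(1)] by simp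

text \<open>Links the noise of the model, a product measure, with the density \<open>phi\<close>
  used everywhere else. Both sides are identified with the product of normal laws centred at the
  \<open>c i\<close>, because they agree with it on boxes.\<close>

lemma distr_gaussian_noise_shift:
  assumes v: "v > 0"
  shows "distr (gaussian_noise n v) (Ln n) (\<lambda>u. \<lambda>i\<in>{1..n}. c i + u i) = density (Ln n) (\<lambda>y. ennreal (phi n v c y))"
proof -
  let ?N = "\<lambda>c. density lborel (\<lambda>x. ennreal (normal_density c (sqrt v) x)) :: real measure"
  have ps: "prob_space (?N c)" for c using v by (intro prob_space_normal_density) auto
  interpret L: product_sigma_finite "\<lambda>_::nat. lborel :: real measure" by standard
  interpret N: product_prob_space "\<lambda>i. ?N (c i)" by (intro product_prob_spaceI ps)
  interpret Z: product_prob_space "\<lambda>_::nat. ?N 0" by (intro product_prob_spaceI ps)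
  have setsN: "sets (Pi\<^sub>M {1..n} (\<lambda>i. ?N (d i))) = sets (Ln n)" for d
    by (intro sets_PiM_cong) auto
  have m: "(\<lambda>u. \<lambda>i\<in>{1..n}. c i + u i) \<in> measurable (gaussian_noise n v) (Ln n)"
    unfolding gaussian_noise_def
    by (intro measurable_restrict) (auto intro!: borel_measurable_add measurable_component_singleton[THEN measurable_compose]
       simp: measurable_cong_sets[OF setsN refl])
  have "distr (gaussian_noise n v) (Ln n) (\<lambda>u. \<lambda>i\<in>{1..n}. c i + u i) = Pi\<^sub>M {1..n} (\<lambda>i. ?N (c i))"
  proof (rule N.PiM_eqI)
    fix A assume A: "\<And>i. i \<in> {1..n} \<Longrightarrow> A i \<in> sets (?N (c i))"
    have A': "(\<Pi>\<^sub>E i\<in>{1..n}. A i) \<in> sets (Ln n)" using A by (intro sets_PiM_I_finite) auto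
    have B: "(\<lambda>x. c i + x) -` A i \<in> sets borel" if "i \<in> {1..n}" for i
      using measurable_sets[of "\<lambda>x. c i + x" borel borel "A i"] A[OF that] by simp
    have "emeasure (distr (gaussian_noise n v) (Ln n) (\<lambda>u. \<lambda>i\<in>{1..n}. c i + u i)) (\<Pi>\<^sub>E i\<in>{1..n}. A i) =
       emeasure (gaussian_noise n v) (\<Pi>\<^sub>E i\<in>{1..n}. (\<lambda>x. c i + x) -` A i)"
      unfolding emeasure_distr[OF m A']
      by (intro arg_cong2[where f=emeasure] refl)
         (auto simp: gaussian_noise_def space_PiM PiE_iff restrict_def extensional_def)
    also have "\<dots> = (\<Prod>i\<in>{1..n}. emeasure (?N 0) ((\<lambda>x. c i + x) -` A i))"
      unfolding gaussian_noise_def using B by (intro Z.emeasure_PiM) auto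
    also have "\<dots> = (\<Prod>i\<in>{1..n}. emeasure (?N (c i)) (A i))"
    proof (intro prod.cong refl)
      fix i assume i: "i \<in> {1..n}"
      have "emeasure (?N (c i)) (A i) = (\<integral>\<^sup>+x. ennreal (normal_density (c i) (sqrt v) x) * indicator (A i) x \<partial>lborel)"
        using A[OF i] by (subst emeasure_density) auto
      also have "\<dots> = (\<integral>\<^sup>+x. ennreal (normal_density (c i) (sqrt v) (c i + 1 * x)) * indicator (A i) (c i + 1 * x) \<partial>lborel)"
        using A[OF i] by (subst nn_integral_real_affine[where c=1 and t="c i"]) auto
      also have "\<dots> = (\<integral>\<^sup>+x. ennreal (normal_density 0 (sqrt v) x) * indicator ((\<lambda>x. c i + x) -` A i) x \<partial>lborel)"
        by (intro nn_integral_cong) (simp add: normal_density_def indicator_def)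
      finally show "emeasure (?N 0) ((\<lambda>x. c i + x) -` A i) = emeasure (?N (c i)) (A i)"
        using B[OF i] by (subst emeasure_density) auto
    qed
    finally show "emeasure (distr (gaussian_noise n v) (Ln n) (\<lambda>u. \<lambda>i\<in>{1..n}. c i + u i)) (\<Pi>\<^sub>E i\<in>{1..n}. A i) =
       (\<Prod>i\<in>{1..n}. emeasure (?N (c i)) (A i))" .
  qed (auto simp: setsN)
  also have "\<dots> = density (Ln n) (\<lambda>y. ennreal (phi n v c y))"
  proof (rule N.PiM_eqI[symmetric])
    fix A assume A: "\<And>i. i \<in> {1..n} \<Longrightarrow> A i \<in> sets (?N (c i))"
    have A': "(\<Pi>\<^sub>E i\<in>{1..n}. A i) \<in> sets (Ln n)" using A by (intro sets_PiM_I_finite) auto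
    have "emeasure (density (Ln n) (\<lambda>y. ennreal (phi n v c y))) (\<Pi>\<^sub>E i\<in>{1..n}. A i) =
       (\<integral>\<^sup>+y. ennreal (phi n v c y) * indicator (\<Pi>\<^sub>E i\<in>{1..n}. A i) y \<partial>Ln n)"
      using A' by (subst emeasure_density) auto
    also have "\<dots> = (\<integral>\<^sup>+y. (\<Prod>i\<in>{1..n}. ennreal (normal_density (c i) (sqrt v) (y i)) * indicator (A i) (y i)) \<partial>Ln n)"
    proof (intro nn_integral_cong)
      fix y :: "nat \<Rightarrow> real" assume "y \<in> space (Ln n)"
      then have "indicator (\<Pi>\<^sub>E i\<in>{1..n}. A i) y = (\<Prod>i\<in>{1..n}. indicator (A i) (y i) :: ennreal)"
        by (auto simp: indicator_def space_PiM PiE_iff intro!: prod.neutral[symmetric] prod_zero[symmetric])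
      then show "ennreal (phi n v c y) * indicator (\<Pi>\<^sub>E i\<in>{1..n}. A i) y =
         (\<Prod>i\<in>{1..n}. ennreal (normal_density (c i) (sqrt v) (y i)) * indicator (A i) (y i))"
        by (simp add: phi_def prod_ennreal prod.distrib)
    qed
    also have "\<dots> = (\<Prod>i\<in>{1..n}. \<integral>\<^sup>+x. ennreal (normal_density (c i) (sqrt v) x) * indicator (A i) x \<partial>lborel)"
      using A by (intro L.product_nn_integral_prod) auto
    also have "\<dots> = (\<Prod>i\<in>{1..n}. emeasure (?N (c i)) (A i))"
      using A by (intro prod.cong) (auto simp: emeasure_density)
    finally show "emeasure (density (Ln n) (\<lambda>y. ennreal (phi n v c y))) (\<Pi>\<^sub>E i\<in>{1..n}. A i) =
       (\<Prod>i\<in>{1..n}. emeasure (?N (c i)) (A i))" .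
  qed (auto simp: setsN)
  finally show ?thesis .
qed

lemma measurable_gaussian_noise_shift:
  assumes "\<And>i. i \<in> {1..n} \<Longrightarrow> c i \<in> borel_measurable M" and "v > 0"
    and "U \<in> measurable M (gaussian_noise n v)"
  shows "(\<lambda>x. \<lambda>i\<in>{1..n}. c i x + U x i) \<in> measurable M (Ln n)"
proof -
  have "sets (gaussian_noise n v) = sets (Ln n)"
    unfolding gaussian_noise_def by (intro sets_PiM_cong) auto
  then have [measurable]: "U \<in> measurable M (Ln n)" using assms(3) measurable_cong_sets by blast
  show ?thesis
    by (intro measurable_restrict) (use assms(1) in \<open>auto intro!: borel_measurable_add measurable_compose[OF \<open>U \<in> measurable M (Ln n)\<close>]\<close>)
qed

lemma nn_integral_gaussian_noise_shift:
  assumes "v > 0" and [measurable]: "h \<in> borel_measurable (Ln n)"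
  shows "(\<integral>\<^sup>+u. h (\<lambda>i\<in>{1..n}. c i + u i) \<partial>gaussian_noise n v) = (\<integral>\<^sup>+y. ennreal (phi n v c y) * h y \<partial>Ln n)"
proof -
  have m: "(\<lambda>u. \<lambda>i\<in>{1..n}. c i + u i) \<in> measurable (gaussian_noise n v) (Ln n)"
    by (rule measurable_gaussian_noise_shift[OF _ assms(1)]) auto
  have "(\<integral>\<^sup>+u. h (\<lambda>i\<in>{1..n}. c i + u i) \<partial>gaussian_noise n v) =
      (\<integral>\<^sup>+y. h y \<partial>distr (gaussian_noise n v) (Ln n) (\<lambda>u. \<lambda>i\<in>{1..n}. c i + u i))"
    using m by (subst nn_integral_distr) auto
  also have "\<dots> = (\<integral>\<^sup>+y. ennreal (phi n v c y) * h y \<partial>Ln n)"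
    unfolding distr_gaussian_noise_shift[OF assms(1)] by (subst nn_integral_density) auto
  finally show ?thesis .
qed

section \<open>An entropy power inequality for Gaussian mixtures\<close>

text \<open>\<open>V\<close> is monotone but possibly not onto, so the change of variables survives
  only as an inequality; the entropy power inequality asks for no more. The proof shows that the
  image under \<open>V\<close> of the measure with density \<open>V'\<close> is dominated by
  Lebesgue measure.\<close>

lemma nn_integral_subst_le:
  fixes V V' :: "real \<Rightarrow> real" and q :: "real \<Rightarrow> ennreal"
  assumes V: "\<And>x. (V has_real_derivative V' x) (at x)"
    and V': "continuous_on UNIV V'" and nn: "\<And>x. V' x \<ge> 0"
    and [measurable]: "q \<in> borel_measurable borel"
  shows "(\<integral>\<^sup>+x. ennreal (V' x) * q (V x) \<partial>lborel) \<le> (\<integral>\<^sup>+x. q x \<partial>lborel)"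
proof -
  have [measurable]: "V' \<in> borel_measurable borel"
    using V' by (rule borel_measurable_continuous_onI)
  have "continuous_on UNIV V"
    using V by (meson DERIV_isCont continuous_at_imp_continuous_on)
  then have [measurable]: "V \<in> borel_measurable borel"
    by (rule borel_measurable_continuous_onI)
  let ?D = "density lborel (\<lambda>x. ennreal (V' x))"
  have "distr ?D lborel V \<le> lborel"
  proof (rule le_measure[THEN iffD2], simp, intro ballI)
    show "emeasure (distr ?D lborel V) A \<le> emeasure lborel A" for A
    proof (cases "A \<in> sets borel")
      case True
      note [measurable] = True
      have [measurable]: "V -` A \<in> sets borel" using measurable_sets[of V borel borel A] by simp
      have 1: "emeasure (distr ?D lborel V) A = (\<integral>\<^sup>+x. ennreal (V' x) * indicator A (V x) \<partial>lborel)"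
        by (subst emeasure_distr, simp, simp, subst emeasure_density) (auto simp: indicator_def intro!: nn_integral_cong)
      \<comment> \<open>The line is exhausted by the intervals \<open>{-k..k}\<close>, where the
        substitution rule applies; monotone convergence gives the whole integral.\<close>
      also have "\<dots> = (\<integral>\<^sup>+x. (SUP k::nat. ennreal (indicator A (V x) * V' x * indicator {-real k..real k} x)) \<partial>lborel)"
      proof (intro nn_integral_cong)
        fix x :: real
        obtain k0 :: nat where k0: "\<bar>x\<bar> \<le> real k0" using real_arch_simple by blast
        show "ennreal (V' x) * indicator A (V x) = (SUP k::nat. ennreal (indicator A (V x) * V' x * indicator {-real k..real k} x))"
          using k0 nn[of x] by (intro antisym SUP_least)
            (auto simp: indicator_def intro!: SUP_upper2[of k0])
      qed
      also have "\<dots> = (SUP k::nat. (\<integral>\<^sup>+x. ennreal (indicator A (V x) * V' x * indicator {-real k..real k} x) \<partial>lborel))"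
        using nn by (intro nn_integral_monotone_convergence_SUP)
          (auto simp: incseq_def le_fun_def indicator_def)
      also have "\<dots> \<le> emeasure lborel A"
      proof (rule SUP_least)
        fix k :: nat
        have "(\<integral>\<^sup>+x. ennreal (indicator A (V x) * V' x * indicator {-real k..real k} x) \<partial>lborel) =
           (\<integral>\<^sup>+x. ennreal (indicator A x * indicator {V (-real k)..V (real k)} x) \<partial>lborel)"
          by (intro nn_integral_substitution[symmetric])
             (use V V' nn in \<open>auto simp: set_borel_measurable_def intro: continuous_on_subset\<close>)
        also have "\<dots> \<le> (\<integral>\<^sup>+x. indicator A x \<partial>lborel)"
          by (intro nn_integral_mono) (auto simp: indicator_def)
        finally show "(\<integral>\<^sup>+x. ennreal (indicator A (V x) * V' x * indicator {-real k..real k} x) \<partial>lborel) \<le> emeasure lborel A"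
          by simp
      qed
      finally show ?thesis .
    qed (simp add: emeasure_notin_sets)
  qed
  then have "(\<integral>\<^sup>+x. q x \<partial>distr ?D lborel V) \<le> (\<integral>\<^sup>+x. q x \<partial>lborel)"
    by (intro nn_integral_mono_measure) auto
  then show ?thesis
    by (simp add: nn_integral_distr nn_integral_density)
qed

lemma ln_std_normal_density: "ln (std_normal_density x) = - 1/2 * ln (2 * pi) - x\<^sup>2 / 2"
  using ln_normal_density[of 1 0 x] by simp

text \<open>Made for Lieb's linear form of the entropy power inequality, with
  \<open>c\<^sup>2 + s\<^sup>2 = 1\<close>: \<open>S\<close> is the input transported to a standard
  Gaussian, \<open>G\<close> the normalised noise. If S G has mean 0 and the square of G mean 1, the
  expected logarithm is the one-dimensional constant by which h(Y + N') is shown to exceed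
  \<open>c\<^sup>2\<close> h(Y).\<close>

definition epi_weight :: "real \<Rightarrow> real \<Rightarrow> real \<Rightarrow> real \<Rightarrow> real \<Rightarrow> real" where
  "epi_weight c s v S G = exp (s\<^sup>2 / 2 * ln (2 * pi) - c\<^sup>2 * ln c + s\<^sup>2 * ln (sqrt v / s) + c * s * S * G + s\<^sup>2 * G\<^sup>2 / 2)"

text \<open>\<open>c * g - s * S\<close> is one coordinate of the rotated pair (S, G). With it held
  fixed, the output moves with the input at the rate \<open>(c + sqrt v * s * d) / c\<close>, where
  \<open>d\<close> is the derivative of the transport. Concavity of the logarithm bounds the
  log-rate from below linearly in \<open>ln f\<close>, and \<open>epi_weight\<close> collects the
  remaining terms.\<close>

lemma epi_weight_bound:
  fixes c s v f S g :: real
  assumes cs: "c > 0" "s > 0" "c\<^sup>2 + s\<^sup>2 = 1" and v: "v > 0" and f: "f > 0"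
  shows "f powr s\<^sup>2 * std_normal_density g * epi_weight c s v S g \<le>
    std_normal_density (c * g - s * S) * (c + sqrt v * s * (f / std_normal_density S))"
proof -
  have pS: "std_normal_density x > 0" for x by (rule normal_density_pos) simp
  define d where "d = f / std_normal_density S"
  have d: "d > 0" using f pS by (simp add: d_def)
  \<comment> \<open>Jensen with weights \<open>c\<^sup>2\<close>, \<open>s\<^sup>2\<close>; the
    points \<open>1 / c\<close> and \<open>sqrt v * d / s\<close> are chosen so that their convex
    combination is \<open>c + sqrt v * s * d\<close>.\<close>
  have "c\<^sup>2 * ln (1 / c) + s\<^sup>2 * ln (sqrt v * d / s) \<le> ln (c\<^sup>2 * (1 / c) + s\<^sup>2 * (sqrt v * d / s))"
  proof -
    have "1 / c > 0" "sqrt v * d / s > 0" "c\<^sup>2 \<ge> 0" "s\<^sup>2 \<ge> 0" using cs v d by auto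
    moreover have "\<forall>x\<in>{0<..}. \<forall>y\<in>{0<..}. \<forall>u\<ge>0. \<forall>v\<ge>0. u + v = 1 \<longrightarrow> u * ln x + v * ln y \<le> ln (u * x + v * y :: real)"
      using ln_concave by (simp add: concave_on_iff)
    ultimately show ?thesis using cs(3) by blast
  qed
  also have "c\<^sup>2 * (1 / c) + s\<^sup>2 * (sqrt v * d / s) = c + sqrt v * s * d"
    using cs by (simp add: power2_eq_square)
  finally have A: "c\<^sup>2 * ln (1 / c) + s\<^sup>2 * ln (sqrt v * d / s) \<le> ln (c + sqrt v * s * d)" .
  have lnd: "ln d = ln f + 1/2 * ln (2 * pi) + S\<^sup>2 / 2"
    using f pS[of S] ln_std_normal_density[of S] by (simp add: d_def ln_div)
  have lnvs: "ln (sqrt v * d / s) = ln (sqrt v / s) + ln d"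
    using v d cs by (simp add: ln_mult ln_div)
  have lnc: "ln (1 / c) = - ln c" using cs by (simp add: ln_div)
  have P: "c + sqrt v * s * d > 0" using cs v d by (auto intro!: add_pos_pos)
  have c2: "c\<^sup>2 = 1 - s\<^sup>2" using cs(3) by simp
  \<comment> \<open>Completes the square in the rotated coordinate; the leftover
    \<open>s\<^sup>2 * (S\<^sup>2 / 2)\<close> is what \<open>s\<^sup>2 * ln d\<close> contributes
    through the Gaussian density at \<open>S\<close>.\<close>
  have quad: "- g\<^sup>2 / 2 + c * s * S * g + s\<^sup>2 * g\<^sup>2 / 2 = - (c * g - s * S)\<^sup>2 / 2 + s\<^sup>2 * (S\<^sup>2 / 2)"
  proof -
    have "c\<^sup>2 * g\<^sup>2 = g\<^sup>2 - s\<^sup>2 * g\<^sup>2" unfolding c2 by (simp add: algebra_simps)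
    then show ?thesis by (simp add: power2_diff power_mult_distrib field_simps)
  qed
  have "ln (f powr s\<^sup>2 * std_normal_density g * epi_weight c s v S g) =
      s\<^sup>2 * ln f + ln (std_normal_density g) + ln (epi_weight c s v S g)"
    using f pS[of g] by (simp add: ln_mult ln_powr epi_weight_def)
  also have "\<dots> = (s\<^sup>2 * ln f + s\<^sup>2 / 2 * ln (2 * pi) - c\<^sup>2 * ln c + s\<^sup>2 * ln (sqrt v / s)) - 1/2 * ln (2 * pi) +
       (- g\<^sup>2 / 2 + c * s * S * g + s\<^sup>2 * g\<^sup>2 / 2)"
    unfolding ln_std_normal_density by (simp add: epi_weight_def)
  also have "\<dots> = ln (std_normal_density (c * g - s * S)) + (c\<^sup>2 * ln (1 / c) + s\<^sup>2 * ln (sqrt v * d / s))"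
    unfolding quad ln_std_normal_density lnvs lnd lnc by (simp add: algebra_simps)
  also have "\<dots> \<le> ln (std_normal_density (c * g - s * S)) + ln (c + sqrt v * s * d)" using A by simp
  also have "\<dots> = ln (std_normal_density (c * g - s * S) * (c + sqrt v * s * d))"
    using P pS[of "c * g - s * S"] by (simp add: ln_mult)
  finally show ?thesis
    unfolding d_def[symmetric] using f P pS
    by (subst (asm) ln_le_cancel_iff) (auto simp: epi_weight_def intro!: mult_pos_pos)
qed

text \<open>The noise variable is exchanged for the rotated coordinate \<open>b\<close>, which
  carries a standard Gaussian weight. For fixed \<open>b\<close> the output is an increasing
  function of \<open>t\<close> whose derivative is exactly the remaining factor, so integrating over
  \<open>t\<close> leaves at most the integral of \<open>q\<close>.\<close>

lemma epi_one_dim: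
  fixes c s v :: real and f S :: "real \<Rightarrow> real" and q :: "real \<Rightarrow> ennreal"
  assumes cs: "c > 0" "s > 0" "c\<^sup>2 + s\<^sup>2 = 1" and v: "v > 0"
    and f: "\<And>t. f t > 0" "continuous_on UNIV f"
    and S: "\<And>t. (S has_real_derivative f t / std_normal_density (S t)) (at t)"
    and [measurable]: "q \<in> borel_measurable borel"
  shows "(\<integral>\<^sup>+t. \<integral>\<^sup>+u. ennreal (f t powr s\<^sup>2 * normal_density t (sqrt v) u * epi_weight c s v (S t) ((u - t) / sqrt v)) * q u \<partial>lborel \<partial>lborel)
    \<le> (\<integral>\<^sup>+u. q u \<partial>lborel)"
proof -
  have pS: "std_normal_density x > 0" for x by (rule normal_density_pos) simp
  define d where "d t = f t / std_normal_density (S t)" for t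
  have d: "d t > 0" for t using f(1) pS by (simp add: d_def)
  have contS: "continuous_on UNIV S"
    using S by (meson DERIV_isCont continuous_at_imp_continuous_on)
  have contd: "continuous_on UNIV d"
    unfolding d_def normal_density_def
    by (intro continuous_intros contS f(2)) auto
  have [measurable]: "f \<in> borel_measurable borel" "S \<in> borel_measurable borel" "d \<in> borel_measurable borel"
    using contS contd f(2) by (auto intro: borel_measurable_continuous_onI)
  have [measurable]: "(\<lambda>x. epi_weight c s v (a x) (b x)) \<in> borel_measurable M"
    if [measurable]: "a \<in> borel_measurable M" "b \<in> borel_measurable M" for a b and M :: "'x measure"
    unfolding epi_weight_def by measurable
  let ?r = "sqrt v"
  have r: "?r > 0" using v by simp
  have "(\<integral>\<^sup>+t. \<integral>\<^sup>+u. ennreal (f t powr s\<^sup>2 * normal_density t ?r u * epi_weight c s v (S t) ((u - t) / ?r)) * q u \<partial>lborel \<partial>lborel)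
     = (\<integral>\<^sup>+t. ?r * (\<integral>\<^sup>+g. ennreal (f t powr s\<^sup>2 * normal_density t ?r (t + ?r * g) * epi_weight c s v (S t) g) * q (t + ?r * g) \<partial>lborel) \<partial>lborel)"
  proof (intro nn_integral_cong)
    fix t :: real
    show "(\<integral>\<^sup>+u. ennreal (f t powr s\<^sup>2 * normal_density t ?r u * epi_weight c s v (S t) ((u - t) / ?r)) * q u \<partial>lborel) =
       ?r * (\<integral>\<^sup>+g. ennreal (f t powr s\<^sup>2 * normal_density t ?r (t + ?r * g) * epi_weight c s v (S t) g) * q (t + ?r * g) \<partial>lborel)"
      by (subst nn_integral_real_affine[where c="?r" and t=t]) (use r in auto)
  qed
  also have "\<dots> \<le> (\<integral>\<^sup>+t. (\<integral>\<^sup>+g. ennreal (std_normal_density (c * g - s * S t) * (c + ?r * s * d t)) * q (t + ?r * g) \<partial>lborel) \<partial>lborel)"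
  proof (intro nn_integral_mono)
    fix t :: real
    have "?r * normal_density t ?r (t + ?r * g) = std_normal_density g" for g
      using v by (simp add: normal_density_def real_sqrt_mult power_mult_distrib field_simps)
    then have eq: "?r * (f t powr s\<^sup>2 * normal_density t ?r (t + ?r * g) * epi_weight c s v (S t) g) =
        f t powr s\<^sup>2 * std_normal_density g * epi_weight c s v (S t) g" for g
      by (simp add: mult.assoc mult.left_commute)
    have "?r * (f t powr s\<^sup>2 * normal_density t ?r (t + ?r * g) * epi_weight c s v (S t) g) \<le>
        std_normal_density (c * g - s * S t) * (c + ?r * s * d t)" for g
      unfolding eq d_def by (rule epi_weight_bound[OF cs v f(1)])
    then have "ennreal ?r * ennreal (f t powr s\<^sup>2 * normal_density t ?r (t + ?r * g) * epi_weight c s v (S t) g) \<le>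
        ennreal (std_normal_density (c * g - s * S t) * (c + ?r * s * d t))" for g
      using r by (subst ennreal_mult'[symmetric]) (auto intro!: ennreal_leI)
    then show "?r * (\<integral>\<^sup>+g. ennreal (f t powr s\<^sup>2 * normal_density t ?r (t + ?r * g) * epi_weight c s v (S t) g) * q (t + ?r * g) \<partial>lborel) \<le>
       (\<integral>\<^sup>+g. ennreal (std_normal_density (c * g - s * S t) * (c + ?r * s * d t)) * q (t + ?r * g) \<partial>lborel)"
      by (subst nn_integral_cmult[symmetric], simp)
         (auto intro!: nn_integral_mono mult_right_mono simp: mult.assoc[symmetric])
  qed
  \<comment> \<open>Substitution \<open>g = (b + s * S t) / c\<close>, so that \<open>b\<close> is
    the rotated coordinate.\<close>
  also have "\<dots> = (\<integral>\<^sup>+t. (\<integral>\<^sup>+b. ennreal (std_normal_density b) * (ennreal (1 + ?r * s / c * d t) * q (t + ?r / c * (b + s * S t))) \<partial>lborel) \<partial>lborel)"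
  proof (rule nn_integral_cong)
    fix t :: real
    have [measurable]: "(\<lambda>x. q (t + ?r * x)) \<in> borel_measurable borel" by measurable
    have "(\<integral>\<^sup>+g. ennreal (std_normal_density (c * g - s * S t) * (c + ?r * s * d t)) * q (t + ?r * g) \<partial>lborel) =
       ennreal (1 / c) * (\<integral>\<^sup>+b. ennreal (std_normal_density b * (c + ?r * s * d t)) * q (t + ?r * (s * S t / c + 1 / c * b)) \<partial>lborel)"
      using cs by (subst nn_integral_real_affine[where c="1/c" and t="s * S t / c"]) (auto simp: field_simps)
    also have "\<dots> = (\<integral>\<^sup>+b. ennreal (1 / c) * (ennreal (std_normal_density b * (c + ?r * s * d t)) * q (t + ?r * (s * S t / c + 1 / c * b))) \<partial>lborel)"
      by (subst nn_integral_cmult) auto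
    also have "\<dots> = (\<integral>\<^sup>+b. ennreal (std_normal_density b) * (ennreal (1 + ?r * s / c * d t) * q (t + ?r / c * (b + s * S t))) \<partial>lborel)"
    proof (intro nn_integral_cong)
      fix b
      have "1 / c * (std_normal_density b * (c + ?r * s * d t)) = std_normal_density b * (1 + ?r * s / c * d t)"
        using cs by (simp add: field_simps)
      moreover have "?r * (s * S t / c + 1 / c * b) = ?r / c * (b + s * S t)"
        by (simp add: add_divide_distrib algebra_simps)
      ultimately show "ennreal (1 / c) * (ennreal (std_normal_density b * (c + ?r * s * d t)) * q (t + ?r * (s * S t / c + 1 / c * b)))
        = ennreal (std_normal_density b) * (ennreal (1 + ?r * s / c * d t) * q (t + ?r / c * (b + s * S t)))"
        using cs by (simp add: mult.assoc[symmetric] ennreal_mult'[symmetric])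
    qed
    finally show "(\<integral>\<^sup>+g. ennreal (std_normal_density (c * g - s * S t) * (c + ?r * s * d t)) * q (t + ?r * g) \<partial>lborel) =
       (\<integral>\<^sup>+b. ennreal (std_normal_density b) * (ennreal (1 + ?r * s / c * d t) * q (t + ?r / c * (b + s * S t))) \<partial>lborel)" .
  qed
  also have "\<dots> = (\<integral>\<^sup>+b. (\<integral>\<^sup>+t. ennreal (std_normal_density b) * (ennreal (1 + ?r * s / c * d t) * q (t + ?r / c * (b + s * S t))) \<partial>lborel) \<partial>lborel)"
    by (rule pair_sigma_finite.Fubini') (auto simp: pair_sigma_finite_def intro: lborel.sigma_finite_measure_axioms)
  also have "\<dots> \<le> (\<integral>\<^sup>+b. ennreal (std_normal_density b) * (\<integral>\<^sup>+u. q u \<partial>lborel) \<partial>lborel)"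
  proof (intro nn_integral_mono)
    fix b :: real
    have "(\<integral>\<^sup>+t. ennreal (1 + ?r * s / c * d t) * q (t + ?r / c * (b + s * S t)) \<partial>lborel) \<le> (\<integral>\<^sup>+u. q u \<partial>lborel)"
    proof (rule nn_integral_subst_le)
      show "((\<lambda>t. t + ?r / c * (b + s * S t)) has_real_derivative (1 + ?r * s / c * d t)) (at t)" for t
        using S[of t] cs by (auto intro!: derivative_eq_intros simp: d_def ac_simps)
      show "continuous_on UNIV (\<lambda>t. 1 + ?r * s / c * d t)" by (intro continuous_intros contd)
      show "0 \<le> 1 + ?r * s / c * d t" for t using cs r d[of t] by auto
    qed simp
    then show "(\<integral>\<^sup>+t. ennreal (std_normal_density b) * (ennreal (1 + ?r * s / c * d t) * q (t + ?r / c * (b + s * S t))) \<partial>lborel) \<le>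
        ennreal (std_normal_density b) * (\<integral>\<^sup>+u. q u \<partial>lborel)"
      by (subst nn_integral_cmult) (auto intro!: mult_left_mono)
  qed
  also have "\<dots> = (\<integral>\<^sup>+u. q u \<partial>lborel)"
    using nn_integral_normal_density[of 1 0] by (subst nn_integral_multc) auto
  finally show ?thesis .
qed

section \<open>Monotone transport of a Gaussian mixture to the standard Gaussian\<close>

definition Phi :: "real \<Rightarrow> real" where
  "Phi = (SOME F. \<forall>x. (F has_real_derivative std_normal_density x) (at x))"

lemma DERIV_Phi: "(Phi has_real_derivative std_normal_density x) (at x)"
proof -
  have "\<exists>F. \<forall>x::real. -\<infinity> < ereal x \<longrightarrow> ereal x < \<infinity> \<longrightarrow> (F has_vector_derivative std_normal_density x) (at x)"
    by (intro einterval_antiderivative) (auto simp: normal_density_def intro!: continuous_intros)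
  then have "\<exists>F. \<forall>x. (F has_real_derivative std_normal_density x) (at x)"
    by (auto simp: has_real_derivative_iff_has_vector_derivative)
  from someI_ex[OF this] show ?thesis by (simp add: Phi_def)
qed

lemma Phi_less: "a < b \<Longrightarrow> Phi a < Phi b"
  by (rule DERIV_pos_imp_increasing) (auto intro!: exI DERIV_Phi normal_density_pos)

lemma Phi_le_iff [simp]: "Phi a \<le> Phi b \<longleftrightarrow> a \<le> b"
  using Phi_less[of a b] Phi_less[of b a] by (cases a b rule: linorder_cases) auto

lemma inj_Phi: "inj Phi"
  by (rule injI) (metis Phi_le_iff order_antisym order_refl)

lemma inv_Phi [simp]: "inv Phi (Phi z) = z"
  by (rule inv_f_f[OF inj_Phi])

lemma continuous_on_Phi: "continuous_on A Phi"
  using DERIV_Phi by (meson DERIV_isCont continuous_at_imp_continuous_on)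

lemma borel_measurable_Phi [measurable]: "Phi \<in> borel_measurable borel"
  using continuous_on_Phi by (rule borel_measurable_continuous_onI)

lemma DERIV_inv_Phi: "(inv Phi has_real_derivative inverse (std_normal_density z)) (at (Phi z))"
proof -
  have "(inv Phi has_derivative (\<lambda>h. h * inverse (std_normal_density z))) (at (Phi z))"
  proof (rule has_derivative_inverse_strong[of UNIV z Phi "inv Phi" "\<lambda>h. h * std_normal_density z"])
    show "(Phi has_derivative (\<lambda>h. h * std_normal_density z)) (at z)"
      using DERIV_Phi[of z] by (simp add: has_field_derivative_def mult_commute_abs)
    show "(\<lambda>h. h * std_normal_density z) \<circ> (\<lambda>h. h * inverse (std_normal_density z)) = id"
      using normal_density_pos[of 1 0 z] by (auto simp: fun_eq_iff)
  qed (auto simp: continuous_on_Phi)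
  then show ?thesis by (simp add: has_field_derivative_def mult_commute_abs)
qed

text \<open>The dimension is an argument because a smaller \<open>n\<close> gives the marginal of
  the first coordinates; quotients of consecutive values are conditional densities.\<close>

definition mixf :: "'k set \<Rightarrow> ('k \<Rightarrow> real) \<Rightarrow> ('k \<Rightarrow> nat \<Rightarrow> real) \<Rightarrow> nat \<Rightarrow> (nat \<Rightarrow> real) \<Rightarrow> real" where
  "mixf K p x n y = (\<Sum>k\<in>K. p k * phi n 1 (x k) y)"

text \<open>Up to the additive constant in \<^const>\<open>Phi\<close>, the distribution function of coordinate
  \<open>Suc m\<close> given the first \<open>m\<close> ones.\<close>

definition cond_cdf :: "'k set \<Rightarrow> ('k \<Rightarrow> real) \<Rightarrow> ('k \<Rightarrow> nat \<Rightarrow> real) \<Rightarrow> nat \<Rightarrow> (nat \<Rightarrow> real) \<Rightarrow> real \<Rightarrow> real" where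
  "cond_cdf K p x m y t = (\<Sum>k\<in>K. p k * phi m 1 (x k) y * Phi (t - x k (Suc m))) / mixf K p x m y"

text \<open>The Knothe-Rosenblatt map: each coordinate goes to the Gaussian quantile of its
  conditional distribution given the preceding ones.\<close>

definition transp :: "'k set \<Rightarrow> ('k \<Rightarrow> real) \<Rightarrow> ('k \<Rightarrow> nat \<Rightarrow> real) \<Rightarrow> nat \<Rightarrow> (nat \<Rightarrow> real) \<Rightarrow> real \<Rightarrow> real" where
  "transp K p x m y t = inv Phi (cond_cdf K p x m y t)"

lemma phi_Suc: "phi (Suc n) v c y = phi n v c y * normal_density (c (Suc n)) (sqrt v) (y (Suc n))"
  by (simp add: phi_def)

lemma phi_cong: "(\<And>i. i \<in> {1..n} \<Longrightarrow> c i = c' i) \<Longrightarrow> (\<And>i. i \<in> {1..n} \<Longrightarrow> y i = y' i) \<Longrightarrow> phi n v c y = phi n v c' y'"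
  unfolding phi_def by (intro prod.cong) auto

locale gauss_mix =
  fixes K :: "'k set" and p :: "'k \<Rightarrow> real" and x :: "'k \<Rightarrow> nat \<Rightarrow> real"
  assumes fin: "finite K" and pos: "\<And>k. k \<in> K \<Longrightarrow> p k > 0" and sum1: "sum p K = 1"
begin

lemma K_ne: "K \<noteq> {}" using sum1 by auto

lemma mixf_pos: "mixf K p x n y > 0"
  unfolding mixf_def using fin K_ne pos phi_pos[of 1] by (intro sum_pos mult_pos_pos) auto

lemma cond_cdf_bounds:
  assumes "\<And>k. k \<in> K \<Longrightarrow> \<bar>x k (Suc m)\<bar> \<le> C"
  shows "Phi (t - C) \<le> cond_cdf K p x m y t" "cond_cdf K p x m y t \<le> Phi (t + C)"
proof -
  have w: "p k * phi m 1 (x k) y \<ge> 0" if "k \<in> K" for k using pos[OF that] by simp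
  have "mixf K p x m y * Phi (t - C) \<le> (\<Sum>k\<in>K. p k * phi m 1 (x k) y * Phi (t - x k (Suc m)))"
    unfolding mixf_def sum_distrib_right using assms w
    by (intro sum_mono mult_left_mono) (auto simp: abs_le_iff)
  then show "Phi (t - C) \<le> cond_cdf K p x m y t"
    using mixf_pos[of m y] by (simp add: cond_cdf_def field_simps)
  have "(\<Sum>k\<in>K. p k * phi m 1 (x k) y * Phi (t - x k (Suc m))) \<le> mixf K p x m y * Phi (t + C)"
    unfolding mixf_def sum_distrib_right
  proof (intro sum_mono mult_left_mono w)
    fix k assume "k \<in> K"
    then show "Phi (t - x k (Suc m)) \<le> Phi (t + C)" using assms[of k] by (simp add: abs_le_iff)
  qed
  then show "cond_cdf K p x m y t \<le> Phi (t + C)"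
    using mixf_pos[of m y] by (simp add: cond_cdf_def field_simps)
qed

text \<open>\<open>inv Phi\<close> is meaningful only on the range of \<open>Phi\<close>. A convex
  combination of values of \<open>Phi\<close> stays in that range by the intermediate value theorem,
  whatever additive constant was chosen in \<open>Phi\<close>.\<close>

lemma Phi_transp: "Phi (transp K p x m y t) = cond_cdf K p x m y t"
proof -
  define C where "C = (\<Sum>k\<in>K. \<bar>x k (Suc m)\<bar>)"
  have C: "\<bar>x k (Suc m)\<bar> \<le> C" if "k \<in> K" for k
    unfolding C_def using fin that by (intro member_le_sum) auto
  then have "C \<ge> 0" using K_ne by (metis abs_ge_zero all_not_in_conv order_trans)
  then have "\<exists>z\<ge>t - C. z \<le> t + C \<and> Phi z = cond_cdf K p x m y t"
    using cond_cdf_bounds[OF C] by (intro IVT') (auto intro: continuous_on_Phi)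
  then show ?thesis unfolding transp_def by (metis inv_Phi)
qed

text \<open>With all means in \<open>[-C, C]\<close>, the conditional distribution function lies
  between two Gaussian ones shifted by \<open>C\<close>. The bound later gives the transported
  coordinate a finite second moment.\<close>

lemma transp_bound:
  assumes "\<And>k. k \<in> K \<Longrightarrow> \<bar>x k (Suc m)\<bar> \<le> C"
  shows "\<bar>transp K p x m y t - t\<bar> \<le> C"
  using cond_cdf_bounds[OF assms, where t=t and y=y] unfolding Phi_transp[symmetric] Phi_le_iff by linarith

text \<open>Conservation of mass in differential form: the conditional density over the Gaussian
  density at the image. This is the hypothesis on \<open>S\<close> in
  \<open>epi_one_dim\<close>.\<close>

lemma DERIV_transp:
  "(transp K p x m y has_real_derivative
     (mixf K p x (Suc m) (y(Suc m := t)) / mixf K p x m y) / std_normal_density (transp K p x m y t)) (at t)"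
proof -
  have "(cond_cdf K p x m y has_real_derivative
      (\<Sum>k\<in>K. p k * phi m 1 (x k) y * std_normal_density (t - x k (Suc m))) / mixf K p x m y) (at t)"
    unfolding cond_cdf_def using mixf_pos[of m y]
    by (auto intro!: derivative_eq_intros DERIV_Phi[THEN DERIV_chain2] DERIV_sum sum.cong)
  moreover have "(\<Sum>k\<in>K. p k * phi m 1 (x k) y * std_normal_density (t - x k (Suc m))) = mixf K p x (Suc m) (y(Suc m := t))"
    unfolding mixf_def phi_Suc
    by (intro sum.cong refl) (auto simp: normal_density_def mult.assoc intro!: phi_cong)
  ultimately have 1: "(cond_cdf K p x m y has_real_derivative mixf K p x (Suc m) (y(Suc m := t)) / mixf K p x m y) (at t)"
    by simp
  have "((\<lambda>t. inv Phi (cond_cdf K p x m y t)) has_real_derivative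
     inverse (std_normal_density (transp K p x m y t)) * (mixf K p x (Suc m) (y(Suc m := t)) / mixf K p x m y)) (at t)"
    using DERIV_inv_Phi[of "transp K p x m y t"] unfolding Phi_transp by (rule DERIV_chain2) (rule 1)
  then show ?thesis unfolding transp_def[symmetric]
    by (simp add: divide_inverse mult.commute transp_def[symmetric, abs_def])
qed

lemma measurable_mixf [measurable (raw)]:
  assumes "\<And>i. i \<in> {1..n} \<Longrightarrow> (\<lambda>w. y w i) \<in> borel_measurable M"
  shows "(\<lambda>w. mixf K p x n (y w)) \<in> borel_measurable M"
  unfolding mixf_def using assms by measurable

text \<open>Sublevel sets are compared through the increasing function \<open>Phi\<close>, so that
  measurability of \<open>inv Phi\<close> does not come up.\<close>

lemma measurable_transp [measurable (raw)]:
  assumes [measurable]: "\<And>i. i \<in> {1..m} \<Longrightarrow> (\<lambda>w. y w i) \<in> borel_measurable M" "t \<in> borel_measurable M"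
  shows "(\<lambda>w. transp K p x m (y w) (t w)) \<in> borel_measurable M"
proof -
  have [measurable]: "(\<lambda>w. cond_cdf K p x m (y w) (t w)) \<in> borel_measurable M"
    unfolding cond_cdf_def by measurable
  have "transp K p x m (y w) (t w) \<le> a \<longleftrightarrow> cond_cdf K p x m (y w) (t w) \<le> Phi a" for w a
    unfolding Phi_transp[symmetric] by simp
  then show ?thesis by (subst borel_measurable_iff_le) simp
qed

end

lemma measurable_Ln_comp: "f \<in> M \<rightarrow>\<^sub>M Ln n \<Longrightarrow> i \<in> {1..n} \<Longrightarrow> (\<lambda>w. f w i) \<in> borel_measurable M"
  by (rule measurable_compose[OF _ measurable_Ln_component])

lemma (in gauss_mix) cond_cdf_cong:
  assumes "\<And>i. i \<in> {1..m} \<Longrightarrow> y i = y' i"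
  shows "cond_cdf K p x m y t = cond_cdf K p x m y' t" "mixf K p x m y = mixf K p x m y'"
    "transp K p x m y t = transp K p x m y' t"
proof -
  have *: "phi m 1 (x k) y = phi m 1 (x k) y'" for k using assms by (intro phi_cong) auto
  show "cond_cdf K p x m y t = cond_cdf K p x m y' t" "mixf K p x m y = mixf K p x m y'"
    by (simp_all add: cond_cdf_def mixf_def *)
  then show "transp K p x m y t = transp K p x m y' t" by (simp add: transp_def)
qed

text \<open>Coordinate \<open>i\<close> is transported given the first \<open>i - 1\<close>. The
  power \<open>s\<^sup>2\<close> of the mixture is what remains when the true density is divided by
  its power \<open>c\<^sup>2\<close>.\<close>

definition (in gauss_mix) epi_kernel :: "real \<Rightarrow> real \<Rightarrow> real \<Rightarrow> nat \<Rightarrow> (nat \<Rightarrow> real) \<Rightarrow> (nat \<Rightarrow> real) \<Rightarrow> real" where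
  "epi_kernel c s v n y u = mixf K p x n y powr s\<^sup>2 * phi n v y u *
     (\<Prod>i\<in>{1..n}. epi_weight c s v (transp K p x (i - 1) y (y i)) ((u i - y i) / sqrt v))"

lemma measurable_epi_weight [measurable (raw)]:
  assumes [measurable]: "a \<in> borel_measurable M" "b \<in> borel_measurable M"
  shows "(\<lambda>w. epi_weight c s v (a w) (b w)) \<in> borel_measurable M"
  unfolding epi_weight_def by measurable

lemma (in gauss_mix) measurable_epi_kernel [measurable (raw)]:
  assumes y[measurable]: "\<And>i. i \<in> {1..n} \<Longrightarrow> (\<lambda>w. y w i) \<in> borel_measurable M"
    and u[measurable]: "\<And>i. i \<in> {1..n} \<Longrightarrow> (\<lambda>w. u w i) \<in> borel_measurable M"
  shows "(\<lambda>w. epi_kernel c s v n (y w) (u w)) \<in> borel_measurable M"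
  unfolding epi_kernel_def
proof (intro borel_measurable_times borel_measurable_prod)
  show "(\<lambda>w. mixf K p x n (y w) powr s\<^sup>2) \<in> borel_measurable M" by measurable
  show "(\<lambda>w. phi n v (y w) (u w)) \<in> borel_measurable M" by measurable
  fix i assume i: "i \<in> {1..n}"
  have [measurable]: "(\<lambda>w. transp K p x (i - 1) (y w) (y w i)) \<in> borel_measurable M"
    using i by (intro measurable_transp y) auto
  note [measurable] = y[OF i] u[OF i]
  show "(\<lambda>w. epi_weight c s v (transp K p x (i - 1) (y w) (y w i)) ((u w i - y w i) / sqrt v)) \<in> borel_measurable M"
    by measurable
qed

text \<open>The transport is triangular: the factors of the first \<open>n\<close> coordinates do
  not see coordinate \<open>Suc n\<close>, so the last one splits off with the conditional density
  as its \<open>f\<close>.\<close>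

lemma (in gauss_mix) epi_kernel_Suc:
  "epi_kernel c s v (Suc n) (y(Suc n := t)) (u(Suc n := z)) = epi_kernel c s v n y u *
     ((mixf K p x (Suc n) (y(Suc n := t)) / mixf K p x n y) powr s\<^sup>2 * normal_density t (sqrt v) z *
       epi_weight c s v (transp K p x n y t) ((z - t) / sqrt v))"
proof -
  let ?y = "y(Suc n := t)" and ?u = "u(Suc n := z)"
  have 1: "mixf K p x (Suc n) ?y powr s\<^sup>2 = mixf K p x n y powr s\<^sup>2 * (mixf K p x (Suc n) ?y / mixf K p x n y) powr s\<^sup>2"
    using mixf_pos[of n y] mixf_pos[of "Suc n" ?y] by (simp add: powr_mult[symmetric] less_imp_le less_imp_neq[symmetric])
  have 2: "phi n v ?y ?u = phi n v y u" by (intro phi_cong) auto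
  have 3: "transp K p x (i - 1) ?y (?y i) = transp K p x (i - 1) y (y i)" if "i \<in> {1..n}" for i
  proof -
    have "?y i = y i" using that by auto
    then show ?thesis using that by (simp only:, intro cond_cdf_cong(3)) auto
  qed
  have 4: "transp K p x n ?y t = transp K p x n y t" by (intro cond_cdf_cong(3)) auto
  have "(\<Prod>i\<in>{1..n}. epi_weight c s v (transp K p x (i - 1) ?y (?y i)) ((?u i - ?y i) / sqrt v)) =
     (\<Prod>i\<in>{1..n}. epi_weight c s v (transp K p x (i - 1) y (y i)) ((u i - y i) / sqrt v))"
    by (intro prod.cong refl) (simp only: 3, auto)
  moreover have "{1..Suc n} = insert (Suc n) {1..n}" by auto
  ultimately show ?thesis
    unfolding epi_kernel_def phi_Suc 1 2 by (simp add: 4 mult.assoc mult.left_commute)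
qed

lemma measurable_Ln_fun_upd [measurable]:
  "(\<lambda>(y, t). y(Suc n := t)) \<in> Ln n \<Otimes>\<^sub>M borel \<rightarrow>\<^sub>M Ln (Suc n)"
proof -
  have "{1..Suc n} = insert (Suc n) {1..n}" by auto
  then have "(\<lambda>(y, t). y(Suc n := t)) \<in> Ln n \<Otimes>\<^sub>M lborel \<rightarrow>\<^sub>M Ln (Suc n)"
    using measurable_add_dim[of "Suc n" "{1..n}" "\<lambda>_. lborel :: real measure"] by simp
  then show ?thesis by simp
qed

lemma nn_integral_Ln_Suc:
  assumes "f \<in> borel_measurable (Ln (Suc n))"
  shows "(\<integral>\<^sup>+y. f y \<partial>Ln (Suc n)) = (\<integral>\<^sup>+y. \<integral>\<^sup>+t. f (y(Suc n := t)) \<partial>lborel \<partial>Ln n)"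
proof -
  interpret product_sigma_finite "\<lambda>_::nat. lborel :: real measure" by standard
  have "{1..Suc n} = insert (Suc n) {1..n}" by auto
  then show ?thesis using product_nn_integral_insert[of "{1..n}" "Suc n" f] assms by simp
qed

text \<open>The variational form of the entropy power inequality, in which the conditioning on the
  preceding coordinates reduces to Fubini's theorem.\<close>

lemma (in gauss_mix) nn_integral_epi_kernel:
  assumes cs: "c > 0" "s > 0" "c\<^sup>2 + s\<^sup>2 = 1" and v: "v > 0"
    and "q \<in> borel_measurable (Ln n)"
  shows "(\<integral>\<^sup>+y. \<integral>\<^sup>+u. ennreal (epi_kernel c s v n y u) * q u \<partial>Ln n \<partial>Ln n) \<le> (\<integral>\<^sup>+u. q u \<partial>Ln n)"
  using assms(5)
proof (induction n arbitrary: q)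
  case 0
  interpret product_sigma_finite "\<lambda>_::nat. lborel :: real measure" by standard
  have "epi_kernel c s v 0 y u = 1" for y u
    by (simp add: epi_kernel_def mixf_def phi_def sum1)
  then show ?case by (simp add: PiM_empty nn_integral_count_space_finite)
next
  case (Suc n)
  note [measurable] = Suc.prems
  interpret L: sigma_finite_measure "Ln m" for m by (rule sigma_finite_Ln)
  have updm: "(\<lambda>w. (f w)(Suc n := g w)) \<in> M \<rightarrow>\<^sub>M Ln (Suc n)"
    if "f \<in> M \<rightarrow>\<^sub>M Ln n" "g \<in> borel_measurable M" for f g and M :: "'z measure"
    using measurable_compose[OF measurable_Pair[OF that] measurable_Ln_fun_upd] by simp
  note comp = measurable_Ln_comp
  have kerm: "(\<lambda>w. epi_kernel c s v m (f w) (g w)) \<in> borel_measurable M"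
    if "f \<in> M \<rightarrow>\<^sub>M Ln m" "g \<in> M \<rightarrow>\<^sub>M Ln m" for f g m and M :: "'z measure"
    by (intro measurable_epi_kernel comp[OF that(1)] comp[OF that(2)])
  have qm: "(\<lambda>w. q (f w)) \<in> borel_measurable M" if "f \<in> M \<rightarrow>\<^sub>M Ln (Suc n)" for f and M :: "'z measure"
    using measurable_compose[OF that Suc.prems] .
  define B where "B y t z = (mixf K p x (Suc n) (y(Suc n := t)) / mixf K p x n y) powr s\<^sup>2 * normal_density t (sqrt v) z *
       epi_weight c s v (transp K p x n y t) ((z - t) / sqrt v)" for y t z
  have Bm: "(\<lambda>w. B (f w) (g w) (h w)) \<in> borel_measurable M"
    if [measurable]: "f \<in> M \<rightarrow>\<^sub>M Ln n" "g \<in> borel_measurable M" "h \<in> borel_measurable M" for f g h and M :: "'z measure"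
  proof -
    note [measurable] = updm[OF that(1,2)]
    have [measurable]: "(\<lambda>w. transp K p x n (f w) (g w)) \<in> borel_measurable M"
      by (intro measurable_transp comp[OF that(1)] that(2))
    have [measurable]: "(\<lambda>w. mixf K p x n (f w)) \<in> borel_measurable M"
      by (intro measurable_mixf comp[OF that(1)])
    have [measurable]: "(\<lambda>w. mixf K p x (Suc n) ((f w)(Suc n := g w))) \<in> borel_measurable M"
      by (intro measurable_mixf comp[OF updm[OF that(1,2)]])
    have [measurable]: "(\<lambda>w. normal_density (g w) (sqrt v) (h w)) \<in> borel_measurable M"
      unfolding normal_density_def by measurable
    show ?thesis unfolding B_def by measurable
  qed
  have Bnn: "B y t z \<ge> 0" for y t z
    unfolding B_def epi_weight_def by simp
  have knn: "epi_kernel c s v m y u \<ge> 0" for m y u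
    unfolding epi_kernel_def epi_weight_def by (auto intro!: mult_nonneg_nonneg prod_nonneg)
  have ks: "ennreal (epi_kernel c s v (Suc n) (y(Suc n := t)) (u(Suc n := z))) = ennreal (epi_kernel c s v n y u) * ennreal (B y t z)" for y u t z
    unfolding epi_kernel_Suc B_def[symmetric] using knn Bnn by (intro ennreal_mult) auto
  \<comment> \<open>The test function with its last output coordinate integrated out; the induction
    hypothesis is applied to it.\<close>
  define Q where "Q u = (\<integral>\<^sup>+z. q (u(Suc n := z)) \<partial>lborel)" for u
  have m1: "(\<lambda>w. \<integral>\<^sup>+u. ennreal (epi_kernel c s v (Suc n) w u) * q u \<partial>Ln (Suc n)) \<in> borel_measurable (Ln (Suc n))"
    unfolding split_beta'[symmetric]
    by (intro L.borel_measurable_nn_integral, unfold split_beta',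
        intro borel_measurable_times_ennreal measurable_compose[OF kerm[OF measurable_fst measurable_snd]] qm[OF measurable_snd]
          measurable_ennreal)
  have m2: "(\<lambda>(t, u). \<integral>\<^sup>+z. ennreal (epi_kernel c s v n y u) * ennreal (B y t z) * q (u(Suc n := z)) \<partial>lborel) \<in> borel_measurable (lborel \<Otimes>\<^sub>M Ln n)" if y: "y \<in> space (Ln n)" for y
  proof -
    have f: "(\<lambda>w. snd (fst w)) \<in> (lborel \<Otimes>\<^sub>M Ln n) \<Otimes>\<^sub>M lborel \<rightarrow>\<^sub>M Ln n" by measurable
    have g: "(\<lambda>w. fst (fst w)) \<in> borel_measurable ((lborel \<Otimes>\<^sub>M Ln n) \<Otimes>\<^sub>M lborel)"
      "(\<lambda>w. snd w) \<in> borel_measurable ((lborel \<Otimes>\<^sub>M Ln n) \<Otimes>\<^sub>M lborel)" by measurable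
    have c: "(\<lambda>w. y) \<in> (lborel \<Otimes>\<^sub>M Ln n) \<Otimes>\<^sub>M lborel \<rightarrow>\<^sub>M Ln n" using y by simp
    show ?thesis
      unfolding split_beta'
      by (intro lborel.borel_measurable_nn_integral, unfold split_beta',
          intro borel_measurable_times_ennreal measurable_compose[OF kerm[OF c f]] measurable_compose[OF Bm[OF c g]]
            qm[OF updm[OF f g(2)]] measurable_ennreal)
  qed
  have "(\<integral>\<^sup>+y. \<integral>\<^sup>+u. ennreal (epi_kernel c s v (Suc n) y u) * q u \<partial>Ln (Suc n) \<partial>Ln (Suc n)) =
     (\<integral>\<^sup>+y. \<integral>\<^sup>+t. \<integral>\<^sup>+u. ennreal (epi_kernel c s v (Suc n) (y(Suc n := t)) u) * q u \<partial>Ln (Suc n) \<partial>lborel \<partial>Ln n)"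
    by (rule nn_integral_Ln_Suc) (rule m1)
  also have "\<dots> = (\<integral>\<^sup>+y. \<integral>\<^sup>+t. \<integral>\<^sup>+u. \<integral>\<^sup>+z. ennreal (epi_kernel c s v n y u) * ennreal (B y t z) * q (u(Suc n := z)) \<partial>lborel \<partial>Ln n \<partial>lborel \<partial>Ln n)"
  proof (rule nn_integral_cong, rule nn_integral_cong)
    fix y t assume y: "y \<in> space (Ln n)"
    have yt: "y(Suc n := t) \<in> space (Ln (Suc n))"
      using y by (auto simp: space_PiM PiE_iff extensional_def)
    have "(\<lambda>u. ennreal (epi_kernel c s v (Suc n) (y(Suc n := t)) u) * q u) \<in> borel_measurable (Ln (Suc n))"
      by (intro borel_measurable_times_ennreal measurable_compose[OF kerm[OF measurable_const[OF yt] measurable_ident[unfolded id_def]]]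
          Suc.prems measurable_ennreal)
    from nn_integral_Ln_Suc[OF this]
    show "(\<integral>\<^sup>+u. ennreal (epi_kernel c s v (Suc n) (y(Suc n := t)) u) * q u \<partial>Ln (Suc n)) =
      (\<integral>\<^sup>+u. \<integral>\<^sup>+z. ennreal (epi_kernel c s v n y u) * ennreal (B y t z) * q (u(Suc n := z)) \<partial>lborel \<partial>Ln n)"
      unfolding ks .
  qed
  \<comment> \<open>\<open>t\<close> is moved inside the first \<open>n\<close> output coordinates,
    so that for fixed \<open>y\<close> and \<open>u\<close> the inner double integral is that of
    \<open>epi_one_dim\<close>.\<close>
  also have "\<dots> = (\<integral>\<^sup>+y. \<integral>\<^sup>+u. \<integral>\<^sup>+t. \<integral>\<^sup>+z. ennreal (epi_kernel c s v n y u) * ennreal (B y t z) * q (u(Suc n := z)) \<partial>lborel \<partial>lborel \<partial>Ln n \<partial>Ln n)"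
  proof (rule nn_integral_cong)
    fix y assume "y \<in> space (Ln n)"
    from m2[OF this]
    show "(\<integral>\<^sup>+t. \<integral>\<^sup>+u. \<integral>\<^sup>+z. ennreal (epi_kernel c s v n y u) * ennreal (B y t z) * q (u(Suc n := z)) \<partial>lborel \<partial>Ln n \<partial>lborel) =
       (\<integral>\<^sup>+u. \<integral>\<^sup>+t. \<integral>\<^sup>+z. ennreal (epi_kernel c s v n y u) * ennreal (B y t z) * q (u(Suc n := z)) \<partial>lborel \<partial>lborel \<partial>Ln n)"
      by (intro pair_sigma_finite.Fubini'[symmetric] pair_sigma_finite.intro sigma_finite_Ln lborel.sigma_finite_measure_axioms) auto
  qed
  also have "\<dots> \<le> (\<integral>\<^sup>+y. \<integral>\<^sup>+u. ennreal (epi_kernel c s v n y u) * Q u \<partial>Ln n \<partial>Ln n)"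
  proof (rule nn_integral_mono, rule nn_integral_mono)
    fix y u assume y: "y \<in> space (Ln n)" and u: "u \<in> space (Ln n)"
    have qb [measurable]: "(\<lambda>z. q (u(Suc n := z))) \<in> borel_measurable borel"
      by (rule qm[OF updm[OF measurable_const[OF u]]]) simp
    have [measurable]: "(\<lambda>z. B y t z) \<in> borel_measurable borel" for t
      by (rule Bm[OF measurable_const[OF y]]) auto
    have [measurable]: "(\<lambda>(t, z). B y t z) \<in> borel_measurable (borel \<Otimes>\<^sub>M borel)"
      unfolding split_beta' by (rule Bm[OF measurable_const[OF y]]) auto
    have cont: "continuous_on UNIV (\<lambda>t. mixf K p x (Suc n) (y(Suc n := t)) / mixf K p x n y)"
    proof -
      have "(\<lambda>t. mixf K p x (Suc n) (y(Suc n := t))) = (\<lambda>t. \<Sum>k\<in>K. p k * (phi n 1 (x k) y * normal_density (x k (Suc n)) 1 t))"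
        unfolding mixf_def phi_Suc
        by (intro ext sum.cong refl) (auto intro!: phi_cong)
      moreover have "continuous_on UNIV (\<lambda>t. \<Sum>k\<in>K. p k * (phi n 1 (x k) y * normal_density (x k (Suc n)) 1 t))"
        unfolding normal_density_def by (intro continuous_intros) auto
      ultimately have cont': "continuous_on UNIV (\<lambda>t. mixf K p x (Suc n) (y(Suc n := t)))" by (simp only:)
      show ?thesis
        by (intro continuous_on_divide cont' continuous_on_const) (use mixf_pos[of n y] in auto)
    qed
    have "(\<integral>\<^sup>+t. \<integral>\<^sup>+z. ennreal (B y t z) * q (u(Suc n := z)) \<partial>lborel \<partial>lborel) \<le> Q u"
      unfolding B_def Q_def
      by (rule epi_one_dim[OF cs v _ cont DERIV_transp qb]) (use mixf_pos in \<open>auto intro!: divide_pos_pos\<close>)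
    moreover have "(\<integral>\<^sup>+t. \<integral>\<^sup>+z. ennreal (epi_kernel c s v n y u) * ennreal (B y t z) * q (u(Suc n := z)) \<partial>lborel \<partial>lborel) =
        ennreal (epi_kernel c s v n y u) * (\<integral>\<^sup>+t. \<integral>\<^sup>+z. ennreal (B y t z) * q (u(Suc n := z)) \<partial>lborel \<partial>lborel)"
      by (simp add: mult.assoc nn_integral_cmult)
    ultimately show "(\<integral>\<^sup>+t. \<integral>\<^sup>+z. ennreal (epi_kernel c s v n y u) * ennreal (B y t z) * q (u(Suc n := z)) \<partial>lborel \<partial>lborel) \<le>
       ennreal (epi_kernel c s v n y u) * Q u"
      by (simp add: mult_left_mono)
  qed
  also have "\<dots> \<le> (\<integral>\<^sup>+u. Q u \<partial>Ln n)"
  proof (rule Suc.IH)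
    show "Q \<in> borel_measurable (Ln n)"
      unfolding Q_def
      by (intro lborel.borel_measurable_nn_integral, unfold split_beta', intro qm[OF updm]) auto
  qed
  also have "\<dots> = (\<integral>\<^sup>+u. q u \<partial>Ln (Suc n))"
    unfolding Q_def by (rule nn_integral_Ln_Suc[symmetric]) simp
  finally show ?case .
qed

section \<open>Expectations under a channel with Gaussian input noise\<close>

text \<open>The joint law of Y = s + N and U = a Y + N'. The choice \<open>a = sqrt g\<close>,
  \<open>v = 1 - g\<close> gives the eavesdropper, \<open>a = 1\<close> the auxiliary noisier
  output, and \<open>a = 0\<close>, \<open>v = 1\<close> a dummy second output for bounds on Y
  alone.\<close>

definition jlaw :: "nat \<Rightarrow> real \<Rightarrow> real \<Rightarrow> (nat \<Rightarrow> real) \<Rightarrow> ((nat \<Rightarrow> real) \<times> (nat \<Rightarrow> real)) measure" where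
  "jlaw n a v s = density (Ln2 n) (\<lambda>(y, u). ennreal (phi n 1 s y * phi n v (\<lambda>i. a * y i) u))"

lemma sets_jlaw [simp, measurable_cong]: "sets (jlaw n a v s) = sets (Ln2 n)"
  by (simp add: jlaw_def)

lemma space_jlaw [simp]: "space (jlaw n a v s) = space (Ln2 n)"
  by (simp add: jlaw_def)

lemma measurable_phi_Ln:
  assumes "f \<in> M \<rightarrow>\<^sub>M Ln n"
  shows "(\<lambda>w. phi n v c (f w)) \<in> borel_measurable M"
  by (intro measurable_phi measurable_Ln_comp[OF assms] borel_measurable_const)

lemma measurable_fst_snd_component [measurable]:
  assumes "i \<in> {1..n}"
  shows "(\<lambda>x. fst x i) \<in> borel_measurable (Ln2 n)" "(\<lambda>x. snd x i) \<in> borel_measurable (Ln2 n)"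
  using measurable_Ln_comp[OF measurable_fst assms] measurable_Ln_comp[OF measurable_snd assms] by auto

lemma measurable_phi_fst_snd [measurable]:
  "(\<lambda>x. phi n v c (fst x)) \<in> borel_measurable (Ln2 n)"
  "(\<lambda>x. phi n v c (snd x)) \<in> borel_measurable (Ln2 n)"
  "(\<lambda>x. phi n v (\<lambda>i. a * fst x i) (snd x)) \<in> borel_measurable (Ln2 n)"
  "(\<lambda>x. phi n v (\<lambda>i. a * snd x i) (fst x)) \<in> borel_measurable (Ln2 n)"
  "(\<lambda>x. phi n v (postmean a' v' c (snd x)) (fst x)) \<in> borel_measurable (Ln2 n)"
  unfolding postmean_def
  by (intro measurable_phi measurable_fst_snd_component borel_measurable_times borel_measurable_add
      borel_measurable_diff borel_measurable_const; simp)+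

lemma nn_integral_Ln_pair:
  assumes "h \<in> borel_measurable (Ln2 n)"
  shows "(\<integral>\<^sup>+x. h x \<partial>Ln2 n) = (\<integral>\<^sup>+y. \<integral>\<^sup>+u. h (y, u) \<partial>Ln n \<partial>Ln n)"
    "(\<integral>\<^sup>+x. h x \<partial>Ln2 n) = (\<integral>\<^sup>+u. \<integral>\<^sup>+y. h (y, u) \<partial>Ln n \<partial>Ln n)"
proof -
  interpret pair_sigma_finite "Ln n" "Ln n" by (rule pair_sigma_finite_Ln)
  show "(\<integral>\<^sup>+x. h x \<partial>Ln2 n) = (\<integral>\<^sup>+y. \<integral>\<^sup>+u. h (y, u) \<partial>Ln n \<partial>Ln n)"
    using assms by (simp add: sigma_finite_measure.nn_integral_fst[OF sigma_finite_Ln])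
  show "(\<integral>\<^sup>+x. h x \<partial>Ln2 n) = (\<integral>\<^sup>+u. \<integral>\<^sup>+y. h (y, u) \<partial>Ln n \<partial>Ln n)"
    using assms by (simp add: nn_integral_snd[symmetric])
qed

lemma nn_integral_jlaw:
  assumes [measurable]: "h \<in> borel_measurable (Ln2 n)"
  shows "(\<integral>\<^sup>+x. h x \<partial>jlaw n a v s) =
     (\<integral>\<^sup>+x. ennreal (phi n 1 s (fst x) * phi n v (\<lambda>i. a * fst x i) (snd x)) * h x \<partial>Ln2 n)"
  unfolding jlaw_def by (subst nn_integral_density) (auto simp: split_beta')

lemma nn_integral_jlaw_fst_snd:
  assumes [measurable]: "h \<in> borel_measurable (Ln2 n)"
  shows "(\<integral>\<^sup>+x. h x \<partial>jlaw n a v s) =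
    (\<integral>\<^sup>+y. ennreal (phi n 1 s y) * (\<integral>\<^sup>+u. ennreal (phi n v (\<lambda>i. a * y i) u) * h (y, u) \<partial>Ln n) \<partial>Ln n)"
proof -
  have "(\<integral>\<^sup>+x. h x \<partial>jlaw n a v s) = (\<integral>\<^sup>+y. \<integral>\<^sup>+u. ennreal (phi n 1 s y * phi n v (\<lambda>i. a * y i) u) * h (y, u) \<partial>Ln n \<partial>Ln n)"
    by (simp add: nn_integral_jlaw nn_integral_Ln_pair(1))
  also have "\<dots> = (\<integral>\<^sup>+y. ennreal (phi n 1 s y) * (\<integral>\<^sup>+u. ennreal (phi n v (\<lambda>i. a * y i) u) * h (y, u) \<partial>Ln n) \<partial>Ln n)"
  proof (rule nn_integral_cong)
    fix y assume [measurable]: "y \<in> space (Ln n)"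
    have [measurable]: "(\<lambda>u. phi n v (\<lambda>i. a * y i) u) \<in> borel_measurable (Ln n)"
      by (rule measurable_phi_Ln) auto
    have [measurable]: "(\<lambda>u. h (y, u)) \<in> borel_measurable (Ln n)" by measurable
    show "(\<integral>\<^sup>+u. ennreal (phi n 1 s y * phi n v (\<lambda>i. a * y i) u) * h (y, u) \<partial>Ln n) =
        ennreal (phi n 1 s y) * (\<integral>\<^sup>+u. ennreal (phi n v (\<lambda>i. a * y i) u) * h (y, u) \<partial>Ln n)"
      by (subst nn_integral_cmult[symmetric]) (auto simp: ennreal_mult mult.assoc intro!: nn_integral_cong)
  qed
  finally show ?thesis .
qed

lemma nn_integral_jlaw_snd_fst:
  assumes v: "v > 0" and [measurable]: "h \<in> borel_measurable (Ln2 n)"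
  shows "(\<integral>\<^sup>+x. h x \<partial>jlaw n a v s) =
    (\<integral>\<^sup>+u. ennreal (phi n (a\<^sup>2 + v) (\<lambda>i. a * s i) u) *
      (\<integral>\<^sup>+y. ennreal (phi n (v / (a\<^sup>2 + v)) (postmean a v s u) y) * h (y, u) \<partial>Ln n) \<partial>Ln n)"
proof -
  have "(\<integral>\<^sup>+x. h x \<partial>jlaw n a v s) = (\<integral>\<^sup>+u. \<integral>\<^sup>+y. ennreal (phi n 1 s y * phi n v (\<lambda>i. a * y i) u) * h (y, u) \<partial>Ln n \<partial>Ln n)"
    by (simp add: nn_integral_jlaw nn_integral_Ln_pair(2))
  also have "\<dots> = (\<integral>\<^sup>+u. ennreal (phi n (a\<^sup>2 + v) (\<lambda>i. a * s i) u) *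
      (\<integral>\<^sup>+y. ennreal (phi n (v / (a\<^sup>2 + v)) (postmean a v s u) y) * h (y, u) \<partial>Ln n) \<partial>Ln n)"
  proof (rule nn_integral_cong)
    fix u assume [measurable]: "u \<in> space (Ln n)"
    have [measurable]: "(\<lambda>y. phi n (v / (a\<^sup>2 + v)) (postmean a v s u) y) \<in> borel_measurable (Ln n)"
      by (rule measurable_phi_Ln) auto
    have [measurable]: "(\<lambda>y. h (y, u)) \<in> borel_measurable (Ln n)" by measurable
    show "(\<integral>\<^sup>+y. ennreal (phi n 1 s y * phi n v (\<lambda>i. a * y i) u) * h (y, u) \<partial>Ln n) =
      ennreal (phi n (a\<^sup>2 + v) (\<lambda>i. a * s i) u) *
      (\<integral>\<^sup>+y. ennreal (phi n (v / (a\<^sup>2 + v)) (postmean a v s u) y) * h (y, u) \<partial>Ln n)"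
      unfolding phi_swap[OF v]
      by (subst nn_integral_cmult[symmetric]) (auto simp: ennreal_mult mult.assoc intro!: nn_integral_cong)
  qed
  finally show ?thesis .
qed

lemma nn_integral_jlaw_fst:
  assumes v: "v > 0" and [measurable]: "h \<in> borel_measurable (Ln n)"
  shows "(\<integral>\<^sup>+x. h (fst x) \<partial>jlaw n a v s) = (\<integral>\<^sup>+y. ennreal (phi n 1 s y) * h y \<partial>Ln n)"
proof -
  have "(\<integral>\<^sup>+u. ennreal (phi n v (\<lambda>i. a * y i) u) * h y \<partial>Ln n) = h y" for y
    using measurable_phi_Ln[of "\<lambda>x. x" "Ln n" n v]
    by (subst nn_integral_multc) (auto simp: nn_integral_phi[OF v])
  then show ?thesis by (simp add: nn_integral_jlaw_fst_snd)
qed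

lemma nn_integral_jlaw_snd:
  assumes v: "v > 0" and [measurable]: "h \<in> borel_measurable (Ln n)"
  shows "(\<integral>\<^sup>+x. h (snd x) \<partial>jlaw n a v s) = (\<integral>\<^sup>+u. ennreal (phi n (a\<^sup>2 + v) (\<lambda>i. a * s i) u) * h u \<partial>Ln n)"
proof -
  have "v / (a\<^sup>2 + v) > 0" using v by (simp add: add_nonneg_pos)
  then have "(\<integral>\<^sup>+y. ennreal (phi n (v / (a\<^sup>2 + v)) (postmean a v s u) y) * h u \<partial>Ln n) = h u" for u
    using measurable_phi_Ln[of "\<lambda>x. x" "Ln n" n "v / (a\<^sup>2 + v)"]
    by (subst nn_integral_multc) (auto simp: nn_integral_phi)
  then show ?thesis using v by (simp add: nn_integral_jlaw_snd_fst)
qed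

lemma prob_space_jlaw:
  assumes "v > 0"
  shows "prob_space (jlaw n a v s)"
proof
  have "emeasure (jlaw n a v s) (space (jlaw n a v s)) = (\<integral>\<^sup>+x. 1 \<partial>jlaw n a v s)" by simp
  also have "\<dots> = 1" using nn_integral_jlaw_fst[OF assms, of "\<lambda>_. 1" n a s] by (simp add: nn_integral_phi)
  finally show "emeasure (jlaw n a v s) (space (jlaw n a v s)) = 1" .
qed

lemma jlaw_quad:
  assumes v: "v > 0" and i: "i \<in> {1..n}"
  shows "has_bochner_integral (jlaw n a v s) (\<lambda>x. (\<alpha> * fst x i + \<beta> * snd x i + \<gamma>)\<^sup>2)
     (((\<alpha> + \<beta> * a) * s i + \<gamma>)\<^sup>2 + (\<alpha> + \<beta> * a)\<^sup>2 + \<beta>\<^sup>2 * v)"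
proof (rule has_bochner_integral_nn_integral)
  have [measurable]: "(\<lambda>x. fst x i) \<in> borel_measurable (Ln2 n)" "(\<lambda>x. snd x i) \<in> borel_measurable (Ln2 n)"
    using i by measurable
  show "(\<lambda>x. (\<alpha> * fst x i + \<beta> * snd x i + \<gamma>)\<^sup>2) \<in> borel_measurable (jlaw n a v s)" by measurable
  have m: "(\<lambda>y. ennreal (phi n 1 s y)) \<in> borel_measurable (Ln n)"
    using measurable_phi_Ln[of "\<lambda>x. x" "Ln n" n 1 s] by simp
  have "(\<integral>\<^sup>+x. ennreal ((\<alpha> * fst x i + \<beta> * snd x i + \<gamma>)\<^sup>2) \<partial>jlaw n a v s) =
     (\<integral>\<^sup>+y. ennreal (phi n 1 s y) * (\<integral>\<^sup>+u. ennreal (phi n v (\<lambda>i. a * y i) u) * ennreal (((\<alpha> * y i + \<gamma>) + \<beta> * u i)\<^sup>2) \<partial>Ln n) \<partial>Ln n)"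
    by (subst nn_integral_jlaw_fst_snd) (auto simp: algebra_simps)
  also have "\<dots> = (\<integral>\<^sup>+y. ennreal (phi n 1 s y) * ennreal (((\<alpha> * y i + \<gamma>) + \<beta> * (a * y i))\<^sup>2 + \<beta>\<^sup>2 * v) \<partial>Ln n)"
    by (simp add: nn_integral_phi_quad[OF v i])
  also have "\<dots> = (\<integral>\<^sup>+y. ennreal (phi n 1 s y) * ennreal ((\<gamma> + (\<alpha> + \<beta> * a) * y i)\<^sup>2) + ennreal (phi n 1 s y) * ennreal (\<beta>\<^sup>2 * v) \<partial>Ln n)"
  proof (rule nn_integral_cong)
    fix y :: "nat \<Rightarrow> real"
    have "(\<alpha> * y i + \<gamma>) + \<beta> * (a * y i) = \<gamma> + (\<alpha> + \<beta> * a) * y i" by (simp add: algebra_simps)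
    then show "ennreal (phi n 1 s y) * ennreal (((\<alpha> * y i + \<gamma>) + \<beta> * (a * y i))\<^sup>2 + \<beta>\<^sup>2 * v) =
      ennreal (phi n 1 s y) * ennreal ((\<gamma> + (\<alpha> + \<beta> * a) * y i)\<^sup>2) + ennreal (phi n 1 s y) * ennreal (\<beta>\<^sup>2 * v)"
      using v by (simp only: ennreal_plus zero_le_power2 zero_le_mult_iff less_imp_le) (simp add: distrib_left)
  qed
  also have "\<dots> = ennreal ((\<gamma> + (\<alpha> + \<beta> * a) * s i)\<^sup>2 + (\<alpha> + \<beta> * a)\<^sup>2 * 1) + ennreal (\<beta>\<^sup>2 * v)"
    using i m measurable_Ln_component[OF i]
    by (subst nn_integral_add) (auto simp: nn_integral_multc nn_integral_phi nn_integral_phi_quad)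
  also have "\<dots> = ennreal (((\<alpha> + \<beta> * a) * s i + \<gamma>)\<^sup>2 + (\<alpha> + \<beta> * a)\<^sup>2 + \<beta>\<^sup>2 * v)"
    using v by (subst ennreal_plus[symmetric]) (auto simp: algebra_simps)
  finally show "(\<integral>\<^sup>+x. ennreal ((\<alpha> * fst x i + \<beta> * snd x i + \<gamma>)\<^sup>2) \<partial>jlaw n a v s) =
     ennreal (((\<alpha> + \<beta> * a) * s i + \<gamma>)\<^sup>2 + (\<alpha> + \<beta> * a)\<^sup>2 + \<beta>\<^sup>2 * v)" .
qed (use v in auto)

text \<open>The exponents are quadratic in a residual affine in both outputs, so first and second
  moments suffice. Describing the residual by \<open>lin\<close> lets one lemma serve true
  densities, linear estimators and posterior means.\<close>

lemma jlaw_ln_phi: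
  assumes v: "v > 0" and th: "\<theta> > 0"
    and lin: "\<And>y u i. i \<in> {1..n} \<Longrightarrow> Y (y, u) i - C (y, u) i = \<alpha> * y i + \<beta> * u i + \<gamma> i"
  shows "has_bochner_integral (jlaw n a v s) (\<lambda>x. ln (phi n \<theta> (C x) (Y x)))
     (- real n / 2 * ln (2 * pi * \<theta>) - (\<Sum>i=1..n. ((\<alpha> + \<beta> * a) * s i + \<gamma> i)\<^sup>2 + (\<alpha> + \<beta> * a)\<^sup>2 + \<beta>\<^sup>2 * v) / (2 * \<theta>))"
proof -
  interpret prob_space "jlaw n a v s" by (rule prob_space_jlaw[OF v])
  have "has_bochner_integral (jlaw n a v s) (\<lambda>x. \<Sum>i=1..n. (\<alpha> * fst x i + \<beta> * snd x i + \<gamma> i)\<^sup>2)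
     (\<Sum>i=1..n. ((\<alpha> + \<beta> * a) * s i + \<gamma> i)\<^sup>2 + (\<alpha> + \<beta> * a)\<^sup>2 + \<beta>\<^sup>2 * v)"
    by (intro has_bochner_integral_sum jlaw_quad[OF v])
  moreover have "has_bochner_integral (jlaw n a v s) (\<lambda>x. - real n / 2 * ln (2 * pi * \<theta>)) (- real n / 2 * ln (2 * pi * \<theta>))"
    using prob_space by (simp add: has_bochner_integral_iff del: space_jlaw)
  ultimately have "has_bochner_integral (jlaw n a v s) (\<lambda>x. - real n / 2 * ln (2 * pi * \<theta>) - (\<Sum>i=1..n. (\<alpha> * fst x i + \<beta> * snd x i + \<gamma> i)\<^sup>2) / (2 * \<theta>))
     (- real n / 2 * ln (2 * pi * \<theta>) - (\<Sum>i=1..n. ((\<alpha> + \<beta> * a) * s i + \<gamma> i)\<^sup>2 + (\<alpha> + \<beta> * a)\<^sup>2 + \<beta>\<^sup>2 * v) / (2 * \<theta>))"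
    using th by (intro has_bochner_integral_diff has_bochner_integral_divide_zero) auto
  moreover have "ln (phi n \<theta> (C x) (Y x)) = - real n / 2 * ln (2 * pi * \<theta>) - (\<Sum>i=1..n. (\<alpha> * fst x i + \<beta> * snd x i + \<gamma> i)\<^sup>2) / (2 * \<theta>)" for x
  proof -
    have "Y x i - C x i = \<alpha> * fst x i + \<beta> * snd x i + \<gamma> i" if "i \<in> {1..n}" for i
      using lin[OF that, of "fst x" "snd x"] by simp
    then show ?thesis unfolding ln_phi[OF th] by (intro arg_cong2[where f="(-)"] refl arg_cong2[where f="(/)"] sum.cong) auto
  qed
  ultimately show ?thesis by simp
qed

section \<open>Averages over the message pairs and Gibbs' inequality\<close>

definition EE :: "'t set \<Rightarrow> ('t \<Rightarrow> 'w measure) \<Rightarrow> ('t \<Rightarrow> 'w \<Rightarrow> real) \<Rightarrow> real" where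
  "EE T J X = (\<Sum>k\<in>T. \<integral>x. X k x \<partial>J k) / real (card T)"

definition II :: "'t set \<Rightarrow> ('t \<Rightarrow> 'w measure) \<Rightarrow> ('t \<Rightarrow> 'w \<Rightarrow> real) \<Rightarrow> bool" where
  "II T J X \<longleftrightarrow> (\<forall>k\<in>T. integrable (J k) (X k))"

lemma II_add: "II T J X \<Longrightarrow> II T J Y \<Longrightarrow> II T J (\<lambda>k x. X k x + Y k x)"
  and II_diff: "II T J X \<Longrightarrow> II T J Y \<Longrightarrow> II T J (\<lambda>k x. X k x - Y k x)"
  and II_cmult: "II T J X \<Longrightarrow> II T J (\<lambda>k x. c * X k x)"
  by (auto simp: II_def)

lemma EE_add: "II T J X \<Longrightarrow> II T J Y \<Longrightarrow> EE T J (\<lambda>k x. X k x + Y k x) = EE T J X + EE T J Y"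
  and EE_diff: "II T J X \<Longrightarrow> II T J Y \<Longrightarrow> EE T J (\<lambda>k x. X k x - Y k x) = EE T J X - EE T J Y"
  by (auto simp: II_def EE_def sum.distrib sum_subtractf add_divide_distrib diff_divide_distrib)

lemma EE_cmult: "EE T J (\<lambda>k x. c * X k x) = c * EE T J X"
  by (auto simp: EE_def sum_distrib_left)

lemma II_const: "(\<And>k. k \<in> T \<Longrightarrow> prob_space (J k)) \<Longrightarrow> II T J (\<lambda>k x. c)"
  unfolding II_def by (auto intro!: finite_measure.integrable_const simp: prob_space_def)

lemma EE_const:
  assumes "\<And>k. k \<in> T \<Longrightarrow> prob_space (J k)" "finite T" "T \<noteq> {}"
  shows "EE T J (\<lambda>k x. c) = c"
proof -
  have "(\<Sum>k\<in>T. \<integral>x. c \<partial>J k) = (\<Sum>k\<in>T. c)"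
    using assms(1) by (intro sum.cong) (auto simp: prob_space.prob_space)
  then show ?thesis using assms by (simp add: EE_def)
qed

text \<open>From \<open>X \<le> exp X - 1\<close>. \<open>EE\<close> averages over a uniform index
  with a separate law for each index, so \<open>le\<close> says that \<open>exp X\<close> has mean
  at most one without forming a joint measure of index and output.\<close>

lemma gibbs:
  assumes T: "finite T" and J: "\<And>k. k \<in> T \<Longrightarrow> prob_space (J k)"
    and I: "II T J X"
    and le: "(\<Sum>k\<in>T. \<integral>\<^sup>+x. ennreal (exp (X k x)) \<partial>J k) \<le> ennreal (real (card T))"
  shows "EE T J X \<le> 0"
proof -
  have [measurable]: "X k \<in> borel_measurable (J k)" if "k \<in> T" for k using I that by (auto simp: II_def)
  have fin: "(\<integral>\<^sup>+x. ennreal (exp (X k x)) \<partial>J k) < \<infinity>" if "k \<in> T" for k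
  proof -
    have "(\<integral>\<^sup>+x. ennreal (exp (X k x)) \<partial>J k) \<le> (\<Sum>k\<in>T. \<integral>\<^sup>+x. ennreal (exp (X k x)) \<partial>J k)"
      using T that by (intro member_le_sum) auto
    also have "\<dots> < \<infinity>" using le by (auto simp: top.not_eq_extremum intro: le_less_trans)
    finally show ?thesis .
  qed
  have int: "integrable (J k) (\<lambda>x. exp (X k x))" if "k \<in> T" for k
    using that fin[OF that] by (intro integrableI_bounded) auto
  have "(\<Sum>k\<in>T. \<integral>x. X k x \<partial>J k) \<le> (\<Sum>k\<in>T. (\<integral>x. exp (X k x) \<partial>J k) - 1)"
  proof (intro sum_mono)
    fix k assume k: "k \<in> T"
    interpret prob_space "J k" by (rule J[OF k])
    have "(\<integral>x. X k x \<partial>J k) \<le> (\<integral>x. exp (X k x) - 1 \<partial>J k)"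
    proof (intro integral_mono)
      show "X k x \<le> exp (X k x) - 1" for x using exp_ge_add_one_self[of "X k x"] by linarith
    qed (use I k int in \<open>auto simp: II_def\<close>)
    then show "(\<integral>x. X k x \<partial>J k) \<le> (\<integral>x. exp (X k x) \<partial>J k) - 1" using int[OF k] by (simp add: prob_space)
  qed
  also have "\<dots> = (\<Sum>k\<in>T. \<integral>x. exp (X k x) \<partial>J k) - real (card T)" by (simp add: sum_subtractf)
  also have "(\<Sum>k\<in>T. \<integral>x. exp (X k x) \<partial>J k) \<le> real (card T)"
  proof -
    have "ennreal (\<Sum>k\<in>T. \<integral>x. exp (X k x) \<partial>J k) = (\<Sum>k\<in>T. \<integral>\<^sup>+x. ennreal (exp (X k x)) \<partial>J k)"
    proof -
      have "(\<Sum>k\<in>T. \<integral>\<^sup>+x. ennreal (exp (X k x)) \<partial>J k) = (\<Sum>k\<in>T. ennreal (\<integral>x. exp (X k x) \<partial>J k))"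
        using int by (intro sum.cong nn_integral_eq_integral) auto
      then show ?thesis by (simp add: sum_ennreal integral_nonneg)
    qed
    with le have "ennreal (\<Sum>k\<in>T. \<integral>x. exp (X k x) \<partial>J k) \<le> ennreal (real (card T))" by simp
    then show ?thesis by (subst (asm) ennreal_le_iff) auto
  qed
  finally show ?thesis by (simp add: EE_def divide_nonpos_nonneg)
qed

section \<open>Converse bounds for one block\<close>

text \<open>The bounds give
  \<open>\<bar>ln f\<bar> \<le> \<bar>ln g\<bar> + \<bar>ln B\<bar>\<close>. Meant for mixtures,
  with \<open>g\<close> a multiple of one component and \<open>B\<close> the peak height.\<close>

lemma integrable_ln_between:
  fixes f g :: "'w \<Rightarrow> real"
  assumes "prob_space Q" and g: "integrable Q (\<lambda>x. ln (g x))"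
    and f [measurable]: "f \<in> borel_measurable Q"
    and bounds: "\<And>x. 0 < g x" "\<And>x. g x \<le> f x" "\<And>x. f x \<le> B"
  shows "integrable Q (\<lambda>x. ln (f x))"
proof -
  interpret prob_space Q by fact
  show ?thesis
  proof (rule Bochner_Integration.integrable_bound)
    show "integrable Q (\<lambda>x. \<bar>ln (g x)\<bar> + \<bar>ln B\<bar>)" using g by auto
    show "AE x in Q. norm (ln (f x)) \<le> norm (\<bar>ln (g x)\<bar> + \<bar>ln B\<bar>)"
    proof (rule AE_I2)
      fix x
      have "ln (g x) \<le> ln (f x)" "ln (f x) \<le> ln B"
        using bounds[of x] by (auto intro!: ln_mono)
      then show "norm (ln (f x)) \<le> norm (\<bar>ln (g x)\<bar> + \<bar>ln B\<bar>)" by (simp add: abs_le_iff) linarith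
    qed
  qed simp
qed

lemma phi_neq_0: "v > 0 \<Longrightarrow> phi n v c y \<noteq> 0"
  using phi_pos[of v n c y] by simp

lemma nn_integral_phi_sum:
  assumes "finite A" "\<theta> > 0"
  shows "(\<integral>\<^sup>+u. ennreal (\<Sum>k\<in>A. phi n \<theta> (c k) u) \<partial>Ln n) = ennreal (real (card A))"
proof -
  note [measurable] = measurable_phi_Ln[of "\<lambda>x. x" "Ln n" n \<theta>, simplified]
  have "(\<integral>\<^sup>+u. ennreal (\<Sum>k\<in>A. phi n \<theta> (c k) u) \<partial>Ln n) = (\<integral>\<^sup>+u. (\<Sum>k\<in>A. ennreal (phi n \<theta> (c k) u)) \<partial>Ln n)"
    by (intro nn_integral_cong) (simp add: sum_ennreal)
  also have "\<dots> = ennreal (real (card A))"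
    by (subst nn_integral_sum) (auto simp: nn_integral_phi[OF assms(2)] ennreal_of_nat_eq_real_of_nat)
  finally show ?thesis .
qed

lemma nn_integral_phi_avg:
  assumes "finite A" "A \<noteq> {}" "\<theta> > 0"
  shows "(\<integral>\<^sup>+u. ennreal ((\<Sum>k\<in>A. phi n \<theta> (c k) u) / real (card A)) \<partial>Ln n) = 1"
proof -
  note [measurable] = measurable_phi_Ln[of "\<lambda>x. x" "Ln n" n \<theta>, simplified]
  have cA: "real (card A) > 0" using assms by (simp add: card_gt_0_iff)
  have "(\<integral>\<^sup>+u. ennreal ((\<Sum>k\<in>A. phi n \<theta> (c k) u) / real (card A)) \<partial>Ln n) =
    (\<integral>\<^sup>+u. ennreal (1 / real (card A)) * ennreal (\<Sum>k\<in>A. phi n \<theta> (c k) u) \<partial>Ln n)"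
    by (intro nn_integral_cong) (simp add: ennreal_mult'[symmetric] sum_nonneg)
  also have "\<dots> = ennreal (1 / real (card A)) * ennreal (real (card A))"
    by (subst nn_integral_cmult) (auto simp: nn_integral_phi_sum[OF assms(1,3)])
  also have "\<dots> = 1" using cA by (simp add: ennreal_mult'[symmetric])
  finally show ?thesis .
qed

lemma phi_sum_le:
  assumes "finite A" "\<theta> > 0"
  shows "(\<Sum>k\<in>A. phi n \<theta> (c k) u) \<le> real (card A) * exp (- real n / 2 * ln (2 * pi * \<theta>))"
  using sum_bounded_above[of A "\<lambda>k. phi n \<theta> (c k) u"] phi_le[OF assms(2)] by simp

lemma nn_integral_pair_phi:
  assumes [measurable]: "h \<in> borel_measurable (Ln n)" and h: "\<And>u. h u \<ge> 0" and th: "\<theta> > 0"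
    and m: "\<And>i. i \<in> {1..n} \<Longrightarrow> (\<lambda>u. C u i) \<in> borel_measurable (Ln n)"
  shows "(\<integral>\<^sup>+x. ennreal (h (snd x) * phi n \<theta> (C (snd x)) (fst x)) \<partial>Ln2 n) = (\<integral>\<^sup>+u. ennreal (h u) \<partial>Ln n)"
proof -
  have [measurable]: "(\<lambda>x. phi n \<theta> (C (snd x)) (fst x)) \<in> borel_measurable (Ln2 n)"
    by (intro measurable_phi measurable_fst_snd_component measurable_compose[OF measurable_snd m])
  have [measurable]: "(\<lambda>y. phi n \<theta> c y) \<in> borel_measurable (Ln n)" for c
    by (intro measurable_phi measurable_Ln_component borel_measurable_const)
  have "(\<integral>\<^sup>+x. ennreal (h (snd x) * phi n \<theta> (C (snd x)) (fst x)) \<partial>Ln2 n) =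
    (\<integral>\<^sup>+u. \<integral>\<^sup>+y. ennreal (h u) * ennreal (phi n \<theta> (C u) y) \<partial>Ln n \<partial>Ln n)"
    by (subst nn_integral_Ln_pair(2)) (auto simp: ennreal_mult h)
  also have "\<dots> = (\<integral>\<^sup>+u. ennreal (h u) \<partial>Ln n)"
    by (intro nn_integral_cong, subst nn_integral_cmult) (auto simp: nn_integral_phi[OF th])
  finally show ?thesis .
qed

lemma nn_integral_pair_phi':
  assumes [measurable]: "h \<in> borel_measurable (Ln n)" and h: "\<And>u. h u \<ge> 0" and th: "\<theta> > 0"
    and m: "\<And>i. i \<in> {1..n} \<Longrightarrow> (\<lambda>u. C u i) \<in> borel_measurable (Ln n)"
  shows "(\<integral>\<^sup>+x. ennreal (h (fst x) * phi n \<theta> (C (fst x)) (snd x)) \<partial>Ln2 n) = (\<integral>\<^sup>+u. ennreal (h u) \<partial>Ln n)"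
proof -
  have [measurable]: "(\<lambda>x. phi n \<theta> (C (fst x)) (snd x)) \<in> borel_measurable (Ln2 n)"
    by (intro measurable_phi measurable_fst_snd_component measurable_compose[OF measurable_fst m])
  have [measurable]: "(\<lambda>y. phi n \<theta> c y) \<in> borel_measurable (Ln n)" for c
    by (intro measurable_phi measurable_Ln_component borel_measurable_const)
  have "(\<integral>\<^sup>+x. ennreal (h (fst x) * phi n \<theta> (C (fst x)) (snd x)) \<partial>Ln2 n) =
    (\<integral>\<^sup>+u. \<integral>\<^sup>+y. ennreal (h u) * ennreal (phi n \<theta> (C u) y) \<partial>Ln n \<partial>Ln n)"
    by (subst nn_integral_Ln_pair(1)) (auto simp: ennreal_mult h)
  also have "\<dots> = (\<integral>\<^sup>+u. ennreal (h u) \<partial>Ln n)"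
    by (intro nn_integral_cong, subst nn_integral_cmult) (auto simp: nn_integral_phi[OF th])
  finally show ?thesis .
qed

text \<open>Only the received codewords \<open>s (w, m)\<close> and the decoder matter here; links
  and powers enter later through index maps and estimators.\<close>

locale block =
  fixes n N M :: nat and s :: "nat \<times> nat \<Rightarrow> nat \<Rightarrow> real" and dc :: "(nat \<Rightarrow> real) \<Rightarrow> nat"
  assumes N1: "N \<ge> 1" and M1: "M \<ge> 1" and dc [measurable]: "dc \<in> measurable (Ln n) (count_space {1..N})"
begin

definition T :: "(nat \<times> nat) set" where "T = {1..N} \<times> {1..M}"

definition J :: "real \<Rightarrow> real \<Rightarrow> nat \<times> nat \<Rightarrow> ((nat \<Rightarrow> real) \<times> (nat \<Rightarrow> real)) measure" where
  "J a v k = jlaw n a v (s k)"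

lemma T_props [simp]: "finite T" "T \<noteq> {}" "card T = N * M"
  using N1 M1 by (auto simp: T_def)

lemma card_T_pos: "real N * real M > 0" "real N > 0" "real M > 0" "N \<noteq> 0" "M \<noteq> 0" using N1 M1 by auto

lemma prob_J: "v > 0 \<Longrightarrow> prob_space (J a v k)"
  unfolding J_def by (rule prob_space_jlaw)

lemma sets_J [simp, measurable_cong]: "sets (J a v k) = sets (Ln2 n)"
  by (simp add: J_def)

lemma sum_T: "(\<Sum>k\<in>T. F k) = (\<Sum>m\<in>{1..M}. \<Sum>w\<in>{1..N}. F (w, m))"
  unfolding T_def by (subst sum.swap) (simp add: sum.cartesian_product)

text \<open>Reduces an information inequality to a pointwise bound: \<open>G\<close> is the
  (sub)density of a test law on the output pair, and the left side of \<open>le\<close> is the true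
  law times the likelihood ratio, summed over the message pairs.\<close>

lemma gibbs_block:
  assumes v: "v > 0" and I: "II T (J a v) X"
    and [measurable]: "G \<in> borel_measurable (Ln2 n)"
    and le: "\<And>y u. y \<in> space (Ln n) \<Longrightarrow> u \<in> space (Ln n) \<Longrightarrow>
       (\<Sum>k\<in>T. phi n 1 (s k) y * phi n v (\<lambda>i. a * y i) u * exp (X k (y, u))) \<le> real N * real M * G (y, u)"
    and int: "(\<integral>\<^sup>+x. ennreal (G x) \<partial>Ln2 n) \<le> 1"
  shows "EE T (J a v) X \<le> 0"
proof (rule gibbs)
  have [measurable]: "X k \<in> borel_measurable (Ln2 n)" if "k \<in> T" for k
    using I that by (auto simp: II_def J_def)
  have "(\<Sum>k\<in>T. \<integral>\<^sup>+x. ennreal (exp (X k x)) \<partial>J a v k) =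
    (\<Sum>k\<in>T. \<integral>\<^sup>+x. ennreal (phi n 1 (s k) (fst x) * phi n v (\<lambda>i. a * fst x i) (snd x) * exp (X k x)) \<partial>Ln2 n)"
    unfolding J_def by (intro sum.cong refl, subst nn_integral_jlaw) (auto simp: ennreal_mult)
  also have "\<dots> = (\<integral>\<^sup>+x. (\<Sum>k\<in>T. ennreal (phi n 1 (s k) (fst x) * phi n v (\<lambda>i. a * fst x i) (snd x) * exp (X k x))) \<partial>Ln2 n)"
    by (subst nn_integral_sum) auto
  also have "\<dots> \<le> (\<integral>\<^sup>+x. ennreal (real N * real M) * ennreal (G x) \<partial>Ln2 n)"
  proof (rule nn_integral_mono)
    fix x assume "x \<in> space (Ln2 n)"
    then have "fst x \<in> space (Ln n)" "snd x \<in> space (Ln n)" by (auto simp: space_pair_measure)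
    from le[OF this]
    show "(\<Sum>k\<in>T. ennreal (phi n 1 (s k) (fst x) * phi n v (\<lambda>i. a * fst x i) (snd x) * exp (X k x))) \<le> ennreal (real N * real M) * ennreal (G x)"
      by (subst sum_ennreal, simp) (auto simp: ennreal_mult'[symmetric] intro!: ennreal_leI)
  qed
  also have "\<dots> = ennreal (real N * real M) * (\<integral>\<^sup>+x. ennreal (G x) \<partial>Ln2 n)"
    by (subst nn_integral_cmult) auto
  also have "\<dots> \<le> ennreal (real N * real M) * 1" by (intro mult_left_mono int) auto
  finally show "(\<Sum>k\<in>T. \<integral>\<^sup>+x. ennreal (exp (X k x)) \<partial>J a v k) \<le> ennreal (real (card T))" by simp
qed (use I v prob_J in auto)

definition rr :: "nat \<Rightarrow> (nat \<Rightarrow> real) \<Rightarrow> real" where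
  "rr w y = (if dc y = w then 1 / 2 else 1 / (2 * real N))"

lemma rr_pos: "rr w y > 0" using N1 by (simp add: rr_def)

lemma rr_sum: "A \<subseteq> {1..N} \<Longrightarrow> (\<Sum>w\<in>A. rr w y) \<le> 1"
proof -
  assume A: "A \<subseteq> {1..N}"
  have "(\<Sum>w\<in>A. rr w y) \<le> (\<Sum>w\<in>{1..N}. rr w y)"
    using A rr_pos by (intro sum_mono2) (auto intro: less_imp_le)
  also have "\<dots> \<le> (\<Sum>w\<in>{1..N}. 1 / (2 * real N) + (if w = dc y then 1 / 2 else 0))"
    by (intro sum_mono) (auto simp: rr_def)
  also have "\<dots> \<le> 1" using N1 by (simp add: sum.distrib sum.delta)
  finally show ?thesis .
qed

definition Pe :: real where
  "Pe = (\<Sum>k\<in>T. enn2real (\<integral>\<^sup>+y. ennreal (phi n 1 (s k) y) * indicator {y. dc y \<noteq> fst k} y \<partial>Ln n)) / real (card T)"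

lemma dc_set [measurable]: "{y \<in> space (Ln n). dc y \<noteq> w} \<in> sets (Ln n)"
proof -
  have "{y \<in> space (Ln n). dc y \<noteq> w} = dc -` ({1..N} - {w}) \<inter> space (Ln n)"
    using measurable_space[OF dc] by auto
  then show ?thesis using measurable_sets[OF dc, of "{1..N} - {w}"] by simp
qed

text \<open>A correct guess costs \<open>ln 2\<close>, a wrong one
  \<open>ln 2 + ln (real N)\<close>. Adding \<open>ln (real N)\<close> gives
  \<open>(1 - Pe) * ln (real N) - ln 2\<close>, the usual outcome of Fano's inequality.\<close>

lemma ln_rr:
  assumes v: "v > 0"
  shows "II T (J a v) (\<lambda>k x. ln (rr (fst k) (fst x)))"
    "EE T (J a v) (\<lambda>k x. ln (rr (fst k) (fst x))) = - ln 2 - Pe * ln (real N)"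
proof -
  let ?B = "\<lambda>k x. indicator {x \<in> space (Ln2 n). dc (fst x) \<noteq> fst k} x :: real"
  have sB [measurable]: "{x \<in> space (Ln2 n). dc (fst x) \<noteq> w} \<in> sets (Ln2 n)" for w
  proof -
    have "{x \<in> space (Ln2 n). dc (fst x) \<noteq> w} = fst -` {y \<in> space (Ln n). dc y \<noteq> w} \<inter> space (Ln2 n)"
      by (auto simp: space_pair_measure)
    then show ?thesis using measurable_sets[OF measurable_fst dc_set] by simp
  qed
  have iB: "II T (J a v) ?B"
    unfolding II_def
  proof
    fix k
    interpret prob_space "J a v k" by (rule prob_J[OF v])
    show "integrable (J a v k) (?B k)" by (rule integrable_const_bound[where B=1]) auto
  qed
  have eB: "EE T (J a v) ?B = Pe"
  proof -
    have "(\<integral>x. ?B k x \<partial>J a v k) = enn2real (\<integral>\<^sup>+y. ennreal (phi n 1 (s k) y) * indicator {y. dc y \<noteq> fst k} y \<partial>Ln n)" for k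
    proof -
      have "(\<integral>x. ?B k x \<partial>J a v k) = enn2real (\<integral>\<^sup>+x. ennreal (?B k x) \<partial>J a v k)"
        by (rule integral_eq_nn_integral) auto
      also have "(\<integral>\<^sup>+x. ennreal (?B k x) \<partial>J a v k) = (\<integral>\<^sup>+x. indicator {y \<in> space (Ln n). dc y \<noteq> fst k} (fst x) \<partial>J a v k)"
        by (intro nn_integral_cong) (auto simp: indicator_def J_def space_pair_measure)
      also have "\<dots> = (\<integral>\<^sup>+y. ennreal (phi n 1 (s k) y) * indicator {y \<in> space (Ln n). dc y \<noteq> fst k} y \<partial>Ln n)"
        unfolding J_def by (rule nn_integral_jlaw_fst[OF v]) simp
      also have "\<dots> = (\<integral>\<^sup>+y. ennreal (phi n 1 (s k) y) * indicator {y. dc y \<noteq> fst k} y \<partial>Ln n)"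
        by (intro nn_integral_cong) (auto simp: indicator_def)
      finally show ?thesis .
    qed
    then show ?thesis by (simp add: EE_def Pe_def)
  qed
  have P: "\<And>k. k \<in> T \<Longrightarrow> prob_space (J a v k)" using prob_J[OF v] by simp
  have eq: "ln (rr (fst k) (fst x)) = - ln 2 - ln (real N) * ?B k x" if "x \<in> space (J a v k)" for k x
    using that N1 by (auto simp: rr_def indicator_def J_def ln_div ln_mult)
  have "II T (J a v) (\<lambda>k x. - ln 2 - ln (real N) * ?B k x)"
    by (intro II_diff II_cmult iB II_const P)
  then show "II T (J a v) (\<lambda>k x. ln (rr (fst k) (fst x)))"
    unfolding II_def by (intro ballI, subst Bochner_Integration.integrable_cong[OF refl eq]) auto
  have "EE T (J a v) (\<lambda>k x. ln (rr (fst k) (fst x))) = EE T (J a v) (\<lambda>k x. - ln 2 - ln (real N) * ?B k x)"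
    unfolding EE_def using eq by (intro arg_cong2[where f="(/)"] sum.cong refl Bochner_Integration.integral_cong) auto
  also have "\<dots> = - ln 2 - ln (real N) * Pe"
    by (subst EE_diff[OF II_const[OF P] II_cmult[OF iB]]) (auto simp: EE_cmult eB EE_const[OF P])
  finally show "EE T (J a v) (\<lambda>k x. ln (rr (fst k) (fst x))) = - ln 2 - Pe * ln (real N)" by simp
qed

lemma EE_const_J [simp]: "v > 0 \<Longrightarrow> EE T (J a v) (\<lambda>k x. c) = c"
  using prob_J by (intro EE_const) auto

lemma II_const_J: "v > 0 \<Longrightarrow> II T (J a v) (\<lambda>k x. c)"
  using prob_J by (intro II_const) auto

lemma ln_phi_J:
  assumes v: "v > 0" and th: "\<theta> > 0"
    and lin: "\<And>k y u i. k \<in> T \<Longrightarrow> i \<in> {1..n} \<Longrightarrow> Y k (y, u) i - C k (y, u) i = \<alpha> * y i + \<beta> * u i + \<gamma> k i"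
  shows "II T (J a v) (\<lambda>k x. ln (phi n \<theta> (C k x) (Y k x)))"
    "EE T (J a v) (\<lambda>k x. ln (phi n \<theta> (C k x) (Y k x))) = - real n / 2 * ln (2 * pi * \<theta>) -
      (\<Sum>k\<in>T. \<Sum>i=1..n. ((\<alpha> + \<beta> * a) * s k i + \<gamma> k i)\<^sup>2 + (\<alpha> + \<beta> * a)\<^sup>2 + \<beta>\<^sup>2 * v) / real (card T) / (2 * \<theta>)"
proof -
  have *: "has_bochner_integral (J a v k) (\<lambda>x. ln (phi n \<theta> (C k x) (Y k x)))
     (- real n / 2 * ln (2 * pi * \<theta>) - (\<Sum>i=1..n. ((\<alpha> + \<beta> * a) * s k i + \<gamma> k i)\<^sup>2 + (\<alpha> + \<beta> * a)\<^sup>2 + \<beta>\<^sup>2 * v) / (2 * \<theta>))"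
    if "k \<in> T" for k
    unfolding J_def using lin[OF that] by (intro jlaw_ln_phi v th) auto
  then show "II T (J a v) (\<lambda>k x. ln (phi n \<theta> (C k x) (Y k x)))"
    by (auto simp: II_def has_bochner_integral_iff)
  have "(\<Sum>k\<in>T. \<integral>x. ln (phi n \<theta> (C k x) (Y k x)) \<partial>J a v k) =
    (\<Sum>k\<in>T. - real n / 2 * ln (2 * pi * \<theta>) - (\<Sum>i=1..n. ((\<alpha> + \<beta> * a) * s k i + \<gamma> k i)\<^sup>2 + (\<alpha> + \<beta> * a)\<^sup>2 + \<beta>\<^sup>2 * v) / (2 * \<theta>))"
    using * by (intro sum.cong) (auto simp: has_bochner_integral_iff)
  then show "EE T (J a v) (\<lambda>k x. ln (phi n \<theta> (C k x) (Y k x))) = - real n / 2 * ln (2 * pi * \<theta>) -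
      (\<Sum>k\<in>T. \<Sum>i=1..n. ((\<alpha> + \<beta> * a) * s k i + \<gamma> k i)\<^sup>2 + (\<alpha> + \<beta> * a)\<^sup>2 + \<beta>\<^sup>2 * v) / real (card T) / (2 * \<theta>)"
    using card_T_pos unfolding EE_def
    by (simp add: sum_subtractf sum_divide_distrib[symmetric] diff_divide_distrib)
qed

text \<open>Averaged over message pairs but summed over time, hence the factor \<open>n\<close> in
  all power and variance bounds.\<close>

definition avg :: "(nat \<times> nat \<Rightarrow> nat \<Rightarrow> real) \<Rightarrow> real" where
  "avg F = (\<Sum>k\<in>T. \<Sum>i=1..n. F k i) / real (card T)"

lemma avg_const [simp]: "avg (\<lambda>k i. c) = real n * c"
  using card_T_pos by (simp add: avg_def)

lemma avg_add: "avg (\<lambda>k i. F k i + G k i) = avg F + avg G"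
  and avg_diff: "avg (\<lambda>k i. F k i - G k i) = avg F - avg G"
  and avg_cmult: "avg (\<lambda>k i. c * F k i) = c * avg F"
  by (auto simp: avg_def sum.distrib sum_subtractf sum_distrib_left add_divide_distrib diff_divide_distrib)

text \<open>The upper bound on entropy by a Gaussian: if the mean square residual is at most
  \<open>\<theta>\<close> per letter, the expected test log-density is at least minus the Gaussian
  entropy.\<close>

lemma ln_phi_test:
  assumes v: "v > 0" and th: "\<theta> > 0"
    and lin: "\<And>k y u i. k \<in> T \<Longrightarrow> i \<in> {1..n} \<Longrightarrow> Y k (y, u) i - C k (y, u) i = \<alpha> * y i + \<beta> * u i + \<gamma> k i"
    and le: "avg (\<lambda>k i. ((\<alpha> + \<beta> * a) * s k i + \<gamma> k i)\<^sup>2) + real n * ((\<alpha> + \<beta> * a)\<^sup>2 + \<beta>\<^sup>2 * v) \<le> real n * \<theta>"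
  shows "- real n / 2 * (ln (2 * pi) + ln \<theta> + 1) \<le> EE T (J a v) (\<lambda>k x. ln (phi n \<theta> (C k x) (Y k x)))"
proof -
  have "avg (\<lambda>k i. ((\<alpha> + \<beta> * a) * s k i + \<gamma> k i)\<^sup>2 + (\<alpha> + \<beta> * a)\<^sup>2 + \<beta>\<^sup>2 * v) \<le> real n * \<theta>"
    using le unfolding avg_add avg_const by (simp add: algebra_simps)
  then have "avg (\<lambda>k i. ((\<alpha> + \<beta> * a) * s k i + \<gamma> k i)\<^sup>2 + (\<alpha> + \<beta> * a)\<^sup>2 + \<beta>\<^sup>2 * v) / (2 * \<theta>) \<le> real n / 2"
    using th by (simp add: field_simps)
  moreover have "EE T (J a v) (\<lambda>k x. ln (phi n \<theta> (C k x) (Y k x))) = - real n / 2 * ln (2 * pi * \<theta>) -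
      avg (\<lambda>k i. ((\<alpha> + \<beta> * a) * s k i + \<gamma> k i)\<^sup>2 + (\<alpha> + \<beta> * a)\<^sup>2 + \<beta>\<^sup>2 * v) / (2 * \<theta>)"
    unfolding avg_def by (rule ln_phi_J(2)[OF v th]) (rule lin)
  ultimately show ?thesis using th by (simp add: ln_mult algebra_simps)
qed

text \<open>The case of a true conditional density: the residual is centred with variance
  \<open>\<theta>\<close>, and the Gaussian entropy is attained.\<close>

lemma ln_phi_exact:
  assumes v: "v > 0" and th: "\<theta> > 0"
    and lin: "\<And>k y u i. k \<in> T \<Longrightarrow> i \<in> {1..n} \<Longrightarrow> Y k (y, u) i - C k (y, u) i = \<alpha> * y i + \<beta> * u i + \<gamma> k i"
    and eq: "\<And>k i. k \<in> T \<Longrightarrow> i \<in> {1..n} \<Longrightarrow> (\<alpha> + \<beta> * a) * s k i + \<gamma> k i = 0" "(\<alpha> + \<beta> * a)\<^sup>2 + \<beta>\<^sup>2 * v = \<theta>"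
  shows "EE T (J a v) (\<lambda>k x. ln (phi n \<theta> (C k x) (Y k x))) = - real n / 2 * (ln (2 * pi) + ln \<theta> + 1)"
proof -
  have "(\<Sum>k\<in>T. \<Sum>i=1..n. ((\<alpha> + \<beta> * a) * s k i + \<gamma> k i)\<^sup>2 + (\<alpha> + \<beta> * a)\<^sup>2 + \<beta>\<^sup>2 * v) = (\<Sum>k\<in>T. \<Sum>i=1..n. \<theta>)"
    using eq by (intro sum.cong) (auto simp: add.assoc)
  moreover have "EE T (J a v) (\<lambda>k x. ln (phi n \<theta> (C k x) (Y k x))) = - real n / 2 * ln (2 * pi * \<theta>) -
      (\<Sum>k\<in>T. \<Sum>i=1..n. ((\<alpha> + \<beta> * a) * s k i + \<gamma> k i)\<^sup>2 + (\<alpha> + \<beta> * a)\<^sup>2 + \<beta>\<^sup>2 * v) / real (card T) / (2 * \<theta>)"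
    by (rule ln_phi_J(2)[OF v th]) (rule lin)
  ultimately show ?thesis
    using th card_T_pos by (simp add: ln_mult field_simps)
qed

text \<open>\<open>jj\<close> is what crosses the cut, known together with \<open>m\<close>;
  \<open>c\<close> estimates the codeword from it, and \<open>\<theta>\<close> bounds noise plus
  estimation error. Taking for \<open>JJ\<close> one link, both links or a single point yields
  \<open>f1\<close> and \<open>f2\<close>, f3(0), and \<open>f4\<close>.\<close>

lemma cutset:
  fixes jj :: "nat \<times> nat \<Rightarrow> 'j" and c :: "'j \<Rightarrow> nat \<Rightarrow> nat \<Rightarrow> real"
  assumes JJ: "finite JJ" "\<And>k. k \<in> T \<Longrightarrow> jj k \<in> JJ" and th: "\<theta> > 0"
    and le: "avg (\<lambda>k i. (s k i - c (jj k) (snd k) i)\<^sup>2) + real n \<le> real n * \<theta>"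
  shows "(1 - Pe) * ln (real N) - ln 2 - ln (real (card JJ)) \<le> real n / 2 * ln \<theta>"
proof -
  have JJne: "JJ \<noteq> {}" using JJ(2) T_props(2) by blast
  have cJ: "real (card JJ) > 0" using JJ(1) JJne by (simp add: card_gt_0_iff)
  \<comment> \<open>The likelihood ratio is the guess, times \<open>N / card JJ\<close>, times test
    density over true density.\<close>
  define X where "X k x = ln (rr (fst k) (fst x)) + ((ln (real N) - ln (real (card JJ))) +
    (ln (phi n \<theta> (c (jj k) (snd k)) (fst x)) - ln (phi n 1 (s k) (fst x))))" for k :: "nat \<times> nat" and x :: "(nat \<Rightarrow> real) \<times> (nat \<Rightarrow> real)"
  have v: "(1::real) > 0" by simp
  note R = ln_rr[OF v, of 0]
  have I1: "II T (J 0 1) (\<lambda>k x. ln (phi n \<theta> (c (jj k) (snd k)) (fst x)))"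
    by (rule ln_phi_J(1)[where \<alpha>=1 and \<beta>=0 and \<gamma>="\<lambda>k i. - c (jj k) (snd k) i", OF v th]) simp
  have I2: "II T (J 0 1) (\<lambda>k x. ln (phi n 1 (s k) (fst x)))"
    by (rule ln_phi_J(1)[where \<alpha>=1 and \<beta>=0 and \<gamma>="\<lambda>k i. - s k i", OF v v]) simp
  have II: "II T (J 0 1) (\<lambda>k x. X k x)"
    unfolding X_def by (intro II_add II_diff R(1) I1 I2 II_const_J v)
  have "EE T (J 0 1) X \<le> 0"
  proof (rule gibbs_block[OF v II])
    let ?G = "\<lambda>x. phi n 1 (\<lambda>i. 0 * fst x i) (snd x) * ((\<Sum>m\<in>{1..M}. \<Sum>j\<in>JJ. phi n \<theta> (c j m) (fst x)) / (real M * real (card JJ)))"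
    show "?G \<in> borel_measurable (Ln2 n)" by measurable
    have eX: "phi n 1 (s k) y * exp (X k (y, u)) = real N / real (card JJ) * (rr (fst k) y * phi n \<theta> (c (jj k) (snd k)) y)" for k y u
      using phi_pos[OF th] phi_pos[OF v] rr_pos cJ N1 th
      by (simp add: X_def exp_add exp_diff phi_neq_0)
    show "(\<Sum>k\<in>T. phi n 1 (s k) y * phi n 1 (\<lambda>i. 0 * y i) u * exp (X k (y, u))) \<le> real N * real M * ?G (y, u)" for y u
    proof -
      have "(\<Sum>k\<in>T. phi n 1 (s k) y * exp (X k (y, u))) =
         real N / real (card JJ) * (\<Sum>m\<in>{1..M}. \<Sum>w\<in>{1..N}. rr w y * phi n \<theta> (c (jj (w, m)) m) y)"
        unfolding eX sum_distrib_left[symmetric] sum_T by simp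
      also have "\<dots> \<le> real N / real (card JJ) * (\<Sum>m\<in>{1..M}. (\<Sum>j\<in>JJ. phi n \<theta> (c j m) y))"
      proof (intro mult_left_mono sum_mono)
        fix m assume m: "m \<in> {1..M}"
        \<comment> \<open>The index of \<open>w\<close> is replaced by a sum over all indices. This
          factor no longer depends on \<open>w\<close>, so the guesses can be summed; the price is
          the factor \<open>card JJ\<close>.\<close>
        have "(\<Sum>w\<in>{1..N}. rr w y * phi n \<theta> (c (jj (w, m)) m) y) \<le> (\<Sum>w\<in>{1..N}. rr w y * (\<Sum>j\<in>JJ. phi n \<theta> (c j m) y))"
          using JJ m by (intro sum_mono mult_left_mono member_le_sum[of _ JJ "\<lambda>j. phi n \<theta> (c j m) y"])
            (auto simp: T_def intro: less_imp_le[OF rr_pos])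
        also have "\<dots> \<le> 1 * (\<Sum>j\<in>JJ. phi n \<theta> (c j m) y)"
          unfolding sum_distrib_right[symmetric] by (intro mult_right_mono rr_sum sum_nonneg) auto
        finally show "(\<Sum>w\<in>{1..N}. rr w y * phi n \<theta> (c (jj (w, m)) m) y) \<le> (\<Sum>j\<in>JJ. phi n \<theta> (c j m) y)" by simp
      qed simp
      finally have "phi n 1 (\<lambda>i. 0 * y i) u * (\<Sum>k\<in>T. phi n 1 (s k) y * exp (X k (y, u))) \<le>
         phi n 1 (\<lambda>i. 0 * y i) u * (real N / real (card JJ) * (\<Sum>m\<in>{1..M}. (\<Sum>j\<in>JJ. phi n \<theta> (c j m) y)))"
        by (intro mult_left_mono) auto
      moreover have "phi n 1 (\<lambda>i. 0 * y i) u * (real N / real (card JJ) * S) =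
          real N * real M * (phi n 1 (\<lambda>i. 0 * y i) u * (S / (real M * real (card JJ))))" for S
        using card_T_pos cJ by (simp add: field_simps)
      moreover have "(\<Sum>k\<in>T. phi n 1 (s k) y * phi n 1 (\<lambda>i. 0 * y i) u * exp (X k (y, u))) =
          phi n 1 (\<lambda>i. 0 * y i) u * (\<Sum>k\<in>T. phi n 1 (s k) y * exp (X k (y, u)))"
        by (simp only: sum_distrib_left mult_ac)
      ultimately show ?thesis by (simp only: fst_conv snd_conv)
    qed
    let ?h = "\<lambda>y. (\<Sum>m\<in>{1..M}. \<Sum>j\<in>JJ. phi n \<theta> (c j m) y) / (real M * real (card JJ))"
    have mh: "?h \<in> borel_measurable (Ln n)"
      by (intro borel_measurable_divide borel_measurable_sum borel_measurable_const measurable_phi measurable_Ln_component) auto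
    have "(\<integral>\<^sup>+x. ennreal (?G x) \<partial>Ln2 n) = (\<integral>\<^sup>+x. ennreal (?h (fst x) * phi n 1 (\<lambda>i. 0 * fst x i) (snd x)) \<partial>Ln2 n)"
      by (simp only: mult.commute)
    also have "\<dots> = (\<integral>\<^sup>+y. ennreal (?h y) \<partial>Ln n)"
      by (rule nn_integral_pair_phi'[where C="\<lambda>y i. 0 * y i", OF mh _ v]) (auto intro!: divide_nonneg_nonneg sum_nonneg)
    also have "\<dots> = 1"
      using nn_integral_phi_avg[of "{1..M} \<times> JJ" \<theta> n "\<lambda>p. c (snd p) (fst p)"] JJ(1) JJne M1 th
      by (simp add: sum.cartesian_product split_beta')
    finally show "(\<integral>\<^sup>+x. ennreal (?G x) \<partial>Ln2 n) \<le> 1" by simp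
  qed
  moreover have "EE T (J 0 1) X = EE T (J 0 1) (\<lambda>k x. ln (rr (fst k) (fst x))) + ((ln (real N) - ln (real (card JJ))) +
    (EE T (J 0 1) (\<lambda>k x. ln (phi n \<theta> (c (jj k) (snd k)) (fst x))) - EE T (J 0 1) (\<lambda>k x. ln (phi n 1 (s k) (fst x)))))"
    unfolding X_def
    by (simp add: EE_add[OF R(1) II_add[OF II_const_J[OF v] II_diff[OF I1 I2]]] EE_add[OF II_const_J[OF v] II_diff[OF I1 I2]] EE_diff[OF I1 I2])
  moreover have "- real n / 2 * (ln (2 * pi) + ln \<theta> + 1) \<le> EE T (J 0 1) (\<lambda>k x. ln (phi n \<theta> (c (jj k) (snd k)) (fst x)))"
    by (rule ln_phi_test[where \<alpha>=1 and \<beta>=0 and \<gamma>="\<lambda>k i. - c (jj k) (snd k) i", OF v th]) (use le in simp_all)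
  moreover have "EE T (J 0 1) (\<lambda>k x. ln (phi n 1 (s k) (fst x))) = - real n / 2 * (ln (2 * pi) + ln 1 + 1)"
    by (rule ln_phi_exact[where \<alpha>=1 and \<beta>=0 and \<gamma>="\<lambda>k i. - s k i", OF v v]) simp_all
  ultimately show ?thesis unfolding R(2) by (simp add: algebra_simps)
qed

end

lemma (in comm_monoid_add) sum_pairs:
  "sum F (A \<times> B) = (\<Sum>w\<in>A. \<Sum>m\<in>B. F (w, m))"
  by (simp add: sum.cartesian_product)

section \<open>Integrability of log-mixtures and the leakage to a degraded output\<close>

context block
begin

lemma II_ln_mix:
  assumes v: "v > 0" and g: "II T (J a v) (\<lambda>k x. ln (g k x))" and c: "c > 0"
    and F: "\<And>k. k \<in> T \<Longrightarrow> F k \<in> borel_measurable (Ln2 n)"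
    and b: "\<And>k x. k \<in> T \<Longrightarrow> 0 < g k x" "\<And>k x. k \<in> T \<Longrightarrow> c * g k x \<le> F k x" "\<And>k x. k \<in> T \<Longrightarrow> F k x \<le> B"
  shows "II T (J a v) (\<lambda>k x. ln (F k x))"
  unfolding II_def
proof
  fix k assume k: "k \<in> T"
  interpret prob_space "J a v k" by (rule prob_J[OF v])
  have "ln (c * g k x) = ln c + ln (g k x)" for x using c b(1)[OF k, of x] by (simp add: ln_mult)
  moreover have "integrable (J a v k) (\<lambda>x. ln c + ln (g k x))"
    using g k by (auto simp: II_def)
  ultimately have i: "integrable (J a v k) (\<lambda>x. ln (c * g k x))" by simp
  have m: "F k \<in> borel_measurable (J a v k)" using F[OF k] by simp
  show "integrable (J a v k) (\<lambda>x. ln (F k x))"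
    by (rule integrable_ln_between[OF prob_J[OF v] i m, where B=B]) (use b k c in auto)
qed

text \<open>The variant of \<open>gibbs_block\<close> for ratios of the second output alone, whose
  noise variance given the codeword is \<open>a\<^sup>2 + v\<close>.\<close>

lemma gibbs_snd:
  assumes v: "v > 0" and I: "II T (J a v) (\<lambda>k x. X k (snd x))"
    and mX: "\<And>k. k \<in> T \<Longrightarrow> X k \<in> borel_measurable (Ln n)"
    and [measurable]: "G \<in> borel_measurable (Ln n)"
    and le: "\<And>u. (\<Sum>k\<in>T. phi n (a\<^sup>2 + v) (\<lambda>i. a * s k i) u * exp (X k u)) \<le> real N * real M * G u"
    and int: "(\<integral>\<^sup>+x. ennreal (G x) \<partial>Ln n) \<le> 1"
  shows "EE T (J a v) (\<lambda>k x. X k (snd x)) \<le> 0"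
proof (rule gibbs)
  note [measurable] = mX measurable_phi_Ln[of "\<lambda>x. x" "Ln n" n "a\<^sup>2 + v", simplified]
  have "(\<Sum>k\<in>T. \<integral>\<^sup>+x. ennreal (exp (X k (snd x))) \<partial>J a v k) =
    (\<Sum>k\<in>T. \<integral>\<^sup>+u. ennreal (phi n (a\<^sup>2 + v) (\<lambda>i. a * s k i) u * exp (X k u)) \<partial>Ln n)"
    unfolding J_def
    by (intro sum.cong refl, subst nn_integral_jlaw_snd[OF v, where h="\<lambda>u. ennreal (exp (X k u))" for k]) (auto simp: ennreal_mult)
  also have "\<dots> = (\<integral>\<^sup>+u. (\<Sum>k\<in>T. ennreal (phi n (a\<^sup>2 + v) (\<lambda>i. a * s k i) u * exp (X k u))) \<partial>Ln n)"
    by (subst nn_integral_sum) auto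
  also have "\<dots> \<le> (\<integral>\<^sup>+u. ennreal (real N * real M) * ennreal (G u) \<partial>Ln n)"
  proof (rule nn_integral_mono)
    fix u
    show "(\<Sum>k\<in>T. ennreal (phi n (a\<^sup>2 + v) (\<lambda>i. a * s k i) u * exp (X k u))) \<le> ennreal (real N * real M) * ennreal (G u)"
      using le[of u] by (subst sum_ennreal, simp) (auto simp: ennreal_mult'[symmetric] intro!: ennreal_leI)
  qed
  also have "\<dots> = ennreal (real N * real M) * (\<integral>\<^sup>+u. ennreal (G u) \<partial>Ln n)"
    by (subst nn_integral_cmult) auto
  also have "\<dots> \<le> ennreal (real N * real M) * 1" by (intro mult_left_mono int) auto
  finally show "(\<Sum>k\<in>T. \<integral>\<^sup>+x. ennreal (exp (X k (snd x))) \<partial>J a v k) \<le> ennreal (real (card T))" by simp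
qed (use I v prob_J in auto)

text \<open>The output density given the message alone: here the fictitious message is averaged out
  instead of conditioned on.\<close>

definition pzw :: "real \<Rightarrow> real \<Rightarrow> nat \<Rightarrow> (nat \<Rightarrow> real) \<Rightarrow> real" where
  "pzw a v w u = (\<Sum>m\<in>{1..M}. phi n (a\<^sup>2 + v) (\<lambda>i. a * s (w, m) i) u) / real M"

definition pz :: "real \<Rightarrow> real \<Rightarrow> (nat \<Rightarrow> real) \<Rightarrow> real" where
  "pz a v u = (\<Sum>k\<in>T. phi n (a\<^sup>2 + v) (\<lambda>i. a * s k i) u) / (real N * real M)"

definition leak :: "real \<Rightarrow> real \<Rightarrow> real" where
  "leak a v = EE T (J a v) (\<lambda>k x. ln (pzw a v (fst k) (snd x) / pz a v (snd x)))"

lemma measurable_pzw [measurable]: "pzw a v w \<in> borel_measurable (Ln n)"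
  unfolding pzw_def
  by (intro borel_measurable_divide borel_measurable_sum borel_measurable_const measurable_phi measurable_Ln_component) auto

lemma measurable_pz [measurable]: "pz a v \<in> borel_measurable (Ln n)"
  unfolding pz_def
  by (intro borel_measurable_divide borel_measurable_sum borel_measurable_const measurable_phi measurable_Ln_component) auto

lemma tau_pos: "v > 0 \<Longrightarrow> (a::real)\<^sup>2 + v > 0" by (simp add: add_nonneg_pos)

lemma pzw_pos: "v > 0 \<Longrightarrow> pzw a v w u > 0"
  unfolding pzw_def using card_T_pos M1 by (intro divide_pos_pos sum_pos phi_pos tau_pos) auto

lemma pz_pos: "v > 0 \<Longrightarrow> pz a v u > 0"
  unfolding pz_def using card_T_pos by (intro divide_pos_pos sum_pos phi_pos tau_pos) auto

lemma II_ln_phi_out: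
  assumes v: "v > 0"
  shows "II T (J a v) (\<lambda>k x. ln (phi n (a\<^sup>2 + v) (\<lambda>i. a * s k i) (snd x)))"
  by (rule ln_phi_J(1)[where \<alpha>=0 and \<beta>=1 and \<gamma>="\<lambda>k i. - a * s k i", OF v tau_pos[OF v]]) simp

lemma II_ln_pzw_pz:
  assumes v: "v > 0"
  shows "II T (J a v) (\<lambda>k x. ln (pzw a v (fst k) (snd x)))" "II T (J a v) (\<lambda>k x. ln (pz a v (snd x)))"
proof -
  let ?B = "exp (- real n / 2 * ln (2 * pi * (a\<^sup>2 + v)))"
  note P = phi_pos[OF tau_pos[OF v]]
  show "II T (J a v) (\<lambda>k x. ln (pzw a v (fst k) (snd x)))"
  proof (rule II_ln_mix[OF v II_ln_phi_out[OF v], where c="1 / real M" and B="?B"])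
    fix k x assume "k \<in> T"
    then have k: "k = (fst k, snd k)" "snd k \<in> {1..M}" by (auto simp: T_def)
    have "phi n (a\<^sup>2 + v) (\<lambda>i. a * s (fst k, snd k) i) (snd x) \<le> (\<Sum>m\<in>{1..M}. phi n (a\<^sup>2 + v) (\<lambda>i. a * s (fst k, m) i) (snd x))"
      using k by (intro member_le_sum[where f="\<lambda>m. phi n (a\<^sup>2 + v) (\<lambda>i. a * s (fst k, m) i) (snd x)"]) auto
    then show "1 / real M * phi n (a\<^sup>2 + v) (\<lambda>i. a * s k i) (snd x) \<le> pzw a v (fst k) (snd x)"
      using card_T_pos k(1) by (simp add: pzw_def divide_right_mono)
    have "(\<Sum>m\<in>{1..M}. phi n (a\<^sup>2 + v) (\<lambda>i. a * s (fst k, m) i) (snd x)) \<le> real (card {1..M}) * ?B"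
      by (intro phi_sum_le tau_pos v) auto
    then show "pzw a v (fst k) (snd x) \<le> ?B"
      using card_T_pos by (simp add: pzw_def field_simps)
  qed (use card_T_pos P in auto)
  show "II T (J a v) (\<lambda>k x. ln (pz a v (snd x)))"
  proof (rule II_ln_mix[OF v II_ln_phi_out[OF v], where c="1 / (real N * real M)" and B="?B"])
    fix k x assume k: "k \<in> T"
    have "phi n (a\<^sup>2 + v) (\<lambda>i. a * s k i) (snd x) \<le> (\<Sum>k\<in>T. phi n (a\<^sup>2 + v) (\<lambda>i. a * s k i) (snd x))"
      using k by (intro member_le_sum[where f="\<lambda>k. phi n (a\<^sup>2 + v) (\<lambda>i. a * s k i) (snd x)"]) auto
    then show "1 / (real N * real M) * phi n (a\<^sup>2 + v) (\<lambda>i. a * s k i) (snd x) \<le> pz a v (snd x)"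
      using card_T_pos by (simp add: pz_def divide_right_mono)
    have "(\<Sum>k\<in>T. phi n (a\<^sup>2 + v) (\<lambda>i. a * s k i) (snd x)) \<le> real (card T) * ?B"
      by (intro phi_sum_le tau_pos v) auto
    then show "pz a v (snd x) \<le> ?B"
      using card_T_pos by (simp add: pz_def field_simps)
  qed (use card_T_pos P in auto)
qed

text \<open>Bounds I(W; Y | U) by h(Y | U) - h(Y | U, W, M). The first entropy is estimated through
  the linear predictor \<open>b * U\<close> with error \<open>\<theta>\<close>; the second is exact,
  since given the codeword the posterior of Y is Gaussian with variance
  \<open>v / (a\<^sup>2 + v)\<close>.\<close>

lemma secrecy_bound:
  assumes v: "v > 0" and th: "\<theta> > 0"
    and le: "avg (\<lambda>k i. ((1 - b * a) * s k i)\<^sup>2) + real n * ((1 - b * a)\<^sup>2 + b\<^sup>2 * v) \<le> real n * \<theta>"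
  shows "(1 - Pe) * ln (real N) - ln 2 - leak a v \<le> real n / 2 * (ln \<theta> - ln (v / (a\<^sup>2 + v)))"
proof -
  let ?ka = "v / (a\<^sup>2 + v)"
  note tau = tau_pos[OF v, of a]
  have ka: "?ka > 0" using v tau by simp
  note R = ln_rr[OF v, of a]
  note I3 = II_ln_pzw_pz[OF v, of a]
  have I1: "II T (J a v) (\<lambda>k x. ln (phi n \<theta> (\<lambda>i. b * snd x i) (fst x)))"
    by (rule ln_phi_J(1)[where \<alpha>=1 and \<beta>="-b" and \<gamma>="\<lambda>k i. 0", OF v th]) simp
  have I2: "II T (J a v) (\<lambda>k x. ln (phi n ?ka (postmean a v (s k) (snd x)) (fst x)))"
    by (rule ln_phi_J(1)[where \<alpha>=1 and \<beta>="- a / (a\<^sup>2 + v)" and \<gamma>="\<lambda>k i. - s k i + a\<^sup>2 / (a\<^sup>2 + v) * s k i", OF v ka])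
       (simp add: postmean_def algebra_simps power2_eq_square)
  have lnq: "ln (pzw a v (fst k) (snd x) / pz a v (snd x)) = ln (pzw a v (fst k) (snd x)) - ln (pz a v (snd x))" for k x
    using pzw_pos[OF v, of a "fst k" "snd x"] pz_pos[OF v, of a "snd x"] by (simp add: ln_div)
  define X where "X k x = ln (rr (fst k) (fst x)) + (ln (real N) + (ln (phi n \<theta> (\<lambda>i. b * snd x i) (fst x)) -
     ((ln (pzw a v (fst k) (snd x)) - ln (pz a v (snd x))) + ln (phi n ?ka (postmean a v (s k) (snd x)) (fst x)))))"
    for k :: "nat \<times> nat" and x :: "(nat \<Rightarrow> real) \<times> (nat \<Rightarrow> real)"
  have II: "II T (J a v) X"
    unfolding X_def by (intro II_add II_diff R(1) I1 I2 I3 II_const_J v)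
  have "EE T (J a v) X \<le> 0"
  proof (rule gibbs_block[OF v II])
    let ?G = "\<lambda>x. pz a v (snd x) * phi n \<theta> (\<lambda>i. b * snd x i) (fst x)"
    show "?G \<in> borel_measurable (Ln2 n)" by measurable
    show "(\<Sum>k\<in>T. phi n 1 (s k) y * phi n v (\<lambda>i. a * y i) u * exp (X k (y, u))) \<le> real N * real M * ?G (y, u)" for y u
    proof -
      have "phi n 1 (s k) y * phi n v (\<lambda>i. a * y i) u * exp (X k (y, u)) =
         real N * (?G (y, u) * (rr (fst k) y * (phi n (a\<^sup>2 + v) (\<lambda>i. a * s k i) u / pzw a v (fst k) u)))" for k
        unfolding phi_swap[OF v]
        using phi_pos[OF th] phi_pos[OF ka] rr_pos pzw_pos[OF v] pz_pos[OF v] card_T_pos ka th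
        by (simp add: X_def exp_add exp_diff phi_neq_0 del: phi_swap)
      then have E: "(\<Sum>k\<in>T. phi n 1 (s k) y * phi n v (\<lambda>i. a * y i) u * exp (X k (y, u))) =
         real N * (?G (y, u) * (\<Sum>k\<in>T. rr (fst k) y * (phi n (a\<^sup>2 + v) (\<lambda>i. a * s k i) u / pzw a v (fst k) u)))"
        by (simp only: sum_distrib_left)
      \<comment> \<open>Dividing by \<open>pzw\<close> turns the output densities into the posterior
        of \<open>m\<close> given \<open>w\<close> and \<open>u\<close>, up to the factor
        \<open>M\<close>; hence the sum over \<open>m\<close> is \<open>M\<close> and only the
        guesses remain.\<close>
      have "(\<Sum>k\<in>T. rr (fst k) y * (phi n (a\<^sup>2 + v) (\<lambda>i. a * s k i) u / pzw a v (fst k) u)) =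
         (\<Sum>w\<in>{1..N}. rr w y * ((\<Sum>m\<in>{1..M}. phi n (a\<^sup>2 + v) (\<lambda>i. a * s (w, m) i) u) / pzw a v w u))"
        unfolding T_def sum_pairs by (simp add: sum_distrib_left sum_divide_distrib)
      also have "\<dots> = (\<Sum>w\<in>{1..N}. rr w y * real M)"
      proof (intro sum.cong refl)
        fix w
        have "pzw a v w u * real M = (\<Sum>m\<in>{1..M}. phi n (a\<^sup>2 + v) (\<lambda>i. a * s (w, m) i) u)"
          using card_T_pos by (simp add: pzw_def)
        then show "rr w y * ((\<Sum>m\<in>{1..M}. phi n (a\<^sup>2 + v) (\<lambda>i. a * s (w, m) i) u) / pzw a v w u) = rr w y * real M"
          using pzw_pos[OF v, of a w u] by (simp add: field_simps)
      qed
      also have "\<dots> \<le> real M"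
        using rr_sum[of "{1..N}" y] mult_right_mono[of "\<Sum>w\<in>{1..N}. rr w y" 1 "real M"] by (simp add: sum_distrib_right)
      finally have "(\<Sum>k\<in>T. rr (fst k) y * (phi n (a\<^sup>2 + v) (\<lambda>i. a * s k i) u / pzw a v (fst k) u)) \<le> real M" .
      moreover have "?G (y, u) \<ge> 0" using pz_pos[OF v, of a u] by simp
      ultimately have "real N * (?G (y, u) * (\<Sum>k\<in>T. rr (fst k) y * (phi n (a\<^sup>2 + v) (\<lambda>i. a * s k i) u / pzw a v (fst k) u)))
          \<le> real N * (?G (y, u) * real M)"
        by (intro mult_left_mono) auto
      then show ?thesis unfolding E by (simp only: mult_ac)
    qed
    have m: "i \<in> {1..n} \<Longrightarrow> (\<lambda>u. b * u i) \<in> borel_measurable (Ln n)" for i by measurable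
    have "(\<integral>\<^sup>+x. ennreal (?G x) \<partial>Ln2 n) = (\<integral>\<^sup>+u. ennreal (pz a v u) \<partial>Ln n)"
      by (rule nn_integral_pair_phi[where C="\<lambda>u i. b * u i", OF measurable_pz _ th m]) (auto intro: less_imp_le pz_pos v)
    also have "\<dots> = 1"
      using nn_integral_phi_avg[of T "a\<^sup>2 + v" n "\<lambda>k i. a * s k i"] tau by (simp add: pz_def)
    finally show "(\<integral>\<^sup>+x. ennreal (?G x) \<partial>Ln2 n) \<le> 1" by simp
  qed
  moreover have "EE T (J a v) X = EE T (J a v) (\<lambda>k x. ln (rr (fst k) (fst x))) + (ln (real N) +
     (EE T (J a v) (\<lambda>k x. ln (phi n \<theta> (\<lambda>i. b * snd x i) (fst x))) -
       (EE T (J a v) (\<lambda>k x. ln (pzw a v (fst k) (snd x)) - ln (pz a v (snd x))) +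
        EE T (J a v) (\<lambda>k x. ln (phi n ?ka (postmean a v (s k) (snd x)) (fst x))))))"
    unfolding X_def
    by (subst EE_add, (intro II_add II_diff R(1) I1 I2 I3 II_const_J v)+)+
       (subst EE_diff[OF I1 II_add[OF II_diff[OF I3] I2]], subst EE_add[OF II_diff[OF I3] I2], simp add: v)
  moreover have "leak a v = EE T (J a v) (\<lambda>k x. ln (pzw a v (fst k) (snd x)) - ln (pz a v (snd x)))"
    unfolding leak_def lnq ..
  moreover have "- real n / 2 * (ln (2 * pi) + ln \<theta> + 1) \<le> EE T (J a v) (\<lambda>k x. ln (phi n \<theta> (\<lambda>i. b * snd x i) (fst x)))"
    by (rule ln_phi_test[where \<alpha>=1 and \<beta>="-b" and \<gamma>="\<lambda>k i. 0", OF v th]) (use le in simp_all)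
  moreover have "EE T (J a v) (\<lambda>k x. ln (phi n ?ka (postmean a v (s k) (snd x)) (fst x))) = - real n / 2 * (ln (2 * pi) + ln ?ka + 1)"
  proof (rule ln_phi_exact[where \<alpha>=1 and \<beta>="- a / (a\<^sup>2 + v)" and \<gamma>="\<lambda>k i. - s k i + a\<^sup>2 / (a\<^sup>2 + v) * s k i", OF v ka])
    have "1 + - a / (a\<^sup>2 + v) * a = ?ka" using tau by (simp add: field_simps power2_eq_square)
    moreover have "(- a / (a\<^sup>2 + v))\<^sup>2 * v = ?ka - ?ka\<^sup>2"
    proof -
      have "a\<^sup>2 = (a\<^sup>2 + v) - v" by simp
      then have "(- a / (a\<^sup>2 + v))\<^sup>2 * v = ((a\<^sup>2 + v) - v) * v / (a\<^sup>2 + v)\<^sup>2" by (simp add: power_divide)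
      also have "\<dots> = ?ka - ?ka\<^sup>2"
      proof -
        have "(t - v) * v / t\<^sup>2 = v / t - (v / t)\<^sup>2" if "t > 0" for t
          using that by (simp add: field_simps power2_eq_square)
        from this[OF tau] show ?thesis .
      qed
      finally show ?thesis .
    qed
    ultimately show "(1 + - a / (a\<^sup>2 + v) * a)\<^sup>2 + (- a / (a\<^sup>2 + v))\<^sup>2 * v = ?ka" by simp
    show "(1 + - a / (a\<^sup>2 + v) * a) * s k i + (- s k i + a\<^sup>2 / (a\<^sup>2 + v) * s k i) = 0" for k i
      by (simp add: algebra_simps power2_eq_square)
  qed (simp add: postmean_def algebra_simps power2_eq_square)
  ultimately show ?thesis unfolding R(2) by (simp add: algebra_simps)
qed

end

section \<open>Entropies of the link indices together with a noisier output\<close>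

context block
begin

definition fU :: "real \<Rightarrow> real \<Rightarrow> nat \<Rightarrow> (nat \<Rightarrow> real) \<Rightarrow> real" where
  "fU a v m u = (\<Sum>w\<in>{1..N}. phi n (a\<^sup>2 + v) (\<lambda>i. a * s (w, m) i) u) / real N"

text \<open>Given \<open>m\<close>, the joint law of the index value \<open>j\<close> and the second
  output. Left unnormalised, so that summing over \<open>j\<close> gives \<open>fU\<close> and no
  probability of \<open>j\<close> has to be divided out.\<close>

definition fj :: "real \<Rightarrow> real \<Rightarrow> (nat \<times> nat \<Rightarrow> 'j) \<Rightarrow> nat \<Rightarrow> 'j \<Rightarrow> (nat \<Rightarrow> real) \<Rightarrow> real" where
  "fj a v jf m j u = (\<Sum>w\<in>{w\<in>{1..N}. jf (w, m) = j}. phi n (a\<^sup>2 + v) (\<lambda>i. a * s (w, m) i) u) / real N"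

lemma measurable_fU [measurable]: "fU a v m \<in> borel_measurable (Ln n)"
  unfolding fU_def
  by (intro borel_measurable_divide borel_measurable_sum borel_measurable_const measurable_phi measurable_Ln_component) auto

lemma measurable_fj [measurable]: "fj a v jf m j \<in> borel_measurable (Ln n)"
  unfolding fj_def
  by (intro borel_measurable_divide borel_measurable_sum borel_measurable_const measurable_phi measurable_Ln_component) auto

lemma fU_pos: "v > 0 \<Longrightarrow> fU a v m u > 0"
  unfolding fU_def using card_T_pos N1 by (intro divide_pos_pos sum_pos phi_pos tau_pos) auto

lemma fj_nonneg: "fj a v jf m j u \<ge> 0"
  unfolding fj_def by (intro divide_nonneg_nonneg sum_nonneg) auto

lemma fj_ge:
  assumes "k \<in> T"
  shows "1 / real N * phi n (a\<^sup>2 + v) (\<lambda>i. a * s k i) u \<le> fj a v jf (snd k) (jf k) u"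
proof -
  have k: "k = (fst k, snd k)" "fst k \<in> {1..N}" using assms by (auto simp: T_def)
  have "phi n (a\<^sup>2 + v) (\<lambda>i. a * s (fst k, snd k) i) u \<le>
     (\<Sum>w\<in>{w\<in>{1..N}. jf (w, snd k) = jf k}. phi n (a\<^sup>2 + v) (\<lambda>i. a * s (w, snd k) i) u)"
    using k by (intro member_le_sum[where f="\<lambda>w. phi n (a\<^sup>2 + v) (\<lambda>i. a * s (w, snd k) i) u"]) auto
  then show ?thesis using card_T_pos k(1) by (simp add: fj_def divide_right_mono)
qed

lemma fj_pos: "v > 0 \<Longrightarrow> k \<in> T \<Longrightarrow> fj a v jf (snd k) (jf k) u > 0"
  by (rule less_le_trans[OF _ fj_ge]) (use card_T_pos in \<open>auto intro!: divide_pos_pos phi_pos tau_pos\<close>)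

lemma sum_fj:
  assumes "finite JJ" "\<And>k. k \<in> T \<Longrightarrow> jf k \<in> JJ" "m \<in> {1..M}"
  shows "(\<Sum>j\<in>JJ. fj a v jf m j u) = fU a v m u"
proof -
  have "(\<lambda>w. jf (w, m)) ` {1..N} \<subseteq> JJ" using assms by (auto simp: T_def)
  from sum.group[OF _ assms(1) this, of "\<lambda>w. phi n (a\<^sup>2 + v) (\<lambda>i. a * s (w, m) i) u"]
  show ?thesis unfolding fj_def fU_def sum_divide_distrib[symmetric] by simp
qed

lemma fU_conv_fj: "fU a v m u = fj a v (\<lambda>_. ()) m () u"
  unfolding fU_def fj_def by (intro arg_cong2[where f="(/)"] sum.cong) auto

lemma fj_le:
  assumes v: "v > 0"
  shows "fj a v jf m j u \<le> exp (- real n / 2 * ln (2 * pi * (a\<^sup>2 + v)))" (is "_ \<le> ?B")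
proof -
  let ?A = "{w\<in>{1..N}. jf (w, m) = j}"
  have "(\<Sum>w\<in>?A. phi n (a\<^sup>2 + v) (\<lambda>i. a * s (w, m) i) u) \<le> real (card ?A) * ?B"
    by (intro phi_sum_le tau_pos v) auto
  also have "\<dots> \<le> real N * ?B"
  proof (intro mult_right_mono)
    have "?A \<subseteq> {1..N}" by auto
    from card_mono[OF finite_atLeastAtMost this] show "real (card ?A) \<le> real N" by simp
  qed simp
  finally show ?thesis using card_T_pos by (simp add: fj_def field_simps)
qed

lemma II_ln_fj:
  assumes v: "v > 0"
  shows "II T (J a v) (\<lambda>k x. ln (fj a v jf (snd k) (jf k) (snd x)))"
proof (rule II_ln_mix[OF v II_ln_phi_out[OF v], where c="1 / real N"])
  show "fj a v jf (snd k) (jf k) (snd x) \<le> exp (- real n / 2 * ln (2 * pi * (a\<^sup>2 + v)))" for k and x :: "(nat \<Rightarrow> real) \<times> (nat \<Rightarrow> real)"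
    by (rule fj_le[OF v])
qed (use card_T_pos fj_ge phi_pos[OF tau_pos[OF v]] in auto)

lemma II_ln_fU: "v > 0 \<Longrightarrow> II T (J a v) (\<lambda>k x. ln (fU a v (snd k) (snd x)))"
  unfolding fU_conv_fj using II_ln_fj[of v a "\<lambda>_. ()"] by simp

lemma int_avg_fU:
  assumes v: "v > 0"
  shows "(\<integral>\<^sup>+u. ennreal ((\<Sum>m\<in>{1..M}. fU a v m u) / real M) \<partial>Ln n) = 1"
proof -
  have "(\<Sum>m\<in>{1..M}. fU a v m u) / real M = (\<Sum>p\<in>{1..M} \<times> {1..N}. phi n (a\<^sup>2 + v) (\<lambda>i. a * s (snd p, fst p) i) u) / real (card ({1..M} \<times> {1..N}))" for u
    unfolding fU_def by (simp add: sum_divide_distrib sum_pairs mult.commute)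
  then show ?thesis
    using nn_integral_phi_avg[of "{1..M} \<times> {1..N}" "a\<^sup>2 + v" n "\<lambda>p i. a * s (snd p, fst p) i"] tau_pos[OF v] N1 M1
    by simp
qed

text \<open>In entropies: h(U, J | M) is at most ln |JJ| plus the Gaussian entropy of variance
  \<open>\<theta>\<close>, which bounds the error of predicting U from the index and
  \<open>m\<close>. The test law is uniform on \<open>JJ\<close> times a Gaussian around the
  prediction.\<close>

lemma marginal_bound:
  fixes jf :: "nat \<times> nat \<Rightarrow> 'j" and c :: "'j \<Rightarrow> nat \<Rightarrow> nat \<Rightarrow> real"
  assumes v: "v > 0" and th: "\<theta> > 0" and JJ: "finite JJ" "\<And>k. k \<in> T \<Longrightarrow> jf k \<in> JJ"
    and le: "avg (\<lambda>k i. (a * s k i - c (jf k) (snd k) i)\<^sup>2) + real n * (a\<^sup>2 + v) \<le> real n * \<theta>"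
  shows "- real n / 2 * (ln (2 * pi) + ln \<theta> + 1) - ln (real (card JJ)) \<le>
    EE T (J a v) (\<lambda>k x. ln (fj a v jf (snd k) (jf k) (snd x)))"
proof -
  have JJne: "JJ \<noteq> {}" using JJ(2) T_props(2) by blast
  have cJ: "real (card JJ) > 0" using JJ(1) JJne by (simp add: card_gt_0_iff)
  have I1: "II T (J a v) (\<lambda>k x. ln (phi n \<theta> (c (jf k) (snd k)) (snd x)))"
    by (rule ln_phi_J(1)[where \<alpha>=0 and \<beta>=1 and \<gamma>="\<lambda>k i. - c (jf k) (snd k) i", OF v th]) simp
  note I2 = II_ln_fj[OF v, of a jf]
  define X where "X k u = ln (phi n \<theta> (c (jf k) (snd k)) u) - (ln (real (card JJ)) + ln (fj a v jf (snd k) (jf k) u))"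
    for k u
  have II: "II T (J a v) (\<lambda>k x. X k (snd x))"
    unfolding X_def by (intro II_add II_diff I1 I2 II_const_J v)
  have mphi: "phi n \<theta> c' \<in> borel_measurable (Ln n)" for c'
    by (intro measurable_phi measurable_Ln_component borel_measurable_const)
  have "EE T (J a v) (\<lambda>k x. X k (snd x)) \<le> 0"
  proof (rule gibbs_snd[OF v II])
    let ?G = "\<lambda>u. (\<Sum>p\<in>{1..M} \<times> JJ. phi n \<theta> (c (snd p) (fst p)) u) / real (card ({1..M} \<times> JJ))"
    show "X k \<in> borel_measurable (Ln n)" for k
      using mphi unfolding X_def by measurable
    show "?G \<in> borel_measurable (Ln n)" using mphi by measurable
    show "(\<Sum>k\<in>T. phi n (a\<^sup>2 + v) (\<lambda>i. a * s k i) u * exp (X k u)) \<le> real N * real M * ?G u" for u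
    proof -
      let ?p = "\<lambda>k. phi n (a\<^sup>2 + v) (\<lambda>i. a * s k i) u"
      have "?p k * exp (X k u) = phi n \<theta> (c (jf k) (snd k)) u / (real (card JJ) * fj a v jf (snd k) (jf k) u) * ?p k" if "k \<in> T" for k
        using phi_pos[OF th, of n "c (jf k) (snd k)" u] fj_pos[OF v that, of a jf u] cJ
        by (simp add: X_def exp_add exp_diff)
      then have "(\<Sum>k\<in>T. ?p k * exp (X k u)) =
          (\<Sum>k\<in>T. phi n \<theta> (c (jf k) (snd k)) u / (real (card JJ) * fj a v jf (snd k) (jf k) u) * ?p k)"
        by (rule sum.cong[OF refl])
      also have "\<dots> = (\<Sum>m\<in>{1..M}. \<Sum>w\<in>{1..N}.
          phi n \<theta> (c (jf (w, m)) m) u / (real (card JJ) * fj a v jf m (jf (w, m)) u) * ?p (w, m))"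
        unfolding sum_T by simp
      also have "\<dots> \<le> (\<Sum>m\<in>{1..M}. \<Sum>j\<in>JJ. real N / real (card JJ) * phi n \<theta> (c j m) u)"
      proof (rule sum_mono)
        fix m assume m: "m \<in> {1..M}"
        have sub: "(\<lambda>w. jf (w, m)) ` {1..N} \<subseteq> JJ" using JJ m by (auto simp: T_def)
        have "(\<Sum>w\<in>{1..N}. phi n \<theta> (c (jf (w, m)) m) u / (real (card JJ) * fj a v jf m (jf (w, m)) u) * ?p (w, m)) =
          (\<Sum>j\<in>JJ. \<Sum>w\<in>{w\<in>{1..N}. jf (w, m) = j}. phi n \<theta> (c (jf (w, m)) m) u / (real (card JJ) * fj a v jf m (jf (w, m)) u) * ?p (w, m))"
          by (rule sum.group[OF _ JJ(1) sub, symmetric]) simp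
        also have "\<dots> = (\<Sum>j\<in>JJ. phi n \<theta> (c j m) u / (real (card JJ) * fj a v jf m j u) * (real N * fj a v jf m j u))"
        proof (intro sum.cong refl)
          fix j
          let ?C = "phi n \<theta> (c j m) u / (real (card JJ) * fj a v jf m j u)"
          have "(\<Sum>w\<in>{w\<in>{1..N}. jf (w, m) = j}. phi n \<theta> (c (jf (w, m)) m) u / (real (card JJ) * fj a v jf m (jf (w, m)) u) * ?p (w, m)) =
             (\<Sum>w\<in>{w\<in>{1..N}. jf (w, m) = j}. ?C * ?p (w, m))"
            by (rule sum.cong) auto
          also have "\<dots> = ?C * (\<Sum>w\<in>{w\<in>{1..N}. jf (w, m) = j}. ?p (w, m))" by (simp only: sum_distrib_left)
          also have "(\<Sum>w\<in>{w\<in>{1..N}. jf (w, m) = j}. ?p (w, m)) = real N * fj a v jf m j u"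
            using card_T_pos by (simp add: fj_def)
          finally show "(\<Sum>w\<in>{w\<in>{1..N}. jf (w, m) = j}. phi n \<theta> (c (jf (w, m)) m) u / (real (card JJ) * fj a v jf m (jf (w, m)) u) * ?p (w, m)) =
             ?C * (real N * fj a v jf m j u)" .
        qed
        also have "\<dots> \<le> (\<Sum>j\<in>JJ. real N / real (card JJ) * phi n \<theta> (c j m) u)"
        proof (rule sum_mono)
          fix j
          show "phi n \<theta> (c j m) u / (real (card JJ) * fj a v jf m j u) * (real N * fj a v jf m j u) \<le> real N / real (card JJ) * phi n \<theta> (c j m) u"
            \<comment> \<open>An index value taken by no message has \<open>fj = 0\<close>; division
              by zero then makes the left side 0.\<close>
            using cJ by (cases "fj a v jf m j u = 0") (auto simp: field_simps)
        qed
        finally show "(\<Sum>w\<in>{1..N}. phi n \<theta> (c (jf (w, m)) m) u / (real (card JJ) * fj a v jf m (jf (w, m)) u) * ?p (w, m)) \<le>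
           (\<Sum>j\<in>JJ. real N / real (card JJ) * phi n \<theta> (c j m) u)" .
      qed
      also have "\<dots> = real N * real M * ?G u"
      proof -
        have "(\<Sum>m\<in>{1..M}. \<Sum>j\<in>JJ. real N / real (card JJ) * phi n \<theta> (c j m) u) =
           real N / real (card JJ) * (\<Sum>m\<in>{1..M}. \<Sum>j\<in>JJ. phi n \<theta> (c j m) u)"
          by (simp only: sum_distrib_left)
        then show ?thesis
          unfolding sum_pairs card_cartesian_product using card_T_pos cJ by simp
      qed
      finally show ?thesis .
    qed
    show "(\<integral>\<^sup>+u. ennreal (?G u) \<partial>Ln n) \<le> 1"
      using nn_integral_phi_avg[of "{1..M} \<times> JJ" \<theta> n "\<lambda>p. c (snd p) (fst p)"] JJ(1) JJne M1 th by simp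
  qed
  moreover have "EE T (J a v) (\<lambda>k x. X k (snd x)) = EE T (J a v) (\<lambda>k x. ln (phi n \<theta> (c (jf k) (snd k)) (snd x))) -
     (ln (real (card JJ)) + EE T (J a v) (\<lambda>k x. ln (fj a v jf (snd k) (jf k) (snd x))))"
    unfolding X_def by (subst EE_diff[OF I1 II_add[OF II_const_J[OF v] I2]], subst EE_add[OF II_const_J[OF v] I2]) (simp add: v)
  moreover have "- real n / 2 * (ln (2 * pi) + ln \<theta> + 1) \<le> EE T (J a v) (\<lambda>k x. ln (phi n \<theta> (c (jf k) (snd k)) (snd x)))"
    by (rule ln_phi_test[where \<alpha>=0 and \<beta>=1 and \<gamma>="\<lambda>k i. - c (jf k) (snd k) i", OF v th]) (use le in simp_all)
  ultimately show ?thesis by simp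
qed

lemma EE_ln_phi_out:
  assumes v: "v > 0"
  shows "EE T (J a v) (\<lambda>k x. ln (phi n (a\<^sup>2 + v) (\<lambda>i. a * s k i) (snd x))) = - real n / 2 * (ln (2 * pi) + ln (a\<^sup>2 + v) + 1)"
  by (rule ln_phi_exact[where \<alpha>=0 and \<beta>=1 and \<gamma>="\<lambda>k i. - a * s k i", OF v tau_pos[OF v]]) simp_all

text \<open>Given the channel output, the entropies of the two link indices bound that of the pair.\<close>

lemma pair_bound:
  assumes v: "v > 0" and J1: "finite J1" "\<And>k. k \<in> T \<Longrightarrow> j1 k \<in> J1" and J2: "finite J2" "\<And>k. k \<in> T \<Longrightarrow> j2 k \<in> J2"
    and sg: "\<And>k. k \<in> T \<Longrightarrow> s k = sg (j1 k) (j2 k) (snd k)"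
  shows "(1 - Pe) * ln (real N) - ln 2 + EE T (J a v) (\<lambda>k x. ln (fj a v j1 (snd k) (j1 k) (snd x)))
      + EE T (J a v) (\<lambda>k x. ln (fj a v j2 (snd k) (j2 k) (snd x)))
      + real n / 2 * (ln (2 * pi) + ln (a\<^sup>2 + v) + 1)
    \<le> EE T (J a v) (\<lambda>k x. ln (fU a v (snd k) (snd x)))"
proof -
  let ?ka = "v / (a\<^sup>2 + v)"
  note tau = tau_pos[OF v, of a]
  have ka: "?ka > 0" using v tau by simp
  note R = ln_rr[OF v, of a]
  note I1 = II_ln_fj[OF v, of a j1] and I2 = II_ln_fj[OF v, of a j2] and I3 = II_ln_fU[OF v, of a] and I4 = II_ln_phi_out[OF v, of a]
  define X where "X k x = ln (rr (fst k) (fst x)) + (ln (real N) + ((ln (fj a v j1 (snd k) (j1 k) (snd x)) + ln (fj a v j2 (snd k) (j2 k) (snd x)))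
     - (ln (fU a v (snd k) (snd x)) + ln (phi n (a\<^sup>2 + v) (\<lambda>i. a * s k i) (snd x)))))"
    for k :: "nat \<times> nat" and x :: "(nat \<Rightarrow> real) \<times> (nat \<Rightarrow> real)"
  have II: "II T (J a v) X"
    unfolding X_def by (intro II_add II_diff R(1) I1 I2 I3 I4 II_const_J v)
  let ?H = "\<lambda>m u. \<lambda>p. fj a v j1 m (fst p) u * fj a v j2 m (snd p) u / fU a v m u"
  let ?P = "\<lambda>m u. \<lambda>p. phi n ?ka (postmean a v (sg (fst p) (snd p) m) u)"
  have "EE T (J a v) X \<le> 0"
  proof (rule gibbs_block[OF v II])
    \<comment> \<open>The test law: given \<open>m\<close> and the noisier output, the two indices
      are independent with their true conditional laws, and Y follows its posterior for the codeword
      they determine.\<close>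
    let ?G = "\<lambda>x. (\<Sum>q\<in>{1..M} \<times> (J1 \<times> J2). ?H (fst q) (snd x) (snd q) / real M * ?P (fst q) (snd x) (snd q) (fst x))"
    have mP: "(\<lambda>x. ?P m (snd x) p (fst x)) \<in> borel_measurable (Ln2 n)" for m p by measurable
    then show "?G \<in> borel_measurable (Ln2 n)" by measurable
    show "(\<Sum>k\<in>T. phi n 1 (s k) y * phi n v (\<lambda>i. a * y i) u * exp (X k (y, u))) \<le> real N * real M * ?G (y, u)" for y u
    proof -
      let ?j = "\<lambda>k. (j1 k, j2 k)"
      have "phi n 1 (s k) y * phi n v (\<lambda>i. a * y i) u * exp (X k (y, u)) =
         real N * (rr (fst k) y * (?H (snd k) u (?j k) * ?P (snd k) u (?j k) y))" if k: "k \<in> T" for k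
        unfolding phi_swap[OF v]
        using phi_pos[OF ka] rr_pos fj_pos[OF v k, of a j1 u] fj_pos[OF v k, of a j2 u] fU_pos[OF v, of a "snd k" u] card_T_pos ka tau
        by (simp add: X_def exp_add exp_diff phi_neq_0 phi_pos sg[OF k])
      then have "(\<Sum>k\<in>T. phi n 1 (s k) y * phi n v (\<lambda>i. a * y i) u * exp (X k (y, u))) =
         (\<Sum>k\<in>T. real N * (rr (fst k) y * (?H (snd k) u (?j k) * ?P (snd k) u (?j k) y)))"
        by (rule sum.cong[OF refl])
      also have "\<dots> = real N * (\<Sum>m\<in>{1..M}. \<Sum>w\<in>{1..N}. rr w y * (?H m u (?j (w, m)) * ?P m u (?j (w, m)) y))"
        unfolding sum_T by (simp add: sum_distrib_left)
      also have "\<dots> \<le> real N * (\<Sum>m\<in>{1..M}. \<Sum>p\<in>J1 \<times> J2. ?H m u p * ?P m u p y)"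
      proof (intro mult_left_mono sum_mono)
        fix m assume m: "m \<in> {1..M}"
        have nn: "?H m u p * ?P m u p y \<ge> 0" for p
          by (intro mult_nonneg_nonneg divide_nonneg_nonneg fj_nonneg less_imp_le[OF fU_pos[OF v]]) simp
        have "(\<Sum>w\<in>{1..N}. rr w y * (?H m u (?j (w, m)) * ?P m u (?j (w, m)) y)) \<le>
           (\<Sum>w\<in>{1..N}. rr w y * (\<Sum>p\<in>J1 \<times> J2. ?H m u p * ?P m u p y))"
        proof (intro sum_mono mult_left_mono)
          fix w assume "w \<in> {1..N}"
          then have "?j (w, m) \<in> J1 \<times> J2" using J1 J2 m by (auto simp: T_def)
          then show "?H m u (?j (w, m)) * ?P m u (?j (w, m)) y \<le> (\<Sum>p\<in>J1 \<times> J2. ?H m u p * ?P m u p y)"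
            using J1(1) J2(1) nn by (intro member_le_sum[where f="\<lambda>p. ?H m u p * ?P m u p y"]) auto
        qed (rule less_imp_le[OF rr_pos])
        also have "\<dots> \<le> 1 * (\<Sum>p\<in>J1 \<times> J2. ?H m u p * ?P m u p y)"
          unfolding sum_distrib_right[symmetric] by (intro mult_right_mono rr_sum sum_nonneg nn) auto
        finally show "(\<Sum>w\<in>{1..N}. rr w y * (?H m u (?j (w, m)) * ?P m u (?j (w, m)) y)) \<le> (\<Sum>p\<in>J1 \<times> J2. ?H m u p * ?P m u p y)"
          by simp
      qed simp
      also have "\<dots> = real N * real M * ?G (y, u)"
        using card_T_pos unfolding sum_pairs[of _ "{1..M}"] by (simp add: sum_distrib_left mult.assoc)
      finally show ?thesis .
    qed
    have hm: "(\<lambda>u. ?H m u p / real M) \<in> borel_measurable (Ln n)" for m p by measurable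
    have hn: "?H m u p / real M \<ge> 0" for m p u
      by (intro divide_nonneg_nonneg mult_nonneg_nonneg fj_nonneg less_imp_le[OF fU_pos[OF v]]) simp
    have pm: "i \<in> {1..n} \<Longrightarrow> (\<lambda>u. postmean a v c u i) \<in> borel_measurable (Ln n)" for c i
      unfolding postmean_def by measurable
    have "(\<integral>\<^sup>+x. ennreal (?G x) \<partial>Ln2 n) =
       (\<integral>\<^sup>+x. (\<Sum>q\<in>{1..M} \<times> (J1 \<times> J2). ennreal (?H (fst q) (snd x) (snd q) / real M * ?P (fst q) (snd x) (snd q) (fst x))) \<partial>Ln2 n)"
      using hn by (intro nn_integral_cong sum_ennreal[symmetric] mult_nonneg_nonneg) auto
    also have "\<dots> = (\<Sum>q\<in>{1..M} \<times> (J1 \<times> J2). \<integral>\<^sup>+x. ennreal (?H (fst q) (snd x) (snd q) / real M * ?P (fst q) (snd x) (snd q) (fst x)) \<partial>Ln2 n)"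
      using mP by (intro nn_integral_sum) measurable
    also have "\<dots> = (\<Sum>q\<in>{1..M} \<times> (J1 \<times> J2). \<integral>\<^sup>+u. ennreal (?H (fst q) u (snd q) / real M) \<partial>Ln n)"
      by (intro sum.cong refl nn_integral_pair_phi hm hn ka pm)
    also have "\<dots> = (\<integral>\<^sup>+u. (\<Sum>q\<in>{1..M} \<times> (J1 \<times> J2). ennreal (?H (fst q) u (snd q) / real M)) \<partial>Ln n)"
      using hm by (intro nn_integral_sum[symmetric]) measurable
    also have "\<dots> = (\<integral>\<^sup>+u. ennreal ((\<Sum>m\<in>{1..M}. fU a v m u) / real M) \<partial>Ln n)"
    proof (intro nn_integral_cong)
      fix u
      have "(\<Sum>q\<in>{1..M} \<times> (J1 \<times> J2). ennreal (?H (fst q) u (snd q) / real M)) = ennreal (\<Sum>q\<in>{1..M} \<times> (J1 \<times> J2). ?H (fst q) u (snd q) / real M)"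
        using hn by (intro sum_ennreal)
      also have "(\<Sum>q\<in>{1..M} \<times> (J1 \<times> J2). ?H (fst q) u (snd q) / real M) = (\<Sum>m\<in>{1..M}. (\<Sum>i\<in>J1. \<Sum>j\<in>J2. fj a v j1 m i u * fj a v j2 m j u) / fU a v m u) / real M"
        by (simp add: sum_pairs sum_divide_distrib)
      also have "\<dots> = (\<Sum>m\<in>{1..M}. fU a v m u * fU a v m u / fU a v m u) / real M"
      proof (intro arg_cong2[where f="(/)"] sum.cong refl)
        fix m assume m: "m \<in> {1..M}"
        show "(\<Sum>i\<in>J1. \<Sum>j\<in>J2. fj a v j1 m i u * fj a v j2 m j u) = fU a v m u * fU a v m u"
        proof -
          have "(\<Sum>j\<in>J1. fj a v j1 m j u) = fU a v m u" "(\<Sum>j\<in>J2. fj a v j2 m j u) = fU a v m u"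
            using J1 J2 m by (auto intro!: sum_fj)
          then show ?thesis by (simp add: sum_product[symmetric])
        qed
      qed
      finally show "(\<Sum>q\<in>{1..M} \<times> (J1 \<times> J2). ennreal (?H (fst q) u (snd q) / real M)) = ennreal ((\<Sum>m\<in>{1..M}. fU a v m u) / real M)"
        using fU_pos[OF v, of a _ u] by (simp add: less_imp_neq[symmetric])
    qed
    also have "\<dots> = 1" by (rule int_avg_fU[OF v])
    finally show "(\<integral>\<^sup>+x. ennreal (?G x) \<partial>Ln2 n) \<le> 1" by simp
  qed
  moreover have "EE T (J a v) X = EE T (J a v) (\<lambda>k x. ln (rr (fst k) (fst x))) + (ln (real N) +
     ((EE T (J a v) (\<lambda>k x. ln (fj a v j1 (snd k) (j1 k) (snd x))) + EE T (J a v) (\<lambda>k x. ln (fj a v j2 (snd k) (j2 k) (snd x))))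
     - (EE T (J a v) (\<lambda>k x. ln (fU a v (snd k) (snd x))) + EE T (J a v) (\<lambda>k x. ln (phi n (a\<^sup>2 + v) (\<lambda>i. a * s k i) (snd x))))))"
    unfolding X_def
    by (subst EE_add, (intro II_add II_diff R(1) I1 I2 I3 I4 II_const_J v)+)+
       (simp add: EE_diff[OF II_add[OF I1 I2] II_add[OF I3 I4]] EE_add[OF I1 I2] EE_add[OF I3 I4] v)
  ultimately show ?thesis unfolding R(2) EE_ln_phi_out[OF v] by (simp add: algebra_simps)
qed

end

text \<open>U - Y is noise, centred and independent of Y. By polarisation the product is a quarter
  of the difference of the squares of f + (U - Y) and f - (U - Y), whose integrals coincide;
  \<open>bd\<close> makes them finite.\<close>

lemma jlaw_cross:
  assumes v: "v > 0" and i: "i \<in> {1..n}" and [measurable]: "f \<in> borel_measurable (Ln n)"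
    and bd: "\<And>y. \<bar>f y - y i\<bar> \<le> C"
  shows "has_bochner_integral (jlaw n 1 v s) (\<lambda>x. f (fst x) * (snd x i - fst x i)) 0"
proof -
  note [measurable] = measurable_fst_snd_component[OF i] measurable_Ln_component[OF i]
  have m: "(\<lambda>y. ennreal (phi n 1 s y)) \<in> borel_measurable (Ln n)"
    using measurable_phi_Ln[of "\<lambda>x. x" "Ln n" n 1 s] by simp
  define V where "V = (\<integral>\<^sup>+y. ennreal (phi n 1 s y) * ennreal ((f y)\<^sup>2 + v) \<partial>Ln n)"
  have nn: "(\<integral>\<^sup>+x. ennreal ((f (fst x) + e * (snd x i - fst x i))\<^sup>2) \<partial>jlaw n 1 v s) = V" if e: "e\<^sup>2 = 1" for e
  proof -
    have "(\<integral>\<^sup>+x. ennreal ((f (fst x) + e * (snd x i - fst x i))\<^sup>2) \<partial>jlaw n 1 v s) =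
       (\<integral>\<^sup>+y. ennreal (phi n 1 s y) * (\<integral>\<^sup>+u. ennreal (phi n v (\<lambda>i. 1 * y i) u) * ennreal (((f y - e * y i) + e * u i)\<^sup>2) \<partial>Ln n) \<partial>Ln n)"
      by (subst nn_integral_jlaw_fst_snd) (auto simp: algebra_simps)
    also have "\<dots> = (\<integral>\<^sup>+y. ennreal (phi n 1 s y) * ennreal (((f y - e * y i) + e * (1 * y i))\<^sup>2 + e\<^sup>2 * v) \<partial>Ln n)"
      by (simp only: nn_integral_phi_quad[OF v i])
    finally show ?thesis by (simp add: e V_def)
  qed
  have "(f y)\<^sup>2 + v \<le> 2 * (0 + 1 * y i)\<^sup>2 + (2 * C\<^sup>2 + v)" for y
  proof -
    have "(p + q)\<^sup>2 \<le> 2 * p\<^sup>2 + 2 * q\<^sup>2" for p q :: real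
      using zero_le_power2[of "p - q"] by (simp add: power2_eq_square algebra_simps)
    from this[of "y i" "f y - y i"] have "(f y)\<^sup>2 \<le> 2 * (y i)\<^sup>2 + 2 * (f y - y i)\<^sup>2" by simp
    also have "(f y - y i)\<^sup>2 \<le> C\<^sup>2" using bd[of y] by (metis abs_ge_zero order_trans power2_abs power_mono)
    finally show ?thesis by simp
  qed
  then have "V \<le> (\<integral>\<^sup>+y. ennreal (phi n 1 s y) * ennreal (2 * (0 + 1 * y i)\<^sup>2 + (2 * C\<^sup>2 + v)) \<partial>Ln n)"
    unfolding V_def by (intro nn_integral_mono mult_left_mono ennreal_leI) auto
  also have "\<dots> = (\<integral>\<^sup>+y. 2 * (ennreal (phi n 1 s y) * ennreal ((0 + 1 * y i)\<^sup>2)) + ennreal (phi n 1 s y) * ennreal (2 * C\<^sup>2 + v) \<partial>Ln n)"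
    using v by (intro nn_integral_cong) (simp add: distrib_left ennreal_mult' mult.left_commute)
  also have "\<dots> = 2 * ennreal ((0 + 1 * s i)\<^sup>2 + 1\<^sup>2 * 1) + ennreal (2 * C\<^sup>2 + v)"
    using m by (subst nn_integral_add, simp, simp, subst nn_integral_cmult, simp, subst nn_integral_phi_quad[OF _ i], simp,
        simp add: nn_integral_multc nn_integral_phi)
  also have "\<dots> < \<infinity>" by (simp add: ennreal_mult_less_top)
  finally have Vfin: "V < \<infinity>" .
  have hb: "has_bochner_integral (jlaw n 1 v s) (\<lambda>x. (f (fst x) + e * (snd x i - fst x i))\<^sup>2) (enn2real V)" if e: "e\<^sup>2 = 1" for e
  proof (rule has_bochner_integral_nn_integral)
    show "(\<lambda>x. (f (fst x) + e * (snd x i - fst x i))\<^sup>2) \<in> borel_measurable (jlaw n 1 v s)" by measurable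
    show "(\<integral>\<^sup>+x. ennreal ((f (fst x) + e * (snd x i - fst x i))\<^sup>2) \<partial>jlaw n 1 v s) = ennreal (enn2real V)"
      using nn[OF e] Vfin by simp
  qed auto
  have H: "has_bochner_integral (jlaw n 1 v s)
     (\<lambda>x. ((f (fst x) + 1 * (snd x i - fst x i))\<^sup>2 - (f (fst x) + (-1) * (snd x i - fst x i))\<^sup>2) / 4) ((enn2real V - enn2real V) / 4)"
    by (intro has_bochner_integral_divide_zero has_bochner_integral_diff hb) auto
  have eq: "((p + 1 * q)\<^sup>2 - (p + (-1) * q)\<^sup>2) / 4 = p * q" for p q :: real
    by (simp add: power2_eq_square field_simps)
  from H[unfolded eq] show ?thesis by simp
qed

section \<open>Lower bounds on output entropy: Fano, degradedness, entropy power\<close>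

context block
begin

abbreviation fY :: "nat \<Rightarrow> (nat \<Rightarrow> real) \<Rightarrow> real" where
  "fY m \<equiv> mixf {1..N} (\<lambda>_. 1 / real N) (\<lambda>w. s (w, m)) n"

sublocale GM: gauss_mix "{1..N}" "\<lambda>_. 1 / real N" "\<lambda>w. s (w, m)" for m
  by standard (use N1 in auto)

lemma fY_eq: "fY m y = (\<Sum>w\<in>{1..N}. phi n 1 (s (w, m)) y) / real N"
  by (simp add: mixf_def sum_divide_distrib)

lemma II_ln_phi_in: "v > 0 \<Longrightarrow> II T (J a v) (\<lambda>k x. ln (phi n 1 (s k) (fst x)))"
  by (rule ln_phi_J(1)[where \<alpha>=1 and \<beta>=0 and \<gamma>="\<lambda>k i. - s k i"]) simp_all

lemma EE_ln_phi_in: "v > 0 \<Longrightarrow> EE T (J a v) (\<lambda>k x. ln (phi n 1 (s k) (fst x))) = - real n / 2 * (ln (2 * pi) + 1)"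
  using ln_phi_exact[where \<alpha>=1 and \<beta>=0 and \<gamma>="\<lambda>k i. - s k i" and \<theta>=1 and v=v and a=a and Y="\<lambda>k x. fst x" and C="\<lambda>k x. s k"] by simp

lemma II_ln_fY:
  assumes v: "v > 0"
  shows "II T (J a v) (\<lambda>k x. ln (fY (snd k) (fst x)))"
proof (rule II_ln_mix[OF v II_ln_phi_in[OF v], where c="1 / real N"])
  fix k :: "nat \<times> nat" and x :: "(nat \<Rightarrow> real) \<times> (nat \<Rightarrow> real)" assume "k \<in> T"
  then have k: "k = (fst k, snd k)" "fst k \<in> {1..N}" by (auto simp: T_def)
  have "phi n 1 (s (fst k, snd k)) (fst x) \<le> (\<Sum>w\<in>{1..N}. phi n 1 (s (w, snd k)) (fst x))"
    using k by (intro member_le_sum[where f="\<lambda>w. phi n 1 (s (w, snd k)) (fst x)"]) auto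
  then show "1 / real N * phi n 1 (s k) (fst x) \<le> fY (snd k) (fst x)"
    using card_T_pos k(1) by (simp add: fY_eq divide_right_mono)
  have "(\<Sum>w\<in>{1..N}. phi n 1 (s (w, snd k)) (fst x)) \<le> real (card {1..N}) * exp (- real n / 2 * ln (2 * pi * 1))"
    by (intro phi_sum_le) auto
  then show "fY (snd k) (fst x) \<le> exp (- real n / 2 * ln (2 * pi * 1))"
    using card_T_pos by (simp add: fY_eq field_simps)
qed (use card_T_pos phi_pos in auto)

text \<open>In entropies: h(Y | M) - h(Y | W, M) is at least the Fano term, because W is decoded
  from Y. This supplies the input entropy for the entropy power inequality.\<close>

lemma fano_bound:
  assumes v: "v > 0"
  shows "EE T (J a v) (\<lambda>k x. ln (fY (snd k) (fst x))) \<le> - ((1 - Pe) * ln (real N) - ln 2) - real n / 2 * (ln (2 * pi) + 1)"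
proof -
  note R = ln_rr[OF v, of a]
  note I1 = II_ln_fY[OF v, of a] and I2 = II_ln_phi_in[OF v, of a]
  define X where "X k x = ln (rr (fst k) (fst x)) + (ln (real N) + (ln (fY (snd k) (fst x)) - ln (phi n 1 (s k) (fst x))))"
    for k :: "nat \<times> nat" and x :: "(nat \<Rightarrow> real) \<times> (nat \<Rightarrow> real)"
  have II: "II T (J a v) X"
    unfolding X_def by (intro II_add II_diff R(1) I1 I2 II_const_J v)
  have "EE T (J a v) X \<le> 0"
  proof (rule gibbs_block[OF v II])
    let ?h = "\<lambda>y. (\<Sum>m\<in>{1..M}. fY m y) / real M"
    let ?G = "\<lambda>x. ?h (fst x) * phi n v (\<lambda>i. a * fst x i) (snd x)"
    show "?G \<in> borel_measurable (Ln2 n)" by measurable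
    show "(\<Sum>k\<in>T. phi n 1 (s k) y * phi n v (\<lambda>i. a * y i) u * exp (X k (y, u))) \<le> real N * real M * ?G (y, u)" for y u
    proof -
      let ?q = "phi n v (\<lambda>i. a * y i) u"
      have "phi n 1 (s k) y * ?q * exp (X k (y, u)) = ?q * (real N * (rr (fst k) y * fY (snd k) y))" for k
        using phi_pos[of 1 n "s k" y] rr_pos GM.mixf_pos[of "snd k" n y] card_T_pos
        by (simp add: X_def exp_add exp_diff)
      then have "(\<Sum>k\<in>T. phi n 1 (s k) y * ?q * exp (X k (y, u))) = ?q * (real N * (\<Sum>m\<in>{1..M}. (\<Sum>w\<in>{1..N}. rr w y) * fY m y))"
        by (simp only: sum_distrib_left[symmetric] sum_distrib_right fst_conv snd_conv sum_T)
      also have "\<dots> \<le> ?q * (real N * (\<Sum>m\<in>{1..M}. 1 * fY m y))"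
        by (intro mult_left_mono sum_mono mult_right_mono rr_sum) (auto intro: less_imp_le GM.mixf_pos)
      also have "\<dots> = real N * real M * ?G (y, u)" using card_T_pos by simp
      finally show ?thesis .
    qed
    have am: "i \<in> {1..n} \<Longrightarrow> (\<lambda>y. a * y i) \<in> borel_measurable (Ln n)" for i by measurable
    have "(\<integral>\<^sup>+x. ennreal (?G x) \<partial>Ln2 n) = (\<integral>\<^sup>+y. ennreal (?h y) \<partial>Ln n)"
      by (rule nn_integral_pair_phi'[where C="\<lambda>y i. a * y i", OF _ _ v am]) (auto intro!: divide_nonneg_nonneg sum_nonneg less_imp_le[OF GM.mixf_pos])
    also have "\<dots> = (\<integral>\<^sup>+y. ennreal ((\<Sum>p\<in>{1..M} \<times> {1..N}. phi n 1 (\<lambda>i. s (snd p, fst p) i) y) / real (card ({1..M} \<times> {1..N}))) \<partial>Ln n)"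
      unfolding fY_eq by (simp add: sum_divide_distrib sum_pairs mult.commute)
    also have "\<dots> = 1"
      by (rule nn_integral_phi_avg) (use N1 M1 in auto)
    finally show "(\<integral>\<^sup>+x. ennreal (?G x) \<partial>Ln2 n) \<le> 1" by simp
  qed
  moreover have "EE T (J a v) X = EE T (J a v) (\<lambda>k x. ln (rr (fst k) (fst x))) + (ln (real N) +
     (EE T (J a v) (\<lambda>k x. ln (fY (snd k) (fst x))) - EE T (J a v) (\<lambda>k x. ln (phi n 1 (s k) (fst x)))))"
    unfolding X_def
    by (subst EE_add, (intro II_add II_diff R(1) I1 I2 II_const_J v)+)+ (simp add: EE_diff[OF I1 I2] v)
  ultimately show ?thesis unfolding R(2) EE_ln_phi_in[OF v] by (simp add: algebra_simps)
qed

text \<open>The chain rule h(U | M) = h(Y | M) + h(U | Y) - h(Y | U, M): the first term contains the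
  rate, the second is noise of variance \<open>v\<close>, and the last is bounded through the
  predictor \<open>b * U\<close>.\<close>

lemma degraded_bound:
  assumes v: "v > 0" and th: "\<theta> > 0"
    and le: "avg (\<lambda>k i. ((1 - b * a) * s k i)\<^sup>2) + real n * ((1 - b * a)\<^sup>2 + b\<^sup>2 * v) \<le> real n * \<theta>"
  shows "(1 - Pe) * ln (real N) - ln 2 + EE T (J a v) (\<lambda>k x. ln (fU a v (snd k) (snd x)))
     + real n / 2 * (ln (2 * pi) + 1 + ln v - ln \<theta>) \<le> 0"
proof -
  note R = ln_rr[OF v, of a]
  have I1: "II T (J a v) (\<lambda>k x. ln (phi n \<theta> (\<lambda>i. b * snd x i) (fst x)))"
    by (rule ln_phi_J(1)[where \<alpha>=1 and \<beta>="-b" and \<gamma>="\<lambda>k i. 0", OF v th]) simp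
  have I2: "II T (J a v) (\<lambda>k x. ln (phi n v (\<lambda>i. a * fst x i) (snd x)))"
    by (rule ln_phi_J(1)[where \<alpha>="-a" and \<beta>=1 and \<gamma>="\<lambda>k i. 0", OF v v]) simp
  note I3 = II_ln_fU[OF v, of a] and I4 = II_ln_phi_in[OF v, of a]
  define X where "X k x = ln (rr (fst k) (fst x)) + (ln (real N) + ((ln (fU a v (snd k) (snd x)) + ln (phi n \<theta> (\<lambda>i. b * snd x i) (fst x)))
     - (ln (phi n 1 (s k) (fst x)) + ln (phi n v (\<lambda>i. a * fst x i) (snd x)))))"
    for k :: "nat \<times> nat" and x :: "(nat \<Rightarrow> real) \<times> (nat \<Rightarrow> real)"
  have II: "II T (J a v) X"
    unfolding X_def by (intro II_add II_diff R(1) I1 I2 I3 I4 II_const_J v)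
  have "EE T (J a v) X \<le> 0"
  proof (rule gibbs_block[OF v II])
    let ?h = "\<lambda>y. (\<Sum>m\<in>{1..M}. fU a v m y) / real M"
    let ?G = "\<lambda>x. ?h (snd x) * phi n \<theta> (\<lambda>i. b * snd x i) (fst x)"
    show "?G \<in> borel_measurable (Ln2 n)" by measurable
    show "(\<Sum>k\<in>T. phi n 1 (s k) y * phi n v (\<lambda>i. a * y i) u * exp (X k (y, u))) \<le> real N * real M * ?G (y, u)" for y u
    proof -
      let ?q = "phi n \<theta> (\<lambda>i. b * u i) y"
      have "phi n 1 (s k) y * phi n v (\<lambda>i. a * y i) u * exp (X k (y, u)) = ?q * (real N * (rr (fst k) y * fU a v (snd k) u))" for k
        using phi_pos[of 1 n "s k" y] phi_pos[OF v, of n "\<lambda>i. a * y i" u] phi_pos[OF th, of n "\<lambda>i. b * u i" y]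
          rr_pos fU_pos[OF v, of a "snd k" u] card_T_pos
        by (simp add: X_def exp_add exp_diff)
      then have "(\<Sum>k\<in>T. phi n 1 (s k) y * phi n v (\<lambda>i. a * y i) u * exp (X k (y, u))) =
          ?q * (real N * (\<Sum>m\<in>{1..M}. (\<Sum>w\<in>{1..N}. rr w y) * fU a v m u))"
        by (simp only: sum_distrib_left[symmetric] sum_distrib_right fst_conv snd_conv sum_T)
      also have "\<dots> \<le> ?q * (real N * (\<Sum>m\<in>{1..M}. 1 * fU a v m u))"
        by (intro mult_left_mono sum_mono mult_right_mono rr_sum) (auto intro: less_imp_le fU_pos[OF v])
      also have "\<dots> = real N * real M * ?G (y, u)" using card_T_pos by simp
      finally show ?thesis .
    qed
    have bm: "i \<in> {1..n} \<Longrightarrow> (\<lambda>u. b * u i) \<in> borel_measurable (Ln n)" for i by measurable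
    have "(\<integral>\<^sup>+x. ennreal (?G x) \<partial>Ln2 n) = (\<integral>\<^sup>+y. ennreal (?h y) \<partial>Ln n)"
      by (rule nn_integral_pair_phi[where C="\<lambda>u i. b * u i", OF _ _ th bm]) (auto intro!: divide_nonneg_nonneg sum_nonneg less_imp_le[OF fU_pos[OF v]])
    also have "\<dots> = 1" by (rule int_avg_fU[OF v])
    finally show "(\<integral>\<^sup>+x. ennreal (?G x) \<partial>Ln2 n) \<le> 1" by simp
  qed
  moreover have "EE T (J a v) X = EE T (J a v) (\<lambda>k x. ln (rr (fst k) (fst x))) + (ln (real N) +
     ((EE T (J a v) (\<lambda>k x. ln (fU a v (snd k) (snd x))) + EE T (J a v) (\<lambda>k x. ln (phi n \<theta> (\<lambda>i. b * snd x i) (fst x))))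
     - (EE T (J a v) (\<lambda>k x. ln (phi n 1 (s k) (fst x))) + EE T (J a v) (\<lambda>k x. ln (phi n v (\<lambda>i. a * fst x i) (snd x))))))"
    unfolding X_def
    by (subst EE_add, (intro II_add II_diff R(1) I1 I2 I3 I4 II_const_J v)+)+
      (simp add: EE_diff[OF II_add[OF I3 I1] II_add[OF I4 I2]] EE_add[OF I3 I1] EE_add[OF I4 I2] v)
  moreover have "- real n / 2 * (ln (2 * pi) + ln \<theta> + 1) \<le> EE T (J a v) (\<lambda>k x. ln (phi n \<theta> (\<lambda>i. b * snd x i) (fst x)))"
    by (rule ln_phi_test[where \<alpha>=1 and \<beta>="-b" and \<gamma>="\<lambda>k i. 0", OF v th]) (use le in simp_all)
  moreover have "EE T (J a v) (\<lambda>k x. ln (phi n v (\<lambda>i. a * fst x i) (snd x))) = - real n / 2 * (ln (2 * pi) + ln v + 1)"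
    by (rule ln_phi_exact[where \<alpha>="-a" and \<beta>=1 and \<gamma>="\<lambda>k i. 0", OF v v]) simp_all
  ultimately show ?thesis unfolding R(2) EE_ln_phi_in[OF v] by (simp add: algebra_simps)
qed

text \<open>Lieb's form: h(Y + N' | M) is at least \<open>c\<^sup>2\<close> h(Y/c | M) +
  \<open>d\<^sup>2\<close> h(N'/d). Transported input and noise are uncorrelated, so the expected
  logarithm of \<open>epi_weight\<close> is an explicit constant.\<close>

lemma epi_bound:
  assumes v: "v > 0" and cd: "c > 0" "d > 0" "c\<^sup>2 + d\<^sup>2 = 1"
  shows "EE T (J 1 v) (\<lambda>k x. ln (fU 1 v (snd k) (snd x))) \<le> c\<^sup>2 * EE T (J 1 v) (\<lambda>k x. ln (fY (snd k) (fst x)))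
    - real n * (d\<^sup>2 / 2 * ln (2 * pi) - c\<^sup>2 * ln c + d\<^sup>2 * ln (sqrt v / d) + d\<^sup>2 / 2)"
proof -
  let ?S = "\<lambda>m i y. transp {1..N} (\<lambda>_. 1 / real N) (\<lambda>w. s (w, m)) (i - 1) y (y i)"
  let ?K0 = "d\<^sup>2 / 2 * ln (2 * pi) - c\<^sup>2 * ln c + d\<^sup>2 * ln (sqrt v / d)"
  define W where "W k x = (\<Sum>i\<in>{1..n}. ln (epi_weight c d v (?S (snd k) i (fst x)) ((snd x i - fst x i) / sqrt v)))"
    for k :: "nat \<times> nat" and x :: "(nat \<Rightarrow> real) \<times> (nat \<Rightarrow> real)"
  have mS: "(\<lambda>y. ?S m i y) \<in> borel_measurable (Ln n)" if "i \<in> {1..n}" for m i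
    using that by (intro GM.measurable_transp measurable_Ln_component) auto
  have hW: "has_bochner_integral (J 1 v k) (W k) (real n * (?K0 + d\<^sup>2 / 2))" for k
  proof -
    interpret prob_space "J 1 v k" by (rule prob_J[OF v])
    have "has_bochner_integral (J 1 v k) (\<lambda>x. ln (epi_weight c d v (?S (snd k) i (fst x)) ((snd x i - fst x i) / sqrt v))) (?K0 + d\<^sup>2 / 2)"
      if i: "i \<in> {1..n}" for i
    proof -
      define C where "C = (\<Sum>w\<in>{1..N}. \<bar>s (w, snd k) i\<bar>)"
      have C: "\<bar>s (w, snd k) (Suc (i - 1))\<bar> \<le> C" if "w \<in> {1..N}" for w
        unfolding C_def using i that by (auto intro!: member_le_sum[where f="\<lambda>w. \<bar>s (w, snd k) i\<bar>"])
      have bd: "\<bar>?S (snd k) i y - y i\<bar> \<le> C" for y by (rule GM.transp_bound[OF C])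
      have h1: "has_bochner_integral (J 1 v k) (\<lambda>x. ?S (snd k) i (fst x) * (snd x i - fst x i)) 0"
        unfolding J_def by (rule jlaw_cross[OF v i mS[OF i] bd])
      have h2: "has_bochner_integral (J 1 v k) (\<lambda>x. ((-1) * fst x i + 1 * snd x i + 0)\<^sup>2) (((-1 + 1 * 1) * s k i + 0)\<^sup>2 + (-1 + 1 * 1)\<^sup>2 + 1\<^sup>2 * v)"
        unfolding J_def by (rule jlaw_quad[OF v i])
      have h3: "has_bochner_integral (J 1 v k) (\<lambda>x. ?K0) ?K0"
        using prob_space by (simp add: has_bochner_integral_iff)
      have "has_bochner_integral (J 1 v k) (\<lambda>x. ?K0 + c * d / sqrt v * (?S (snd k) i (fst x) * (snd x i - fst x i)) +
           d\<^sup>2 / (2 * v) * ((-1) * fst x i + 1 * snd x i + 0)\<^sup>2)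
         (?K0 + c * d / sqrt v * 0 + d\<^sup>2 / (2 * v) * (((-1 + 1 * 1) * s k i + 0)\<^sup>2 + (-1 + 1 * 1)\<^sup>2 + 1\<^sup>2 * v))"
        by (intro has_bochner_integral_add h3 has_bochner_integral_mult_right[OF h1] has_bochner_integral_mult_right[OF h2])
      moreover have "ln (epi_weight c d v S (g / sqrt v)) = ?K0 + c * d / sqrt v * (S * g) + d\<^sup>2 / (2 * v) * g\<^sup>2" for S g
        using v by (simp add: epi_weight_def power_divide)
      ultimately show ?thesis using v by simp
    qed
    then have "has_bochner_integral (J 1 v k) (W k) (\<Sum>i\<in>{1..n}. ?K0 + d\<^sup>2 / 2)"
      unfolding W_def by (intro has_bochner_integral_sum)
    then show ?thesis by simp
  qed
  have I3: "II T (J 1 v) W" using hW by (auto simp: II_def has_bochner_integral_iff)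
  have eW: "EE T (J 1 v) W = real n * (?K0 + d\<^sup>2 / 2)"
    using hW card_T_pos by (simp add: EE_def has_bochner_integral_iff)
  note I1 = II_ln_fU[OF v, of 1] and I2 = II_cmult[OF II_ln_fY[OF v, of 1], of "c\<^sup>2"]
  define X where "X k x = (ln (fU 1 v (snd k) (snd x)) + W k x) - c\<^sup>2 * ln (fY (snd k) (fst x))"
    for k :: "nat \<times> nat" and x :: "(nat \<Rightarrow> real) \<times> (nat \<Rightarrow> real)"
  have II: "II T (J 1 v) X"
    unfolding X_def by (intro II_add II_diff I1 I2 I3)
  have "EE T (J 1 v) X \<le> 0"
  proof (rule gibbs_block[OF v II])
    let ?k = "\<lambda>m. GM.epi_kernel m c d v n"
    let ?G = "\<lambda>x. \<Sum>m\<in>{1..M}. ?k m (fst x) (snd x) * (fU 1 v m (snd x) / real M)"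
    have mk: "(\<lambda>x. ?k m (fst x) (snd x)) \<in> borel_measurable (Ln2 n)" for m
      by (intro GM.measurable_epi_kernel measurable_fst_snd_component)
    then show "?G \<in> borel_measurable (Ln2 n)" by measurable
    have knn: "?k m y u \<ge> 0" for m y u
      unfolding GM.epi_kernel_def epi_weight_def by (auto intro!: mult_nonneg_nonneg prod_nonneg)
    show "(\<Sum>k\<in>T. phi n 1 (s k) y * phi n v (\<lambda>i. 1 * y i) u * exp (X k (y, u))) \<le> real N * real M * ?G (y, u)" for y u
    proof -
      have eX: "exp (X k (y, u)) = fU 1 v (snd k) u * (\<Prod>i\<in>{1..n}. epi_weight c d v (?S (snd k) i y) ((u i - y i) / sqrt v)) * fY (snd k) y powr (- c\<^sup>2)" for k
        using fU_pos[OF v, of 1 "snd k" u] GM.mixf_pos[of "snd k" n y]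
        by (simp add: X_def W_def exp_add exp_diff exp_sum epi_weight_def powr_def exp_minus field_simps)
      have "(\<Sum>k\<in>T. phi n 1 (s k) y * phi n v (\<lambda>i. 1 * y i) u * exp (X k (y, u))) =
         (\<Sum>m\<in>{1..M}. (\<Sum>w\<in>{1..N}. phi n 1 (s (w, m)) y) * (phi n v (\<lambda>i. 1 * y i) u * exp (X (1, m) (y, u))))"
        unfolding sum_T sum_distrib_right eX by (simp add: mult.assoc)
      also have "\<dots> = (\<Sum>m\<in>{1..M}. real N * (?k m y u * fU 1 v m u))"
      proof (rule sum.cong[OF refl])
        fix m
        have "(\<Sum>w\<in>{1..N}. phi n 1 (s (w, m)) y) = real N * fY m y" using card_T_pos by (simp add: fY_eq)
        moreover have "fY m y * fY m y powr (- c\<^sup>2) = fY m y powr d\<^sup>2"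
        proof -
          have "fY m y powr d\<^sup>2 = fY m y powr (1 + - c\<^sup>2)" using cd(3) by (intro arg_cong2[where f="(powr)"]) auto
          then show ?thesis unfolding powr_add using GM.mixf_pos[of m n y] by simp
        qed
        ultimately show "(\<Sum>w\<in>{1..N}. phi n 1 (s (w, m)) y) * (phi n v (\<lambda>i. 1 * y i) u * exp (X (1, m) (y, u))) = real N * (?k m y u * fU 1 v m u)"
          unfolding GM.epi_kernel_def eX by (simp add: mult_ac)
      qed
      also have "\<dots> = real N * real M * ?G (y, u)" using card_T_pos by (simp add: sum_distrib_left)
      finally show ?thesis by simp
    qed
    have nn: "fU 1 v m u / real M \<ge> 0" for m u using fU_pos[OF v, of 1 m u] by simp
    have "(\<integral>\<^sup>+x. ennreal (?G x) \<partial>Ln2 n) = (\<integral>\<^sup>+x. (\<Sum>m\<in>{1..M}. ennreal (?k m (fst x) (snd x)) * ennreal (fU 1 v m (snd x) / real M)) \<partial>Ln2 n)"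
    proof (intro nn_integral_cong)
      fix x :: "(nat \<Rightarrow> real) \<times> (nat \<Rightarrow> real)"
      show "ennreal (?G x) = (\<Sum>m\<in>{1..M}. ennreal (?k m (fst x) (snd x)) * ennreal (fU 1 v m (snd x) / real M))"
        unfolding ennreal_mult'[OF knn, symmetric] using knn nn by (intro sum_ennreal[symmetric] mult_nonneg_nonneg)
    qed
    also have "\<dots> = (\<Sum>m\<in>{1..M}. \<integral>\<^sup>+x. ennreal (?k m (fst x) (snd x)) * ennreal (fU 1 v m (snd x) / real M) \<partial>Ln2 n)"
      using mk by (intro nn_integral_sum) measurable
    also have "\<dots> \<le> (\<Sum>m\<in>{1..M}. \<integral>\<^sup>+u. ennreal (fU 1 v m u / real M) \<partial>Ln n)"
    proof (rule sum_mono)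
      fix m
      have "(\<integral>\<^sup>+x. ennreal (?k m (fst x) (snd x)) * ennreal (fU 1 v m (snd x) / real M) \<partial>Ln2 n) =
         (\<integral>\<^sup>+y. \<integral>\<^sup>+u. ennreal (?k m y u) * ennreal (fU 1 v m u / real M) \<partial>Ln n \<partial>Ln n)"
        using mk by (subst nn_integral_Ln_pair(1)) auto
      also have "\<dots> \<le> (\<integral>\<^sup>+u. ennreal (fU 1 v m u / real M) \<partial>Ln n)"
        by (rule GM.nn_integral_epi_kernel[OF cd v]) simp
      finally show "(\<integral>\<^sup>+x. ennreal (?k m (fst x) (snd x)) * ennreal (fU 1 v m (snd x) / real M) \<partial>Ln2 n) \<le> (\<integral>\<^sup>+u. ennreal (fU 1 v m u / real M) \<partial>Ln n)" .
    qed
    also have "\<dots> = (\<integral>\<^sup>+u. (\<Sum>m\<in>{1..M}. ennreal (fU 1 v m u / real M)) \<partial>Ln n)"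
      by (intro nn_integral_sum[symmetric]) measurable
    also have "\<dots> = (\<integral>\<^sup>+u. ennreal ((\<Sum>m\<in>{1..M}. fU 1 v m u) / real M) \<partial>Ln n)"
    proof (intro nn_integral_cong)
      fix u
      show "(\<Sum>m\<in>{1..M}. ennreal (fU 1 v m u / real M)) = ennreal ((\<Sum>m\<in>{1..M}. fU 1 v m u) / real M)"
        unfolding sum_divide_distrib by (rule sum_ennreal) (rule nn)
    qed
    also have "\<dots> = 1" by (rule int_avg_fU[OF v])
    finally show "(\<integral>\<^sup>+x. ennreal (?G x) \<partial>Ln2 n) \<le> 1" .
  qed
  moreover have "EE T (J 1 v) X = (EE T (J 1 v) (\<lambda>k x. ln (fU 1 v (snd k) (snd x))) + EE T (J 1 v) W) - c\<^sup>2 * EE T (J 1 v) (\<lambda>k x. ln (fY (snd k) (fst x)))"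
    unfolding X_def by (subst EE_diff[OF II_add[OF I1 I3] I2], subst EE_add[OF I1 I3]) (simp add: EE_cmult)
  ultimately show ?thesis unfolding eW by (simp add: algebra_simps)
qed

end

section \<open>The block of a secrecy code\<close>

lemma num_msgs_ge_1: "r \<ge> 0 \<Longrightarrow> num_msgs n r \<ge> 1"
proof -
  assume "r \<ge> 0"
  then have "(1::real) \<le> 2 powr (real n * r)" by (intro ge_one_powr_ge_zero) auto
  then show ?thesis unfolding num_msgs_def by (simp add: le_nat_iff le_floor_iff)
qed

definition relay_sum :: "secrecy_code \<Rightarrow> nat \<times> nat \<Rightarrow> nat \<Rightarrow> real" where
  "relay_sum c k i = relay1 c (fst (src_enc c (fst k) (snd k))) (snd k) i + relay2 c (snd (src_enc c (fst k) (snd k))) (snd k) i"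

locale coded =
  fixes g R' R :: real and n :: nat and c :: secrecy_code
  assumes g: "0 \<le> g" "g < 1" and R: "R \<ge> 0" and R': "R' \<ge> 0"
    and dec: "dec c \<in> measurable (\<Pi>\<^sub>M i\<in>{1..n}. borel) (count_space {1..num_msgs n R})"
begin

abbreviation "N \<equiv> num_msgs n R"
abbreviation "M \<equiv> num_msgs n R'"

sublocale block n N M "relay_sum c" "dec c"
proof
  show "dec c \<in> Ln n \<rightarrow>\<^sub>M count_space {1..N}"
    using dec by (simp only: measurable_cong_sets[OF sets_Ln_borel refl])
qed (use R R' num_msgs_ge_1 in auto)

lemma prob_gaussian_noise: "v > 0 \<Longrightarrow> prob_space (gaussian_noise n v)"
  unfolding gaussian_noise_def by (intro prob_space_PiM prob_space_normal_density) auto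

lemma sets_gaussian_noise: "sets (gaussian_noise n v) = sets (Ln n)"
  unfolding gaussian_noise_def by (intro sets_PiM_cong) auto

abbreviation "\<Omega> \<equiv> code_space g R' R n"

lemma sets_code_space: "sets \<Omega> = sets (count_space {1..N} \<Otimes>\<^sub>M count_space {1..M} \<Otimes>\<^sub>M (Ln2 n))"
  unfolding code_space_def
  by (intro sets_pair_measure_cong sets_uniform_count_measure_count_space sets_gaussian_noise)

lemma prob_code_space: "prob_space \<Omega>"
proof -
  have N: "prob_space (uniform_count_measure {1..N})" "prob_space (uniform_count_measure {1..M})"
    using N1 M1 by (auto intro!: prob_space_uniform_count_measure)
  have G: "prob_space (gaussian_noise n 1)" "prob_space (gaussian_noise n (1 - g))"
    using g by (auto intro!: prob_gaussian_noise)
  show ?thesis unfolding code_space_def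
    by (intro prob_space_pair N G)
qed

lemma nn_integral_code_space:
  assumes h: "h \<in> borel_measurable \<Omega>"
  shows "(\<integral>\<^sup>+\<omega>. h \<omega> \<partial>\<Omega>) = ennreal (1 / (real N * real M)) *
    (\<Sum>k\<in>T. \<integral>\<^sup>+u. \<integral>\<^sup>+v. h (fst k, snd k, u, v) \<partial>gaussian_noise n (1 - g) \<partial>gaussian_noise n 1)"
proof -
  let ?U = "\<lambda>A. uniform_count_measure A :: nat measure"
  let ?G1 = "gaussian_noise n 1" and ?G2 = "gaussian_noise n (1 - g)"
  have sf: "sigma_finite_measure ?G2" "sigma_finite_measure (?G1 \<Otimes>\<^sub>M ?G2)" "sigma_finite_measure (?U {1..M} \<Otimes>\<^sub>M ?G1 \<Otimes>\<^sub>M ?G2)"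
  proof -
    have G: "prob_space ?G1" "prob_space ?G2"
      using g by (auto intro!: prob_gaussian_noise)
    have U: "prob_space (?U {1..M})" using M1 by (auto intro!: prob_space_uniform_count_measure)
    show "sigma_finite_measure ?G2" "sigma_finite_measure (?G1 \<Otimes>\<^sub>M ?G2)" "sigma_finite_measure (?U {1..M} \<Otimes>\<^sub>M ?G1 \<Otimes>\<^sub>M ?G2)"
      by (intro prob_space_imp_sigma_finite prob_space_pair G U)+
  qed
  have h1: "(\<lambda>x. h (w, x)) \<in> borel_measurable (?U {1..M} \<Otimes>\<^sub>M ?G1 \<Otimes>\<^sub>M ?G2)" if "w \<in> {1..N}" for w
    using measurable_compose[OF measurable_Pair1' h[unfolded code_space_def]] that
    by (simp add: space_uniform_count_measure)
  have h2: "(\<lambda>x. h (w, m, x)) \<in> borel_measurable (?G1 \<Otimes>\<^sub>M ?G2)" if "w \<in> {1..N}" "m \<in> {1..M}" for w m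
    using measurable_compose[OF measurable_Pair1' h1[OF that(1)]] that
    by (simp add: space_uniform_count_measure)
  have "(\<integral>\<^sup>+\<omega>. h \<omega> \<partial>\<Omega>) = (\<integral>\<^sup>+w. \<integral>\<^sup>+x. h (w, x) \<partial>(?U {1..M} \<Otimes>\<^sub>M ?G1 \<Otimes>\<^sub>M ?G2) \<partial>?U {1..N})"
    unfolding code_space_def by (rule sigma_finite_measure.nn_integral_fst[symmetric, OF sf(3) h[unfolded code_space_def]])
  also have "\<dots> = (\<Sum>w\<in>{1..N}. ennreal (1 / real N) * (\<integral>\<^sup>+x. h (w, x) \<partial>(?U {1..M} \<Otimes>\<^sub>M ?G1 \<Otimes>\<^sub>M ?G2)))"
    unfolding uniform_count_measure_def by (subst nn_integral_point_measure_finite) auto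
  also have "\<dots> = (\<Sum>w\<in>{1..N}. ennreal (1 / real N) * (\<Sum>m\<in>{1..M}. ennreal (1 / real M) *
      (\<integral>\<^sup>+u. \<integral>\<^sup>+v. h (w, m, u, v) \<partial>?G2 \<partial>?G1)))"
  proof (intro sum.cong refl arg_cong2[where f="(*)"])
    fix w assume w: "w \<in> {1..N}"
    have "(\<integral>\<^sup>+x. h (w, x) \<partial>(?U {1..M} \<Otimes>\<^sub>M ?G1 \<Otimes>\<^sub>M ?G2)) = (\<integral>\<^sup>+m. \<integral>\<^sup>+x. h (w, m, x) \<partial>(?G1 \<Otimes>\<^sub>M ?G2) \<partial>?U {1..M})"
      by (rule sigma_finite_measure.nn_integral_fst[symmetric, OF sf(2) h1[OF w]])
    also have "\<dots> = (\<Sum>m\<in>{1..M}. ennreal (1 / real M) * (\<integral>\<^sup>+x. h (w, m, x) \<partial>(?G1 \<Otimes>\<^sub>M ?G2)))"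
      unfolding uniform_count_measure_def by (subst nn_integral_point_measure_finite) auto
    also have "\<dots> = (\<Sum>m\<in>{1..M}. ennreal (1 / real M) * (\<integral>\<^sup>+u. \<integral>\<^sup>+v. h (w, m, u, v) \<partial>?G2 \<partial>?G1))"
      by (intro sum.cong refl arg_cong2[where f="(*)"] sigma_finite_measure.nn_integral_fst[symmetric, OF sf(1)] h2 w)
    finally show "(\<integral>\<^sup>+x. h (w, x) \<partial>(?U {1..M} \<Otimes>\<^sub>M ?G1 \<Otimes>\<^sub>M ?G2)) =
       (\<Sum>m\<in>{1..M}. ennreal (1 / real M) * (\<integral>\<^sup>+u. \<integral>\<^sup>+v. h (w, m, u, v) \<partial>?G2 \<partial>?G1))" .
  qed
  also have "\<dots> = ennreal (1 / (real N * real M)) *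
    (\<Sum>k\<in>T. \<integral>\<^sup>+u. \<integral>\<^sup>+v. h (fst k, snd k, u, v) \<partial>?G2 \<partial>?G1)"
  proof -
    have "ennreal (1 / (real N * real M)) = ennreal (1 / real N) * ennreal (1 / real M)"
      by (subst ennreal_mult'[symmetric]) auto
    then show ?thesis by (simp add: T_def sum_pairs sum_distrib_left mult.assoc)
  qed
  finally show ?thesis .
qed

text \<open>\<open>v\<close> is free because the sigma-algebra of \<open>gaussian_noise\<close> does
  not depend on the variance. Any function of the message pair is measurable, as the pair lives in a
  finite discrete space.\<close>

lemma code_space_components:
  "fst \<in> \<Omega> \<rightarrow>\<^sub>M count_space {1..N}"
  "(\<lambda>\<omega>. F (fst \<omega>) (fst (snd \<omega>)) :: real) \<in> borel_measurable \<Omega>"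
  "(\<lambda>\<omega>. fst (snd (snd \<omega>))) \<in> \<Omega> \<rightarrow>\<^sub>M gaussian_noise n v"
  "(\<lambda>\<omega>. snd (snd (snd \<omega>))) \<in> \<Omega> \<rightarrow>\<^sub>M gaussian_noise n v"
proof -
  let ?S = "count_space {1..N} \<Otimes>\<^sub>M count_space {1..M} \<Otimes>\<^sub>M (Ln2 n)"
  note ms = measurable_cong_sets[OF sets_code_space]
  show "fst \<in> \<Omega> \<rightarrow>\<^sub>M count_space {1..N}" unfolding ms[OF refl] by measurable
  show "(\<lambda>\<omega>. fst (snd (snd \<omega>))) \<in> \<Omega> \<rightarrow>\<^sub>M gaussian_noise n v"
    unfolding ms[OF sets_gaussian_noise] by measurable
  show "(\<lambda>\<omega>. snd (snd (snd \<omega>))) \<in> \<Omega> \<rightarrow>\<^sub>M gaussian_noise n v"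
    unfolding ms[OF sets_gaussian_noise] by measurable
  have "(\<lambda>\<omega>. (fst \<omega>, fst (snd \<omega>))) \<in> ?S \<rightarrow>\<^sub>M count_space {1..N} \<Otimes>\<^sub>M count_space {1..M}" by measurable
  then have p: "(\<lambda>\<omega>. (fst \<omega>, fst (snd \<omega>))) \<in> ?S \<rightarrow>\<^sub>M count_space ({1..N} \<times> {1..M})"
    by (simp add: pair_measure_countable)
  have "(\<lambda>k. F (fst k) (snd k)) \<in> count_space ({1..N} \<times> {1..M}) \<rightarrow>\<^sub>M borel" by simp
  from measurable_compose[OF p this]
  show "(\<lambda>\<omega>. F (fst \<omega>) (fst (snd \<omega>))) \<in> borel_measurable \<Omega>" unfolding ms[OF refl] by simp
qed

lemma dest_output_eq:
  "dest_output n c (w, m, u, v) = (\<lambda>i\<in>{1..n}. relay_sum c (w, m) i + u i)"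
  by (simp add: dest_output_def relay_sum_def)

lemma measurable_dest_output: "dest_output n c \<in> \<Omega> \<rightarrow>\<^sub>M Ln n"
proof -
  have "(\<lambda>\<omega>. \<lambda>i\<in>{1..n}. relay_sum c (fst \<omega>, fst (snd \<omega>)) i + fst (snd (snd \<omega>)) i) \<in> \<Omega> \<rightarrow>\<^sub>M Ln n"
    by (rule measurable_gaussian_noise_shift[OF code_space_components(2)[where F="\<lambda>w m. relay_sum c (w, m) i" for i] zero_less_one code_space_components(3)])
  moreover have "(\<lambda>\<omega>. \<lambda>i\<in>{1..n}. relay_sum c (fst \<omega>, fst (snd \<omega>)) i + fst (snd (snd \<omega>)) i) = dest_output n c"
    by (auto simp: fun_eq_iff dest_output_eq)
  ultimately show ?thesis by simp
qed

lemma measurable_eve_output: "eve_output g n c \<in> \<Omega> \<rightarrow>\<^sub>M Ln n"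
proof -
  have "(\<lambda>\<omega>. \<lambda>i\<in>{1..n}. sqrt g * dest_output n c \<omega> i + snd (snd (snd \<omega>)) i) \<in> \<Omega> \<rightarrow>\<^sub>M Ln n"
    by (rule measurable_gaussian_noise_shift[OF _ zero_less_one code_space_components(4)])
       (intro borel_measurable_times borel_measurable_const measurable_Ln_comp[OF measurable_dest_output])
  moreover have "(\<lambda>\<omega>. \<lambda>i\<in>{1..n}. sqrt g * dest_output n c \<omega> i + snd (snd (snd \<omega>)) i) = eve_output g n c"
    by (auto simp: fun_eq_iff eve_output_def)
  ultimately show ?thesis by simp
qed

text \<open>The eavesdropper's noise integrates out, and shifting the legitimate noise by the
  codeword produces the densities in \<open>Pe\<close>.\<close>

lemma error_prob_eq: "error_prob g R' R n c = Pe"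
proof -
  let ?A = "{\<omega> \<in> space \<Omega>. dec c (dest_output n c \<omega>) \<noteq> msg \<omega>}"
  let ?e = "\<lambda>k. \<integral>\<^sup>+y. ennreal (phi n 1 (relay_sum c k) y) * indicator {y. dec c y \<noteq> fst k} y \<partial>Ln n"
  have "(\<lambda>\<omega>. (dec c (dest_output n c \<omega>), fst \<omega>)) \<in> \<Omega> \<rightarrow>\<^sub>M count_space {1..N} \<Otimes>\<^sub>M count_space {1..N}"
    by (intro measurable_Pair measurable_compose[OF measurable_dest_output dc] code_space_components(1))
  then have "(\<lambda>\<omega>. (dec c (dest_output n c \<omega>), fst \<omega>)) \<in> \<Omega> \<rightarrow>\<^sub>M count_space ({1..N} \<times> {1..N})"
    by (simp add: pair_measure_countable)
  from measurable_sets[OF this, of "{p \<in> {1..N} \<times> {1..N}. fst p \<noteq> snd p}"]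
  have "(\<lambda>\<omega>. (dec c (dest_output n c \<omega>), fst \<omega>)) -` {p \<in> {1..N} \<times> {1..N}. fst p \<noteq> snd p} \<inter> space \<Omega> \<in> sets \<Omega>" by auto
  moreover have "(\<lambda>\<omega>. (dec c (dest_output n c \<omega>), fst \<omega>)) -` {p \<in> {1..N} \<times> {1..N}. fst p \<noteq> snd p} \<inter> space \<Omega> = ?A"
    using measurable_space[OF measurable_compose[OF measurable_dest_output dc]] measurable_space[OF code_space_components(1)]
    by (auto simp: msg_def split_beta')
  ultimately have A: "?A \<in> sets \<Omega>" by simp
  have spT: "(w, m, u, v) \<in> space \<Omega>" if "(w, m) \<in> T" "u \<in> space (gaussian_noise n 1)" "v \<in> space (gaussian_noise n (1 - g))" for w m u v
    using that by (simp add: code_space_def space_pair_measure space_uniform_count_measure T_def)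
  have "emeasure \<Omega> ?A = (\<integral>\<^sup>+\<omega>. indicator ?A \<omega> \<partial>\<Omega>)" using A by simp
  also have "\<dots> = ennreal (1 / (real N * real M)) *
    (\<Sum>k\<in>T. \<integral>\<^sup>+u. \<integral>\<^sup>+v. indicator ?A (fst k, snd k, u, v) \<partial>gaussian_noise n (1 - g) \<partial>gaussian_noise n 1)"
    using A by (intro nn_integral_code_space) auto
  also have "(\<Sum>k\<in>T. \<integral>\<^sup>+u. \<integral>\<^sup>+v. indicator ?A (fst k, snd k, u, v) \<partial>gaussian_noise n (1 - g) \<partial>gaussian_noise n 1) = (\<Sum>k\<in>T. ?e k)"
  proof (rule sum.cong[OF refl])
    fix k assume k: "k \<in> T"
    have "(\<integral>\<^sup>+u. \<integral>\<^sup>+v. indicator ?A (fst k, snd k, u, v) \<partial>gaussian_noise n (1 - g) \<partial>gaussian_noise n 1) =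
      (\<integral>\<^sup>+u. indicator {y \<in> space (Ln n). dec c y \<noteq> fst k} (\<lambda>i\<in>{1..n}. relay_sum c k i + u i) \<partial>gaussian_noise n 1)"
    proof (rule nn_integral_cong)
      fix u assume u: "u \<in> space (gaussian_noise n 1)"
      interpret prob_space "gaussian_noise n (1 - g)" using g by (intro prob_gaussian_noise) simp
      have "(\<integral>\<^sup>+v. indicator ?A (fst k, snd k, u, v) \<partial>gaussian_noise n (1 - g)) =
        (\<integral>\<^sup>+v. indicator {y \<in> space (Ln n). dec c y \<noteq> fst k} (\<lambda>i\<in>{1..n}. relay_sum c k i + u i) \<partial>gaussian_noise n (1 - g))"
        using k u spT[of "fst k" "snd k" u]
        by (intro nn_integral_cong) (auto simp: indicator_def dest_output_eq msg_def space_PiM PiE_def extensional_def restrict_def)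
      also have "\<dots> = indicator {y \<in> space (Ln n). dec c y \<noteq> fst k} (\<lambda>i\<in>{1..n}. relay_sum c k i + u i)"
        by (simp add: emeasure_space_1)
      finally show "(\<integral>\<^sup>+v. indicator ?A (fst k, snd k, u, v) \<partial>gaussian_noise n (1 - g)) =
        indicator {y \<in> space (Ln n). dec c y \<noteq> fst k} (\<lambda>i\<in>{1..n}. relay_sum c k i + u i)" .
    qed
    also have "\<dots> = (\<integral>\<^sup>+y. ennreal (phi n 1 (relay_sum c k) y) * indicator {y \<in> space (Ln n). dec c y \<noteq> fst k} y \<partial>Ln n)"
      using dc_set[of "fst k"] by (intro nn_integral_gaussian_noise_shift) auto
    also have "\<dots> = ?e k"
      by (intro nn_integral_cong) (auto simp: indicator_def)
    finally show "(\<integral>\<^sup>+u. \<integral>\<^sup>+v. indicator ?A (fst k, snd k, u, v) \<partial>gaussian_noise n (1 - g) \<partial>gaussian_noise n 1) = ?e k" .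
  qed
  finally have em: "emeasure \<Omega> ?A = ennreal (1 / (real N * real M)) * (\<Sum>k\<in>T. ?e k)" .
  have fin: "?e k < \<infinity>" for k
  proof -
    have "?e k \<le> (\<integral>\<^sup>+y. ennreal (phi n 1 (relay_sum c k) y) \<partial>Ln n)"
      by (intro nn_integral_mono) (auto simp: indicator_def)
    also have "\<dots> < \<infinity>" by (simp add: nn_integral_phi)
    finally show ?thesis .
  qed
  have "enn2real (\<Sum>k\<in>T. ?e k) = (\<Sum>k\<in>T. enn2real (?e k))"
  proof -
    have "(\<Sum>k\<in>T. ?e k) = (\<Sum>k\<in>T. ennreal (enn2real (?e k)))"
      by (intro sum.cong refl ennreal_enn2real[symmetric]) (use fin in \<open>simp add: infinity_ennreal_def\<close>)
    then show ?thesis by (simp add: sum_ennreal sum_nonneg)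
  qed
  then show ?thesis
    unfolding error_prob_def measure_def em Pe_def using card_T_pos by (simp add: enn2real_mult)
qed

text \<open>Given the message pair, the eavesdropper sees the second component of
  \<open>jlaw\<close>. The variance \<open>(sqrt g)\<^sup>2 + (1 - g)\<close> equals 1 but is left
  in the shape \<open>a\<^sup>2 + v\<close> of the block.\<close>

lemma nn_integral_msg_eve:
  assumes h: "\<And>w. w \<in> {1..N} \<Longrightarrow> h w \<in> borel_measurable (Ln n)"
    and m: "(\<lambda>\<omega>. h (msg \<omega>) (eve_output g n c \<omega>)) \<in> borel_measurable \<Omega>"
  shows "(\<integral>\<^sup>+\<omega>. h (msg \<omega>) (eve_output g n c \<omega>) \<partial>\<Omega>) = ennreal (1 / (real N * real M)) *
    (\<Sum>k\<in>T. \<integral>\<^sup>+z. ennreal (phi n ((sqrt g)\<^sup>2 + (1 - g)) (\<lambda>i. sqrt g * relay_sum c k i) z) * h (fst k) z \<partial>Ln n)"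
  unfolding nn_integral_code_space[OF m]
proof (intro arg_cong2[where f="(*)"] refl sum.cong)
  fix k assume k: "k \<in> T"
  have v: "1 - g > 0" using g by simp
  have hk [measurable]: "h (fst k) \<in> borel_measurable (Ln n)" using k by (intro h) (auto simp: T_def)
  let ?F = "\<lambda>y. \<integral>\<^sup>+z. ennreal (phi n (1 - g) (\<lambda>i. sqrt g * y i) z) * h (fst k) z \<partial>Ln n"
  have mF: "?F \<in> borel_measurable (Ln n)"
  proof (rule sigma_finite_measure.borel_measurable_nn_integral[OF sigma_finite_Ln])
    show "(\<lambda>(y, z). ennreal (phi n (1 - g) (\<lambda>i. sqrt g * y i) z) * h (fst k) z) \<in> borel_measurable (Ln2 n)"
      unfolding split_beta' by measurable
  qed
  have "(\<integral>\<^sup>+u. \<integral>\<^sup>+v. h (msg (fst k, snd k, u, v)) (eve_output g n c (fst k, snd k, u, v)) \<partial>gaussian_noise n (1 - g) \<partial>gaussian_noise n 1) =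
     (\<integral>\<^sup>+u. ?F (\<lambda>i\<in>{1..n}. relay_sum c k i + u i) \<partial>gaussian_noise n 1)"
  proof (rule nn_integral_cong)
    fix u
    have "eve_output g n c (fst k, snd k, u, v) = (\<lambda>i\<in>{1..n}. sqrt g * (\<lambda>i\<in>{1..n}. relay_sum c k i + u i) i + v i)" for v
      by (cases k) (simp add: eve_output_def dest_output_eq)
    then show "(\<integral>\<^sup>+v. h (msg (fst k, snd k, u, v)) (eve_output g n c (fst k, snd k, u, v)) \<partial>gaussian_noise n (1 - g)) =
       ?F (\<lambda>i\<in>{1..n}. relay_sum c k i + u i)"
      using nn_integral_gaussian_noise_shift[OF v hk] by (simp only: msg_def case_prod_conv)
  qed
  also have "\<dots> = (\<integral>\<^sup>+y. ennreal (phi n 1 (relay_sum c k) y) * ?F y \<partial>Ln n)"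
    by (intro nn_integral_gaussian_noise_shift mF) simp
  also have "\<dots> = (\<integral>\<^sup>+x. h (fst k) (snd x) \<partial>jlaw n (sqrt g) (1 - g) (relay_sum c k))"
    by (rule nn_integral_jlaw_fst_snd[symmetric, where h="\<lambda>x. h (fst k) (snd x)", simplified]) measurable
  also have "\<dots> = (\<integral>\<^sup>+z. ennreal (phi n ((sqrt g)\<^sup>2 + (1 - g)) (\<lambda>i. sqrt g * relay_sum c k i) z) * h (fst k) z \<partial>Ln n)"
    by (rule nn_integral_jlaw_snd[OF v hk])
  finally show "(\<integral>\<^sup>+u. \<integral>\<^sup>+v. h (msg (fst k, snd k, u, v)) (eve_output g n c (fst k, snd k, u, v)) \<partial>gaussian_noise n (1 - g) \<partial>gaussian_noise n 1) =
     (\<integral>\<^sup>+z. ennreal (phi n ((sqrt g)\<^sup>2 + (1 - g)) (\<lambda>i. sqrt g * relay_sum c k i) z) * h (fst k) z \<partial>Ln n)" .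
qed

lemma measurable_msg: "msg \<in> \<Omega> \<rightarrow>\<^sub>M count_space {1..N}"
proof -
  have "msg = fst" by (auto simp: msg_def fun_eq_iff)
  then show ?thesis using code_space_components(1) by simp
qed

lemma distributed_msg: "distributed \<Omega> (count_space {1..N}) msg (\<lambda>w. ennreal (1 / real N))"
  unfolding distributed_def
proof (intro conjI measurable_msg measure_eqI)
  fix A assume "A \<in> sets (distr \<Omega> (count_space {1..N}) msg)"
  then have A: "A \<subseteq> {1..N}" by simp
  then have fA: "finite A" by (rule finite_subset) simp
  have t: "(sqrt g)\<^sup>2 + (1 - g) > 0" using g by simp
  have "emeasure (distr \<Omega> (count_space {1..N}) msg) A = (\<integral>\<^sup>+\<omega>. indicator A (msg \<omega>) \<partial>\<Omega>)"
    using A by (subst nn_integral_distr[OF measurable_msg, symmetric]) auto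
  also have "\<dots> = ennreal (1 / (real N * real M)) * (\<Sum>k\<in>T. indicator A (fst k))"
    using measurable_compose[OF measurable_msg, of "indicator A :: nat \<Rightarrow> ennreal" borel] t
    by (subst nn_integral_msg_eve) (auto simp: nn_integral_multc nn_integral_phi)
  also have "(\<Sum>k\<in>T. indicator A (fst k) :: ennreal) = ennreal (real M * real (card A))"
  proof -
    have "(\<Sum>k\<in>T. indicator A (fst k) :: ennreal) = of_nat M * (\<Sum>w\<in>{1..N}. indicator A w)"
      by (simp add: T_def sum_pairs sum_distrib_left)
    also have "(\<Sum>w\<in>{1..N}. indicator A w :: ennreal) = of_nat (card A)"
      using A by (simp add: indicator_def sum.If_cases Int_absorb1)
    finally show ?thesis by (simp add: ennreal_of_nat_eq_real_of_nat ennreal_mult)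
  qed
  also have "ennreal (1 / (real N * real M)) * ennreal (real M * real (card A)) = ennreal (real (card A) / real N)"
    using card_T_pos by (simp add: ennreal_mult'[symmetric])
  also have "\<dots> = emeasure (density (count_space {1..N}) (\<lambda>w. ennreal (1 / real N))) A"
    using A fA by (simp add: emeasure_density nn_integral_cmult_indicator ennreal_mult'[symmetric] ennreal_of_nat_eq_real_of_nat)
  finally show "emeasure (distr \<Omega> (count_space {1..N}) msg) A = emeasure (density (count_space {1..N}) (\<lambda>w. ennreal (1 / real N))) A" .
qed simp_all

lemma distributed_eve: "distributed \<Omega> (Ln n) (eve_output g n c) (\<lambda>z. ennreal (pz (sqrt g) (1 - g) z))"
  unfolding distributed_def
proof (intro conjI measurable_eve_output measure_eqI)
  fix A assume "A \<in> sets (distr \<Omega> (Ln n) (eve_output g n c))"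
  then have A [measurable]: "A \<in> sets (Ln n)" by simp
  let ?p = "\<lambda>k. phi n ((sqrt g)\<^sup>2 + (1 - g)) (\<lambda>i. sqrt g * relay_sum c k i)"
  have "emeasure (distr \<Omega> (Ln n) (eve_output g n c)) A = (\<integral>\<^sup>+\<omega>. indicator A (eve_output g n c \<omega>) \<partial>\<Omega>)"
    by (subst nn_integral_distr[OF measurable_eve_output, symmetric]) auto
  also have "\<dots> = ennreal (1 / (real N * real M)) * (\<Sum>k\<in>T. \<integral>\<^sup>+z. ennreal (?p k z) * indicator A z \<partial>Ln n)"
    using measurable_compose[OF measurable_eve_output, of "indicator A :: _ \<Rightarrow> ennreal" borel]
    by (intro nn_integral_msg_eve) auto
  also have "\<dots> = (\<integral>\<^sup>+z. ennreal (1 / (real N * real M)) * (\<Sum>k\<in>T. ennreal (?p k z) * indicator A z) \<partial>Ln n)"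
    by (subst nn_integral_cmult, measurable) (subst nn_integral_sum, auto)
  also have "\<dots> = (\<integral>\<^sup>+z. ennreal (pz (sqrt g) (1 - g) z) * indicator A z \<partial>Ln n)"
  proof (rule nn_integral_cong)
    fix z
    have "(\<Sum>k\<in>T. ennreal (?p k z) * indicator A z) = ennreal (\<Sum>k\<in>T. ?p k z) * indicator A z"
      by (simp add: sum_ennreal sum_distrib_right[symmetric])
    then show "ennreal (1 / (real N * real M)) * (\<Sum>k\<in>T. ennreal (?p k z) * indicator A z) = ennreal (pz (sqrt g) (1 - g) z) * indicator A z"
      by (simp add: pz_def mult.assoc[symmetric] ennreal_mult'[symmetric] sum_nonneg)
  qed
  also have "\<dots> = emeasure (density (Ln n) (\<lambda>z. ennreal (pz (sqrt g) (1 - g) z))) A"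
    by (subst emeasure_density) auto
  finally show "emeasure (distr \<Omega> (Ln n) (eve_output g n c)) A = emeasure (density (Ln n) (\<lambda>z. ennreal (pz (sqrt g) (1 - g) z))) A" .
qed simp_all

lemma measurable_pzw_pair:
  "(\<lambda>x. pzw a v (fst x) (snd x)) \<in> borel_measurable (count_space {1..N} \<Otimes>\<^sub>M Ln n)"
  by (rule measurable_compose_countable'[where I="{1..N}" and g=fst and f="\<lambda>w x. pzw a v w (snd x)"]) auto

lemma distributed_msg_eve: "distributed \<Omega> (count_space {1..N} \<Otimes>\<^sub>M Ln n) (\<lambda>\<omega>. (msg \<omega>, eve_output g n c \<omega>))
   (\<lambda>x. ennreal (pzw (sqrt g) (1 - g) (fst x) (snd x) / real N))"
  unfolding distributed_def
proof (intro conjI measure_eqI)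
  let ?S = "count_space {1..N} \<Otimes>\<^sub>M Ln n"
  let ?f = "\<lambda>w z. ennreal (pzw (sqrt g) (1 - g) w z / real N)"
  have mj: "(\<lambda>\<omega>. (msg \<omega>, eve_output g n c \<omega>)) \<in> \<Omega> \<rightarrow>\<^sub>M ?S"
    by (intro measurable_Pair measurable_msg measurable_eve_output)
  then show "(\<lambda>\<omega>. (msg \<omega>, eve_output g n c \<omega>)) \<in> \<Omega> \<rightarrow>\<^sub>M ?S" .
  show mf: "(\<lambda>x. ?f (fst x) (snd x)) \<in> borel_measurable ?S"
    using measurable_pzw_pair by measurable
  fix A assume "A \<in> sets (distr \<Omega> ?S (\<lambda>\<omega>. (msg \<omega>, eve_output g n c \<omega>)))"
  then have A [measurable]: "A \<in> sets ?S" by simp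
  have Aw [measurable]: "(\<lambda>z. indicator A (w, z) :: ennreal) \<in> borel_measurable (Ln n)" if "w \<in> {1..N}" for w
    using measurable_compose[OF measurable_Pair1'[of w "count_space {1..N}" "Ln n"], of "indicator A :: _ \<Rightarrow> ennreal" borel] that by simp
  let ?p = "\<lambda>k. phi n ((sqrt g)\<^sup>2 + (1 - g)) (\<lambda>i. sqrt g * relay_sum c k i)"
  have "emeasure (distr \<Omega> ?S (\<lambda>\<omega>. (msg \<omega>, eve_output g n c \<omega>))) A = (\<integral>\<^sup>+\<omega>. indicator A (msg \<omega>, eve_output g n c \<omega>) \<partial>\<Omega>)"
    by (subst nn_integral_distr[OF mj, symmetric]) auto
  also have "\<dots> = ennreal (1 / (real N * real M)) * (\<Sum>k\<in>T. \<integral>\<^sup>+z. ennreal (?p k z) * indicator A (fst k, z) \<partial>Ln n)"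
    using measurable_compose[OF mj, of "indicator A :: _ \<Rightarrow> ennreal" borel] Aw
    by (intro nn_integral_msg_eve[where h="\<lambda>w z. indicator A (w, z)"]) auto
  also have "\<dots> = (\<Sum>w\<in>{1..N}. \<integral>\<^sup>+z. ?f w z * indicator A (w, z) \<partial>Ln n)"
  proof -
    have E: "(\<Sum>k\<in>T. \<integral>\<^sup>+z. ennreal (?p k z) * indicator A (fst k, z) \<partial>Ln n) =
       (\<Sum>w\<in>{1..N}. \<Sum>m\<in>{1..M}. \<integral>\<^sup>+z. ennreal (?p (w, m) z) * indicator A (w, z) \<partial>Ln n)"
      by (simp add: T_def sum_pairs)
    show ?thesis unfolding E sum_distrib_left[of _ _ "{1..N}"]
    proof (rule sum.cong[OF refl])
      fix w assume w: "w \<in> {1..N}"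
      note [measurable] = Aw[OF w]
      have "ennreal (1 / (real N * real M)) * (\<Sum>m\<in>{1..M}. \<integral>\<^sup>+z. ennreal (?p (w, m) z) * indicator A (w, z) \<partial>Ln n) =
        (\<integral>\<^sup>+z. ennreal (1 / (real N * real M)) * (\<Sum>m\<in>{1..M}. ennreal (?p (w, m) z) * indicator A (w, z)) \<partial>Ln n)"
        by (subst nn_integral_cmult, measurable) (subst nn_integral_sum, auto)
      also have "\<dots> = (\<integral>\<^sup>+z. ?f w z * indicator A (w, z) \<partial>Ln n)"
      proof (rule nn_integral_cong)
        fix z
        have e1: "(\<Sum>m\<in>{1..M}. ennreal (?p (w, m) z) * indicator A (w, z)) = ennreal (\<Sum>m\<in>{1..M}. ?p (w, m) z) * indicator A (w, z)"
          by (simp only: sum_distrib_right[symmetric]) (simp add: sum_ennreal)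
        have e2: "?f w z = ennreal (1 / (real N * real M)) * ennreal (\<Sum>m\<in>{1..M}. ?p (w, m) z)"
          by (simp add: pzw_def ennreal_mult'[symmetric] sum_nonneg mult.commute)
        show "ennreal (1 / (real N * real M)) * (\<Sum>m\<in>{1..M}. ennreal (?p (w, m) z) * indicator A (w, z)) = ?f w z * indicator A (w, z)"
          unfolding e1 e2 by (simp only: mult.assoc)
      qed
      finally show "ennreal (1 / (real N * real M)) * (\<Sum>m\<in>{1..M}. \<integral>\<^sup>+z. ennreal (?p (w, m) z) * indicator A (w, z) \<partial>Ln n) =
         (\<integral>\<^sup>+z. ?f w z * indicator A (w, z) \<partial>Ln n)" .
    qed
  qed
  also have "\<dots> = (\<integral>\<^sup>+x. ?f (fst x) (snd x) * indicator A x \<partial>?S)"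
    using mf
    by (subst sigma_finite_measure.nn_integral_fst[OF sigma_finite_Ln, symmetric])
       (auto simp: nn_integral_count_space_finite)
  also have "\<dots> = emeasure (density ?S (\<lambda>x. ?f (fst x) (snd x))) A"
    using mf by (subst emeasure_density) auto
  finally show "emeasure (distr \<Omega> ?S (\<lambda>\<omega>. (msg \<omega>, eve_output g n c \<omega>))) A = emeasure (density ?S (\<lambda>x. ?f (fst x) (snd x))) A" .
qed simp_all

text \<open>The three \<open>distributed\<close> facts turn the mutual information into an integral
  of densities, which is regrouped as an average over message pairs; \<open>ln 2\<close> converts
  bits to nats.\<close>

lemma leakage_eq: "leakage g R' R n c * ln 2 = leak (sqrt g) (1 - g)"
proof -
  let ?S = "count_space {1..N}" and ?B = "\<Pi>\<^sub>M i\<in>{1..n}. borel :: real measure"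
  let ?P = "pzw (sqrt g) (1 - g)" and ?q = "pz (sqrt g) (1 - g)"
  have v: "1 - g > 0" using g by simp
  interpret prob_space \<Omega> by (rule prob_code_space)
  interpret information_space \<Omega> 2 by standard simp
  \<comment> \<open>The model uses the Borel product, the densities the Lebesgue product; image laws
    depend only on the common sigma-algebra.\<close>
  have "mutual_information 2 ?S ?B msg (eve_output g n c) = mutual_information 2 ?S (Ln n) msg (eve_output g n c)"
  proof -
    have "distr \<Omega> ?B (eve_output g n c) = distr \<Omega> (Ln n) (eve_output g n c)"
      by (intro distr_cong refl sets_Ln_borel[symmetric])
    moreover have "distr \<Omega> (?S \<Otimes>\<^sub>M ?B) (\<lambda>x. (msg x, eve_output g n c x)) = distr \<Omega> (?S \<Otimes>\<^sub>M Ln n) (\<lambda>x. (msg x, eve_output g n c x))"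
      by (intro distr_cong refl sets_pair_measure_cong sets_Ln_borel[symmetric])
    ultimately show ?thesis unfolding mutual_information_def by simp
  qed
  also have "\<dots> = (\<integral>x. ?P (fst x) (snd x) / real N * log 2 (?P (fst x) (snd x) / real N / (1 / real N * ?q (snd x))) \<partial>(?S \<Otimes>\<^sub>M Ln n))"
    by (subst mutual_information_distr[OF _ sigma_finite_Ln distributed_msg _ distributed_eve _ distributed_msg_eve])
       (auto intro!: sigma_finite_measure_count_space_finite divide_nonneg_nonneg less_imp_le[OF pz_pos[OF v]] less_imp_le[OF pzw_pos[OF v]])
  also have "\<dots> = (\<integral>x. ?P (fst x) (snd x) / real N * log 2 (?P (fst x) (snd x) / ?q (snd x)) \<partial>(?S \<Otimes>\<^sub>M Ln n))"
    using card_T_pos by simp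
  finally have 1: "leakage g R' R n c = (\<integral>x. ?P (fst x) (snd x) / real N * log 2 (?P (fst x) (snd x) / ?q (snd x)) \<partial>(?S \<Otimes>\<^sub>M Ln n))"
    by (simp add: leakage_def)
  let ?L = "\<lambda>w z. log 2 (?P w z / ?q z)"
  let ?p = "\<lambda>k. phi n ((sqrt g)\<^sup>2 + (1 - g)) (\<lambda>i. sqrt g * relay_sum c k i)"
  have II: "II T (J (sqrt g) (1 - g)) (\<lambda>k x. ln (?P (fst k) (snd x) / ?q (snd x)))"
  proof -
    have eq: "ln (?P (fst k) (snd x) / ?q (snd x)) = ln (?P (fst k) (snd x)) - ln (?q (snd x))" for k x
      using pzw_pos[OF v, of "sqrt g" "fst k" "snd x"] pz_pos[OF v, of "sqrt g" "snd x"] by (simp add: ln_div)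
    show ?thesis unfolding eq by (rule II_diff[OF II_ln_pzw_pz[OF v]])
  qed
  have hb: "has_bochner_integral (Ln n) (\<lambda>z. ?p k z * ?L (fst k) z) ((\<integral>x. ln (?P (fst k) (snd x) / ?q (snd x)) \<partial>J (sqrt g) (1 - g) k) / ln 2)"
    if k: "k \<in> T" for k
  proof -
    have d: "distr (jlaw n (sqrt g) (1 - g) (relay_sum c k)) (Ln n) snd = density (Ln n) (\<lambda>z. ennreal (?p k z))"
    proof (rule measure_eqI)
      fix A assume "A \<in> sets (distr (jlaw n (sqrt g) (1 - g) (relay_sum c k)) (Ln n) snd)"
      then have [measurable]: "A \<in> sets (Ln n)" by simp
      have "emeasure (distr (jlaw n (sqrt g) (1 - g) (relay_sum c k)) (Ln n) snd) A =
         (\<integral>\<^sup>+z. indicator A z \<partial>distr (jlaw n (sqrt g) (1 - g) (relay_sum c k)) (Ln n) snd)"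
        by simp
      also have "\<dots> = (\<integral>\<^sup>+x. indicator A (snd x) \<partial>jlaw n (sqrt g) (1 - g) (relay_sum c k))"
        by (rule nn_integral_distr) auto
      also have "\<dots> = emeasure (density (Ln n) (\<lambda>z. ennreal (?p k z))) A"
        by (subst nn_integral_jlaw_snd[OF v], simp, subst emeasure_density) auto
      finally show "emeasure (distr (jlaw n (sqrt g) (1 - g) (relay_sum c k)) (Ln n) snd) A = emeasure (density (Ln n) (\<lambda>z. ennreal (?p k z))) A" .
    qed simp
    have mL: "?L (fst k) \<in> borel_measurable (Ln n)" by measurable
    have "integrable (J (sqrt g) (1 - g) k) (\<lambda>x. ?L (fst k) (snd x))"
      using II k by (auto simp: II_def log_def)
    then have "integrable (distr (jlaw n (sqrt g) (1 - g) (relay_sum c k)) (Ln n) snd) (?L (fst k))"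
      unfolding J_def using mL by (subst integrable_distr_eq) auto
    then have i: "integrable (Ln n) (\<lambda>z. ?p k z * ?L (fst k) z)"
      unfolding d using mL by (subst (asm) integrable_density) auto
    have "(\<integral>z. ?p k z * ?L (fst k) z \<partial>Ln n) = (\<integral>z. ?L (fst k) z \<partial>distr (jlaw n (sqrt g) (1 - g) (relay_sum c k)) (Ln n) snd)"
      unfolding d using mL by (subst integral_density) auto
    also have "\<dots> = (\<integral>x. ?L (fst k) (snd x) \<partial>J (sqrt g) (1 - g) k)"
      unfolding J_def using mL by (subst integral_distr) auto
    also have "\<dots> = (\<integral>x. ln (?P (fst k) (snd x) / ?q (snd x)) \<partial>J (sqrt g) (1 - g) k) / ln 2"
      unfolding log_def by simp
    finally show ?thesis using i by (simp add: has_bochner_integral_iff)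
  qed
  have hbw: "has_bochner_integral (Ln n) (\<lambda>z. ?P w z / real N * ?L w z)
     ((\<Sum>m\<in>{1..M}. (\<integral>x. ln (?P w (snd x) / ?q (snd x)) \<partial>J (sqrt g) (1 - g) (w, m)) / ln 2) / (real N * real M))"
    if w: "w \<in> {1..N}" for w
  proof -
    have "has_bochner_integral (Ln n) (\<lambda>z. (\<Sum>m\<in>{1..M}. ?p (w, m) z * ?L w z) / (real N * real M))
      ((\<Sum>m\<in>{1..M}. (\<integral>x. ln (?P w (snd x) / ?q (snd x)) \<partial>J (sqrt g) (1 - g) (w, m)) / ln 2) / (real N * real M))"
      using hb[of "(w, m)" for m] w
      by (intro has_bochner_integral_divide_zero has_bochner_integral_sum) (auto simp: T_def)
    moreover have "(\<Sum>m\<in>{1..M}. ?p (w, m) z * ?L w z) / (real N * real M) = ?P w z / real N * ?L w z" for z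
      by (simp add: pzw_def sum_distrib_right[symmetric] mult.commute)
    ultimately show ?thesis by simp
  qed
  interpret F: pair_sigma_finite ?S "Ln n"
    by (intro pair_sigma_finite.intro sigma_finite_Ln sigma_finite_measure_count_space_finite) simp
  let ?f = "\<lambda>x. ?P (fst x) (snd x) / real N * ?L (fst x) (snd x)"
  have mf: "?f \<in> borel_measurable (?S \<Otimes>\<^sub>M Ln n)"
    using measurable_pzw_pair[of "sqrt g" "1 - g"] by measurable
  have int: "integrable (?S \<Otimes>\<^sub>M Ln n) ?f"
    by (rule F.Fubini_integrable[OF mf])
       (use hbw in \<open>auto simp: AE_count_space has_bochner_integral_iff integrable_count_space\<close>)
  have "leakage g R' R n c = (\<integral>w. (\<integral>z. ?P w z / real N * ?L w z \<partial>Ln n) \<partial>?S)"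
    unfolding 1 F.integral_fst'[OF int, symmetric] fst_conv snd_conv ..
  also have "\<dots> = (\<Sum>w\<in>{1..N}. \<integral>z. ?P w z / real N * ?L w z \<partial>Ln n)"
    by (rule lebesgue_integral_count_space_finite) simp
  also have "\<dots> = (\<Sum>w\<in>{1..N}. (\<Sum>m\<in>{1..M}. (\<integral>x. ln (?P w (snd x) / ?q (snd x)) \<partial>J (sqrt g) (1 - g) (w, m)) / ln 2) / (real N * real M))"
    by (intro sum.cong refl has_bochner_integral_integral_eq hbw)
  also have "\<dots> = leak (sqrt g) (1 - g) / ln 2"
    unfolding leak_def EE_def by (simp add: T_def sum_pairs sum_divide_distrib mult_ac)
  finally show ?thesis by simp
qed

end

section \<open>The outer bound for one code and its limit\<close>

text \<open>In nats, \<open>r\<close> stands for the rate and \<open>l\<close> for the leakage rate.\<close>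

definition outer :: "real \<Rightarrow> real \<Rightarrow> real \<Rightarrow> real \<Rightarrow> real \<Rightarrow> real \<Rightarrow> real \<Rightarrow> real \<Rightarrow> bool" where
  "outer P1 P2 C1 C2 g r l \<rho> \<longleftrightarrow>
    (let Q = P1 + P2 + 2 * \<rho> * sqrt (P1 * P2);
         A = (\<lambda>v. ln (1 + v + (1 - \<rho>\<^sup>2) * P2) + ln (1 + v + (1 - \<rho>\<^sup>2) * P1) - ln (1 + v)) in
     \<bar>\<rho>\<bar> \<le> 1 \<and>
     r \<le> C1 * ln 2 + 1 / 2 * ln (1 + (1 - \<rho>\<^sup>2) * P2) \<and>
     r \<le> C2 * ln 2 + 1 / 2 * ln (1 + (1 - \<rho>\<^sup>2) * P1) \<and>
     r \<le> (C1 + C2) * ln 2 \<and>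
     r \<le> 1 / 2 * ln (1 + Q) \<and>
     r - l \<le> 1 / 2 * (ln (1 + Q) - ln (1 + g * Q)) \<and>
     (\<forall>v>0. 2 * r \<le> (C1 + C2) * ln 2 + 1 / 2 * (A v + ln (1 + Q) - ln (1 + Q + v))) \<and>
     (\<forall>v>0. \<forall>\<mu>. 0 < \<mu> \<and> \<mu> < 1 \<longrightarrow>
        (1 + \<mu>) * r \<le> (C1 + C2) * ln 2 + 1 / 2 * (A v + \<mu> * ln \<mu> - (1 - \<mu>) * ln (v / (1 - \<mu>)))))"

lemma ln_num_msgs_le:
  assumes "r \<ge> 0"
  shows "ln (real (num_msgs n r)) \<le> real n * r * ln 2"
proof -
  have p: "(2::real) powr (real n * r) > 0" by simp
  have "real (num_msgs n r) \<le> 2 powr (real n * r)"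
    unfolding num_msgs_def using p by (simp add: of_nat_nat)
  then have "ln (real (num_msgs n r)) \<le> ln (2 powr (real n * r))"
    using num_msgs_ge_1[OF assms, of n] by (intro ln_mono) auto
  then show ?thesis by (simp add: ln_powr)
qed

text \<open>Rounding down loses at most a factor 2, since there is at least one message.\<close>

lemma ln_num_msgs_ge:
  assumes "r \<ge> 0"
  shows "real n * r * ln 2 - ln 2 \<le> ln (real (num_msgs n r))"
proof -
  have "(2::real) powr (real n * r) \<le> real (num_msgs n r) + 1"
    unfolding num_msgs_def using real_of_int_floor_add_one_ge[of "2 powr (real n * r)"] by (simp add: of_nat_nat)
  also have "\<dots> \<le> 2 * real (num_msgs n r)" using num_msgs_ge_1[OF assms, of n] by simp
  finally have "ln (2 powr (real n * r)) \<le> ln (2 * real (num_msgs n r))" by (intro ln_mono) auto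
  then show ?thesis using num_msgs_ge_1[OF assms, of n] by (simp add: ln_powr ln_mult)
qed

lemma sqrt_prod_le_sum:
  assumes "P1 > 0" "P2 > (0::real)"
  shows "2 * sqrt (P1 * P2) \<le> P1 + P2"
  using arith_geo_mean_sqrt[of P1 P2] assms by simp

lemma Q_nonneg:
  fixes P1 P2 \<rho> :: real
  assumes "P1 > 0" "P2 > 0" "\<bar>\<rho>\<bar> \<le> 1"
  shows "P1 + P2 + 2 * \<rho> * sqrt (P1 * P2) \<ge> 0"
proof -
  have "- 1 * sqrt (P1 * P2) \<le> \<rho> * sqrt (P1 * P2)"
    using assms by (intro mult_right_mono) auto
  then show ?thesis using sqrt_prod_le_sum[OF assms(1,2)] by simp
qed

section \<open>Power-limited codes and their empirical correlation\<close>

locale coded_power = coded +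
  fixes P1 P2 C1 C2 :: real
  assumes P: "P1 > 0" "P2 > 0" and C: "C1 \<ge> 0" "C2 \<ge> 0" and n0: "n > 0"
    and code: "is_code P1 P2 C1 C2 R' R n c"
begin

definition "j1 k = fst (src_enc c (fst k) (snd k))"
definition "j2 k = snd (src_enc c (fst k) (snd k))"
definition "x1 k = relay1 c (j1 k) (snd k)"
definition "x2 k = relay2 c (j2 k) (snd k)"
abbreviation "J1 \<equiv> {1..num_msgs n C1}"
abbreviation "J2 \<equiv> {1..num_msgs n C2}"
definition "\<sigma> = sqrt (P1 * P2)"
text \<open>Normalised by the permitted powers rather than the powers used: in every quadratic form
  the cross term is then exact, while the square terms are bounded by \<open>P1\<close> and
  \<open>P2\<close>.\<close>

definition "\<rho> = avg (\<lambda>k i. x1 k i * x2 k i) / (real n * \<sigma>)"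
definition "D = (1 - Pe) * ln (real N) - ln 2"

lemma s_eq: "relay_sum c k i = x1 k i + x2 k i"
  by (simp add: relay_sum_def x1_def x2_def j1_def j2_def)

lemma j_in: "k \<in> T \<Longrightarrow> j1 k \<in> J1" "k \<in> T \<Longrightarrow> j2 k \<in> J2"
  using code unfolding is_code_def T_def j1_def j2_def by (auto simp: mem_Times_iff)

lemma sigma_props: "\<sigma> > 0" "\<sigma>\<^sup>2 = P1 * P2" "real n > 0"
  using P n0 by (auto simp: \<sigma>_def)

lemma avg_le:
  assumes "\<And>k. k \<in> T \<Longrightarrow> (\<Sum>i=1..n. F k i) \<le> B"
  shows "avg F \<le> B"
proof -
  have "(\<Sum>k\<in>T. \<Sum>i=1..n. F k i) \<le> (\<Sum>k\<in>T. B)" by (intro sum_mono assms)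
  then show ?thesis using card_T_pos by (simp add: avg_def field_simps)
qed

lemma avg_power: "avg (\<lambda>k i. (x1 k i)\<^sup>2) \<le> real n * P1" "avg (\<lambda>k i. (x2 k i)\<^sup>2) \<le> real n * P2"
proof -
  have m: "snd k \<in> {1..M}" if "k \<in> T" for k using that by (auto simp: T_def)
  have "power_constraint n P1 (x1 k)" "power_constraint n P2 (x2 k)" if "k \<in> T" for k
    using code j_in[OF that] m[OF that] unfolding is_code_def x1_def x2_def by auto
  then show "avg (\<lambda>k i. (x1 k i)\<^sup>2) \<le> real n * P1" "avg (\<lambda>k i. (x2 k i)\<^sup>2) \<le> real n * P2"
    using n0 by (auto intro!: avg_le simp: power_constraint_def field_simps)
qed

lemma avg_cross: "avg (\<lambda>k i. x1 k i * x2 k i) = real n * \<rho> * \<sigma>"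
  using sigma_props by (simp add: \<rho>_def)

lemma avg_quad: "avg (\<lambda>k i. (\<alpha> * x1 k i + \<beta> * x2 k i)\<^sup>2) \<le> real n * (\<alpha>\<^sup>2 * P1 + 2 * \<alpha> * \<beta> * \<rho> * \<sigma> + \<beta>\<^sup>2 * P2)"
proof -
  have "(\<lambda>k i. (\<alpha> * x1 k i + \<beta> * x2 k i)\<^sup>2) = (\<lambda>k i. \<alpha>\<^sup>2 * (x1 k i)\<^sup>2 + (2 * \<alpha> * \<beta>) * (x1 k i * x2 k i) + \<beta>\<^sup>2 * (x2 k i)\<^sup>2)"
    by (intro ext) (simp add: power2_eq_square algebra_simps)
  then have "avg (\<lambda>k i. (\<alpha> * x1 k i + \<beta> * x2 k i)\<^sup>2) =
     \<alpha>\<^sup>2 * avg (\<lambda>k i. (x1 k i)\<^sup>2) + (2 * \<alpha> * \<beta>) * (real n * \<rho> * \<sigma>) + \<beta>\<^sup>2 * avg (\<lambda>k i. (x2 k i)\<^sup>2)"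
    by (simp only: avg_add avg_cmult avg_cross)
  also have "\<dots> \<le> \<alpha>\<^sup>2 * (real n * P1) + (2 * \<alpha> * \<beta>) * (real n * \<rho> * \<sigma>) + \<beta>\<^sup>2 * (real n * P2)"
    using mult_left_mono[OF avg_power(1), of "\<alpha>\<^sup>2"] mult_left_mono[OF avg_power(2), of "\<beta>\<^sup>2"] by simp
  finally show ?thesis by (simp add: algebra_simps)
qed

lemma avg_quad_nonneg: "0 \<le> real n * (\<alpha>\<^sup>2 * P1 + 2 * \<alpha> * \<beta> * \<rho> * \<sigma> + \<beta>\<^sup>2 * P2)"
proof -
  have "0 \<le> avg (\<lambda>k i. (\<alpha> * x1 k i + \<beta> * x2 k i)\<^sup>2)"
    unfolding avg_def by (intro divide_nonneg_nonneg sum_nonneg) auto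
  also note avg_quad
  finally show ?thesis .
qed

text \<open>Cauchy-Schwarz through the quadratic form: it stays nonnegative with the permitted
  powers inserted, and after scaling it reads
  \<open>1 + 2 * \<beta> * \<rho> + \<beta>\<^sup>2\<close>, evaluated at 1 and -1.\<close>

lemma rho_le: "\<bar>\<rho>\<bar> \<le> 1"
proof -
  have *: "0 \<le> P2 * P1 + 2 * \<beta> * \<rho> * (P1 * P2) + \<beta>\<^sup>2 * (P1 * P2)" for \<beta>
  proof -
    have "0 \<le> real n * (\<sigma>\<^sup>2 * P1 + 2 * \<sigma> * (\<beta> * P1) * \<rho> * \<sigma> + (\<beta> * P1)\<^sup>2 * P2)" by (rule avg_quad_nonneg)
    also have "\<dots> = real n * P1 * (\<sigma>\<^sup>2 + 2 * \<beta> * \<rho> * \<sigma>\<^sup>2 + \<beta>\<^sup>2 * (P1 * P2))"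
      by (simp add: power2_eq_square algebra_simps)
    finally have "0 \<le> \<sigma>\<^sup>2 + 2 * \<beta> * \<rho> * \<sigma>\<^sup>2 + \<beta>\<^sup>2 * (P1 * P2)"
      using mult_pos_pos[OF sigma_props(3) P(1)] by (simp only: zero_le_mult_iff) linarith
    then show ?thesis unfolding sigma_props(2) by (simp add: mult.commute)
  qed
  have "0 \<le> (P1 * P2) * (1 + 2 * \<beta> * \<rho> + \<beta>\<^sup>2)" for \<beta> using *[of \<beta>] by (simp add: algebra_simps)
  then have "0 \<le> 1 + 2 * \<beta> * \<rho> + \<beta>\<^sup>2" for \<beta>
    using mult_pos_pos[OF P] by (simp only: zero_le_mult_iff) (metis not_less)
  from this[of 1] this[of "-1"] show ?thesis by simp
qed

lemma rho2: "0 \<le> 1 - \<rho>\<^sup>2" using rho_le abs_square_le_1[of \<rho>] by simp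

abbreviation "Q \<equiv> P1 + P2 + 2 * \<rho> * \<sigma>"

lemma Q0: "Q \<ge> 0" using Q_nonneg[OF P rho_le] by (simp add: \<sigma>_def)

text \<open>\<open>\<rho> * \<sigma> / P1\<close> is the coefficient of the best linear estimate of
  the second input from the first at full power, so \<open>b1 * x1\<close> predicts the received
  sum.\<close>

definition "b1 = 1 + \<rho> * \<sigma> / P1"
definition "b2 = 1 + \<rho> * \<sigma> / P2"

lemma pred1: "avg (\<lambda>k i. (relay_sum c k i - b1 * x1 k i)\<^sup>2) \<le> real n * ((1 - \<rho>\<^sup>2) * P2)"
proof -
  have "(\<lambda>k i. (relay_sum c k i - b1 * x1 k i)\<^sup>2) = (\<lambda>k i. ((- \<rho> * \<sigma> / P1) * x1 k i + 1 * x2 k i)\<^sup>2)"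
    by (simp add: s_eq b1_def algebra_simps)
  then have "avg (\<lambda>k i. (relay_sum c k i - b1 * x1 k i)\<^sup>2) \<le>
      real n * ((- \<rho> * \<sigma> / P1)\<^sup>2 * P1 + 2 * (- \<rho> * \<sigma> / P1) * 1 * \<rho> * \<sigma> + 1\<^sup>2 * P2)"
    using avg_quad[of "- \<rho> * \<sigma> / P1" 1] by simp
  also have "(- \<rho> * \<sigma> / P1)\<^sup>2 * P1 + 2 * (- \<rho> * \<sigma> / P1) * 1 * \<rho> * \<sigma> + 1\<^sup>2 * P2 = P2 - \<rho>\<^sup>2 * \<sigma>\<^sup>2 / P1"
    using P by (simp add: field_simps power2_eq_square)
  also have "\<dots> = (1 - \<rho>\<^sup>2) * P2" unfolding sigma_props(2) using P by (simp add: algebra_simps)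
  finally show ?thesis .
qed

lemma pred2: "avg (\<lambda>k i. (relay_sum c k i - b2 * x2 k i)\<^sup>2) \<le> real n * ((1 - \<rho>\<^sup>2) * P1)"
proof -
  have "(\<lambda>k i. (relay_sum c k i - b2 * x2 k i)\<^sup>2) = (\<lambda>k i. (1 * x1 k i + (- \<rho> * \<sigma> / P2) * x2 k i)\<^sup>2)"
    by (simp add: s_eq b2_def algebra_simps)
  then have "avg (\<lambda>k i. (relay_sum c k i - b2 * x2 k i)\<^sup>2) \<le>
      real n * (1\<^sup>2 * P1 + 2 * 1 * (- \<rho> * \<sigma> / P2) * \<rho> * \<sigma> + (- \<rho> * \<sigma> / P2)\<^sup>2 * P2)"
    using avg_quad[of 1 "- \<rho> * \<sigma> / P2"] by simp
  also have "1\<^sup>2 * P1 + 2 * 1 * (- \<rho> * \<sigma> / P2) * \<rho> * \<sigma> + (- \<rho> * \<sigma> / P2)\<^sup>2 * P2 = P1 - \<rho>\<^sup>2 * \<sigma>\<^sup>2 / P2"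
    using P by (simp add: field_simps power2_eq_square)
  also have "\<dots> = (1 - \<rho>\<^sup>2) * P1" unfolding sigma_props(2) using P by (simp add: algebra_simps)
  finally show ?thesis .
qed

lemma avg_sum: "avg (\<lambda>k i. (relay_sum c k i)\<^sup>2) \<le> real n * Q"
  using avg_quad[of 1 1] by (simp add: s_eq algebra_simps)

lemma theta_pos: "v \<ge> 0 \<Longrightarrow> 1 + v + (1 - \<rho>\<^sup>2) * P1 > 0" "v \<ge> 0 \<Longrightarrow> 1 + v + (1 - \<rho>\<^sup>2) * P2 > 0"
  using rho2 P by (auto intro!: add_pos_nonneg mult_nonneg_nonneg)

lemma lnJ: "ln (real (card J1)) \<le> real n * C1 * ln 2" "ln (real (card J2)) \<le> real n * C2 * ln 2"
  using ln_num_msgs_le C by auto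

lemma bound_f1: "D \<le> real n * (C1 * ln 2 + 1 / 2 * ln (1 + (1 - \<rho>\<^sup>2) * P2))"
proof -
  have "D - ln (real (card J1)) \<le> real n / 2 * ln (1 + (1 - \<rho>\<^sup>2) * P2)"
    unfolding D_def
    by (rule cutset[where jj=j1 and c="\<lambda>j m i. b1 * relay1 c j m i"])
       (use j_in theta_pos[of 0] pred1 in \<open>auto simp: x1_def algebra_simps\<close>)
  then show ?thesis using lnJ(1) by (simp add: algebra_simps)
qed

lemma bound_f2: "D \<le> real n * (C2 * ln 2 + 1 / 2 * ln (1 + (1 - \<rho>\<^sup>2) * P1))"
proof -
  have "D - ln (real (card J2)) \<le> real n / 2 * ln (1 + (1 - \<rho>\<^sup>2) * P1)"
    unfolding D_def
    by (rule cutset[where jj=j2 and c="\<lambda>j m i. b2 * relay2 c j m i"])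
       (use j_in theta_pos[of 0] pred2 in \<open>auto simp: x2_def algebra_simps\<close>)
  then show ?thesis using lnJ(2) by (simp add: algebra_simps)
qed

lemma bound_links: "D \<le> real n * ((C1 + C2) * ln 2)"
proof -
  have "D - ln (real (card (J1 \<times> J2))) \<le> real n / 2 * ln 1"
    unfolding D_def
    by (rule cutset[where jj="\<lambda>k. (j1 k, j2 k)" and c="\<lambda>j m i. relay1 c (fst j) m i + relay2 c (snd j) m i"])
       (use j_in in \<open>auto simp: s_eq x1_def x2_def\<close>)
  moreover have "ln (real (card (J1 \<times> J2))) = ln (real (card J1)) + ln (real (card J2))"
    using num_msgs_ge_1[OF C(1), of n] num_msgs_ge_1[OF C(2), of n] by (simp add: card_cartesian_product ln_mult)
  ultimately show ?thesis using lnJ by (simp add: algebra_simps)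
qed

lemma bound_f4: "D \<le> real n * (1 / 2 * ln (1 + Q))"
proof -
  have "D - ln (real (card {()})) \<le> real n / 2 * ln (1 + Q)"
    unfolding D_def
    by (rule cutset[where jj="\<lambda>k. ()" and c="\<lambda>j m i. 0"])
       (use avg_sum Q0 in \<open>auto simp: algebra_simps\<close>)
  then show ?thesis by (simp add: algebra_simps)
qed

text \<open>The linear estimate of the legitimate output from the degraded one.\<close>

lemma lmmse:
  fixes a v :: real
  assumes v: "v > 0"
  defines "b \<equiv> a * (1 + Q) / (a\<^sup>2 * (1 + Q) + v)" and "\<theta> \<equiv> (1 + Q) * v / (a\<^sup>2 * (1 + Q) + v)"
  shows "\<theta> > 0" "avg (\<lambda>k i. ((1 - b * a) * relay_sum c k i)\<^sup>2) + real n * ((1 - b * a)\<^sup>2 + b\<^sup>2 * v) \<le> real n * \<theta>"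
proof -
  have q: "1 + Q > 0" using Q0 by simp
  have t: "a\<^sup>2 * (1 + Q) + v > 0" using v q by (intro add_nonneg_pos mult_nonneg_nonneg) auto
  show "\<theta> > 0" unfolding \<theta>_def using q t v by simp
  have "avg (\<lambda>k i. ((1 - b * a) * relay_sum c k i)\<^sup>2) = (1 - b * a)\<^sup>2 * avg (\<lambda>k i. (relay_sum c k i)\<^sup>2)"
    by (simp add: power_mult_distrib avg_cmult)
  also have "\<dots> \<le> (1 - b * a)\<^sup>2 * (real n * Q)" by (intro mult_left_mono avg_sum) simp
  finally have "avg (\<lambda>k i. ((1 - b * a) * relay_sum c k i)\<^sup>2) + real n * ((1 - b * a)\<^sup>2 + b\<^sup>2 * v)
     \<le> real n * ((1 - b * a)\<^sup>2 * (1 + Q) + b\<^sup>2 * v)" by (simp add: algebra_simps)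
  also have "(1 - b * a)\<^sup>2 * (1 + Q) + b\<^sup>2 * v = \<theta>"
  proof -
    define w where "w = 1 + Q"
    define t where "t = a\<^sup>2 * w + v"
    have t0: "t \<noteq> 0" using \<open>a\<^sup>2 * (1 + Q) + v > 0\<close> by (simp add: t_def w_def)
    have "1 - b * a = v / t" unfolding b_def w_def[symmetric] t_def[symmetric] using t0
      by (simp add: field_simps) (simp add: t_def power2_eq_square)
    moreover have "b = a * w / t" unfolding b_def w_def t_def ..
    ultimately have "(1 - b * a)\<^sup>2 * w + b\<^sup>2 * v = (v\<^sup>2 * w + a\<^sup>2 * w\<^sup>2 * v) / t\<^sup>2"
      by (simp add: power_divide power_mult_distrib add_divide_distrib)
    also have "v\<^sup>2 * w + a\<^sup>2 * w\<^sup>2 * v = w * v * t" by (simp add: t_def power2_eq_square algebra_simps)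
    also have "w * v * t / t\<^sup>2 = w * v / t" using t0 by (simp add: power2_eq_square)
    finally show ?thesis unfolding \<theta>_def w_def[symmetric] t_def[symmetric] .
  qed
  finally show "avg (\<lambda>k i. ((1 - b * a) * relay_sum c k i)\<^sup>2) + real n * ((1 - b * a)\<^sup>2 + b\<^sup>2 * v) \<le> real n * \<theta>" .
qed

text \<open>For the eavesdropper \<open>a\<^sup>2 + v\<close> is 1, so the posterior variance is
  \<open>1 - g\<close>; it cancels against the same factor in the estimation error and leaves
  \<open>f4 - f5\<close>.\<close>

lemma bound_secrecy: "D - leak (sqrt g) (1 - g) \<le> real n * (1 / 2 * (ln (1 + Q) - ln (1 + g * Q)))"
proof -
  have v: "1 - g > 0" using g by simp
  have e: "(sqrt g)\<^sup>2 = g" using g by simp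
  have q: "1 + Q > 0" "1 + g * Q > 0" using Q0 g by (auto intro!: add_pos_nonneg)
  have t: "g * (1 + Q) + (1 - g) = 1 + g * Q" by (simp add: algebra_simps)
  have "D - leak (sqrt g) (1 - g) \<le> real n / 2 * (ln ((1 + Q) * (1 - g) / (1 + g * Q)) - ln (1 - g))"
    using secrecy_bound[OF v lmmse[OF v, of "sqrt g"]] unfolding D_def e t by simp
  also have "ln ((1 + Q) * (1 - g) / (1 + g * Q)) = ln (1 + Q) + ln (1 - g) - ln (1 + g * Q)"
    using q v by (simp add: ln_div ln_mult)
  finally show ?thesis by (simp add: algebra_simps)
qed

definition "A v = ln (1 + v + (1 - \<rho>\<^sup>2) * P2) + ln (1 + v + (1 - \<rho>\<^sup>2) * P1) - ln (1 + v)"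

text \<open>\<open>pair_bound\<close> turns the upper bounds on the entropies of U with each index
  into one on h(U | M). \<open>A v\<close> collects the logarithms of the two prediction errors
  minus that of the noise variance \<open>1 + v\<close>.\<close>

lemma bound_output_entropy:
  assumes v: "v > 0"
  shows "D - real n * ((C1 + C2) * ln 2) - real n / 2 * (ln (2 * pi) + 1 + A v) \<le> EE T (J 1 v) (\<lambda>k x. ln (fU 1 v (snd k) (snd x)))"
proof -
  have 1: "- real n / 2 * (ln (2 * pi) + ln (1 + v + (1 - \<rho>\<^sup>2) * P2) + 1) - ln (real (card J1)) \<le>
    EE T (J 1 v) (\<lambda>k x. ln (fj 1 v j1 (snd k) (j1 k) (snd x)))"
    by (rule marginal_bound[OF v, where c="\<lambda>j m i. b1 * relay1 c j m i"])
       (use j_in theta_pos[of v] v pred1 in \<open>auto simp: x1_def algebra_simps\<close>)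
  have 2: "- real n / 2 * (ln (2 * pi) + ln (1 + v + (1 - \<rho>\<^sup>2) * P1) + 1) - ln (real (card J2)) \<le>
    EE T (J 1 v) (\<lambda>k x. ln (fj 1 v j2 (snd k) (j2 k) (snd x)))"
    by (rule marginal_bound[OF v, where c="\<lambda>j m i. b2 * relay2 c j m i"])
       (use j_in theta_pos[of v] v pred2 in \<open>auto simp: x2_def algebra_simps\<close>)
  have 3: "D + EE T (J 1 v) (\<lambda>k x. ln (fj 1 v j1 (snd k) (j1 k) (snd x)))
      + EE T (J 1 v) (\<lambda>k x. ln (fj 1 v j2 (snd k) (j2 k) (snd x)))
      + real n / 2 * (ln (2 * pi) + ln (1\<^sup>2 + v) + 1)
    \<le> EE T (J 1 v) (\<lambda>k x. ln (fU 1 v (snd k) (snd x)))"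
    unfolding D_def
    by (rule pair_bound[OF v, where ?J1.0=J1 and ?J2.0=J2 and sg="\<lambda>j j' m i. relay1 c j m i + relay2 c j' m i"])
       (use j_in in \<open>auto simp: s_eq x1_def x2_def fun_eq_iff\<close>)
  show ?thesis using 1 2 3 lnJ unfolding A_def by (simp add: algebra_simps)
qed

text \<open>The upper bound on h(U | M) meets the lower one from the chain rule; both contain the
  rate, hence \<open>2 * D\<close>.\<close>

lemma bound_degraded:
  assumes v: "v > 0"
  shows "2 * D \<le> real n * ((C1 + C2) * ln 2 + 1 / 2 * (A v + ln (1 + Q) - ln (1 + Q + v)))"
proof -
  have q: "1 + Q > 0" using Q0 by simp
  have eq: "ln ((1 + Q) * v / (1\<^sup>2 * (1 + Q) + v)) = ln (1 + Q) + ln v - ln (1 + Q + v)"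
    using q v by (simp add: ln_div ln_mult)
  note degraded_bound[OF v lmmse[OF v, of 1], unfolded eq D_def[symmetric]]
  with bound_output_entropy[OF v] show ?thesis by (simp add: algebra_simps)
qed

text \<open>The same upper bound meets the entropy power inequality with
  \<open>c = sqrt \<mu>\<close>, where Fano's bound has weight \<open>\<mu>\<close>; hence
  \<open>1 + \<mu>\<close>. The weight stays free until the rate is known.\<close>

lemma bound_epi:
  assumes v: "v > 0" and lam: "0 < \<mu>" "\<mu> < 1"
  shows "(1 + \<mu>) * D \<le> real n * ((C1 + C2) * ln 2 + 1 / 2 * (A v + \<mu> * ln \<mu> - (1 - \<mu>) * ln (v / (1 - \<mu>))))"
proof -
  have cd: "sqrt \<mu> > 0" "sqrt (1 - \<mu>) > 0" "(sqrt \<mu>)\<^sup>2 + (sqrt (1 - \<mu>))\<^sup>2 = 1" using lam by auto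
  have e: "(sqrt \<mu>)\<^sup>2 = \<mu>" "(sqrt (1 - \<mu>))\<^sup>2 = 1 - \<mu>" using lam by auto
  have l: "ln (sqrt \<mu>) = ln \<mu> / 2" "ln (sqrt v / sqrt (1 - \<mu>)) = ln (v / (1 - \<mu>)) / 2"
    using lam v by (simp_all add: ln_sqrt real_sqrt_divide[symmetric])
  let ?Y = "EE T (J 1 v) (\<lambda>k x. ln (fY (snd k) (fst x)))"
  have "EE T (J 1 v) (\<lambda>k x. ln (fU 1 v (snd k) (snd x))) \<le> \<mu> * ?Y
    - real n * ((1 - \<mu>) / 2 * ln (2 * pi) - \<mu> * (ln \<mu> / 2) + (1 - \<mu>) * (ln (v / (1 - \<mu>)) / 2) + (1 - \<mu>) / 2)"
    using epi_bound[OF v cd] unfolding e l .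
  also have "\<mu> * ?Y \<le> \<mu> * (- D - real n / 2 * (ln (2 * pi) + 1))"
    using fano_bound[OF v, of 1] lam unfolding D_def by (intro mult_left_mono) auto
  finally have "EE T (J 1 v) (\<lambda>k x. ln (fU 1 v (snd k) (snd x))) \<le> \<mu> * (- D - real n / 2 * (ln (2 * pi) + 1))
    - real n * ((1 - \<mu>) / 2 * ln (2 * pi) - \<mu> * (ln \<mu> / 2) + (1 - \<mu>) * (ln (v / (1 - \<mu>)) / 2) + (1 - \<mu>) / 2)"
    by simp
  with bound_output_entropy[OF v] show ?thesis by (simp add: field_simps)
qed

lemma outer_code: "outer P1 P2 C1 C2 g (D / real n) (leak (sqrt g) (1 - g) / real n) \<rho>"
proof -
  have div: "x / real n \<le> y \<longleftrightarrow> x \<le> real n * y" for x y using sigma_props(3) by (simp add: field_simps)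
  have m: "a * (D / real n) = (a * D) / real n" "D / real n - x / real n = (D - x) / real n" for a x
    by (simp_all add: diff_divide_distrib)
  show ?thesis
    unfolding outer_def Let_def m div \<sigma>_def[symmetric] A_def[symmetric]
    using rho_le bound_f1 bound_f2 bound_links bound_f4 bound_secrecy bound_degraded bound_epi by blast
qed

end

text \<open>The correlation varies with the code, so the bounds pass to the limit jointly with it,
  at fixed \<open>v\<close> and \<open>\<mu>\<close>. Continuity holds because
  \<open>\<bar>\<rho>\<bar> \<le> 1\<close> keeps every argument of \<open>ln\<close>
  positive.\<close>

lemma outer_closed:
  fixes r l \<rho> :: "nat \<Rightarrow> real"
  assumes P: "P1 > 0" "P2 > 0" and g: "0 \<le> g"
    and o: "\<And>n. outer P1 P2 C1 C2 g (r n) (l n) (\<rho> n)"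
    and r: "r \<longlonglongrightarrow> r0" and l: "l \<longlonglongrightarrow> l0" and rho: "\<rho> \<longlonglongrightarrow> \<rho>0"
  shows "outer P1 P2 C1 C2 g r0 l0 \<rho>0"
proof -
  let ?Q = "\<lambda>\<rho>. P1 + P2 + 2 * \<rho> * sqrt (P1 * P2)"
  have ab: "\<bar>\<rho>0\<bar> \<le> 1"
    by (rule tendsto_upperbound[OF tendsto_rabs[OF rho]]) (use o in \<open>auto simp: outer_def Let_def\<close>)
  have V: "0 \<le> 1 - \<rho>0\<^sup>2" using ab abs_square_le_1[of \<rho>0] by simp
  have pos: "1 + v + (1 - \<rho>0\<^sup>2) * P2 \<noteq> 0" "1 + v + (1 - \<rho>0\<^sup>2) * P1 \<noteq> 0" "1 + (1 - \<rho>0\<^sup>2) * P2 \<noteq> 0" "1 + (1 - \<rho>0\<^sup>2) * P1 \<noteq> 0" "1 + v \<noteq> 0"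
    if "v > 0" for v
  proof -
    have "(1 - \<rho>0\<^sup>2) * P2 \<ge> 0" "(1 - \<rho>0\<^sup>2) * P1 \<ge> 0" using V P by auto
    then show "1 + v + (1 - \<rho>0\<^sup>2) * P2 \<noteq> 0" "1 + v + (1 - \<rho>0\<^sup>2) * P1 \<noteq> 0" "1 + (1 - \<rho>0\<^sup>2) * P2 \<noteq> 0" "1 + (1 - \<rho>0\<^sup>2) * P1 \<noteq> 0" "1 + v \<noteq> 0"
      using that by linarith+
  qed
  have q: "?Q \<rho>0 \<ge> 0" by (rule Q_nonneg[OF P ab])
  have posq: "1 + ?Q \<rho>0 \<noteq> 0" "1 + g * ?Q \<rho>0 \<noteq> 0" "v > 0 \<Longrightarrow> 1 + ?Q \<rho>0 + v \<noteq> 0" for v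
    using q mult_nonneg_nonneg[OF g q] by linarith+
  have lim: "x \<le> y" if "X \<longlonglongrightarrow> x" "Y \<longlonglongrightarrow> y" "\<And>n. X n \<le> Y n" for X Y :: "nat \<Rightarrow> real" and x y
    using LIMSEQ_le[OF that(1,2)] that(3) by blast
  note outer_ineqs = o[unfolded outer_def Let_def]
  show ?thesis
    unfolding outer_def Let_def
  proof (intro conjI allI impI)
    show "r0 \<le> C1 * ln 2 + 1 / 2 * ln (1 + (1 - \<rho>0\<^sup>2) * P2)"
      by (rule lim[where X=r and Y="\<lambda>n. C1 * ln 2 + 1 / 2 * ln (1 + (1 - (\<rho> n)\<^sup>2) * P2)"])
         (use outer_ineqs pos[of 1] in \<open>auto intro!: tendsto_intros r rho\<close>)
    show "r0 \<le> C2 * ln 2 + 1 / 2 * ln (1 + (1 - \<rho>0\<^sup>2) * P1)"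
      by (rule lim[where X=r and Y="\<lambda>n. C2 * ln 2 + 1 / 2 * ln (1 + (1 - (\<rho> n)\<^sup>2) * P1)"])
         (use outer_ineqs pos[of 1] in \<open>auto intro!: tendsto_intros r rho\<close>)
    show "r0 \<le> (C1 + C2) * ln 2"
      by (rule lim[where X=r and Y="\<lambda>n. (C1 + C2) * ln 2"]) (use outer_ineqs in \<open>auto intro!: r\<close>)
    show "r0 \<le> 1 / 2 * ln (1 + ?Q \<rho>0)"
      by (rule lim[where X=r and Y="\<lambda>n. 1 / 2 * ln (1 + ?Q (\<rho> n))"])
         (use outer_ineqs posq in \<open>auto intro!: tendsto_intros r rho\<close>)
    show "r0 - l0 \<le> 1 / 2 * (ln (1 + ?Q \<rho>0) - ln (1 + g * ?Q \<rho>0))"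
      by (rule lim[where X="\<lambda>n. r n - l n" and Y="\<lambda>n. 1 / 2 * (ln (1 + ?Q (\<rho> n)) - ln (1 + g * ?Q (\<rho> n)))"])
         (use outer_ineqs posq in \<open>auto intro!: tendsto_intros r l rho\<close>)
    show "2 * r0 \<le> (C1 + C2) * ln 2 + 1 / 2 * (ln (1 + v + (1 - \<rho>0\<^sup>2) * P2) + ln (1 + v + (1 - \<rho>0\<^sup>2) * P1) - ln (1 + v) + ln (1 + ?Q \<rho>0) - ln (1 + ?Q \<rho>0 + v))"
      if v: "v > 0" for v
      by (rule lim[where X="\<lambda>n. 2 * r n" and Y="\<lambda>n. (C1 + C2) * ln 2 + 1 / 2 * (ln (1 + v + (1 - (\<rho> n)\<^sup>2) * P2) + ln (1 + v + (1 - (\<rho> n)\<^sup>2) * P1) - ln (1 + v) + ln (1 + ?Q (\<rho> n)) - ln (1 + ?Q (\<rho> n) + v))"])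
         (use outer_ineqs posq pos[OF v] v in \<open>auto intro!: tendsto_intros r l rho\<close>)
    show "(1 + \<mu>) * r0 \<le> (C1 + C2) * ln 2 + 1 / 2 * (ln (1 + v + (1 - \<rho>0\<^sup>2) * P2) + ln (1 + v + (1 - \<rho>0\<^sup>2) * P1) - ln (1 + v) + \<mu> * ln \<mu> - (1 - \<mu>) * ln (v / (1 - \<mu>)))"
      if v: "v > 0" and mu: "0 < \<mu> \<and> \<mu> < 1" for v \<mu>
      by (rule lim[where X="\<lambda>n. (1 + \<mu>) * r n" and Y="\<lambda>n. (C1 + C2) * ln 2 + 1 / 2 * (ln (1 + v + (1 - (\<rho> n)\<^sup>2) * P2) + ln (1 + v + (1 - (\<rho> n)\<^sup>2) * P1) - ln (1 + v) + \<mu> * ln \<mu> - (1 - \<mu>) * ln (v / (1 - \<mu>)))"])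
         (use outer_ineqs posq pos[OF v] v mu in \<open>auto intro!: tendsto_intros r l rho\<close>)
  qed (rule ab)
qed

lemma achievable_outer:
  assumes P: "P1 > 0" "P2 > 0" and C: "C1 \<ge> 0" "C2 \<ge> 0" and g: "0 \<le> g" "g < 1" and R': "R' \<ge> 0"
    and ach: "achievable P1 P2 C1 C2 g R' R"
  shows "\<exists>\<rho>. outer P1 P2 C1 C2 g (R * ln 2) 0 \<rho>"
proof -
  from ach obtain c where R: "R \<ge> 0" and code: "\<And>n. is_code P1 P2 C1 C2 R' R n (c n)"
    and err: "(\<lambda>n. error_prob g R' R n (c n)) \<longlonglongrightarrow> 0"
    and leak: "(\<lambda>n. (1 / real n) * leakage g R' R n (c n)) \<longlonglongrightarrow> 0"
    unfolding achievable_def by blast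
  define r where "r n = ((1 - error_prob g R' R n (c n)) * ln (real (num_msgs n R)) - ln 2) / real n" for n
  define l where "l n = leakage g R' R n (c n) * ln 2 / real n" for n
  \<comment> \<open>\<open>Suc n\<close> excludes block length 0, where rates per letter would be
    divisions by zero.\<close>
  have "\<exists>\<rho>. outer P1 P2 C1 C2 g (r (Suc n)) (l (Suc n)) \<rho>" for n
  proof -
    interpret coded_power g R' R "Suc n" "c (Suc n)" P1 P2 C1 C2
      by unfold_locales (use P C g R R' code[of "Suc n"] in \<open>auto simp: is_code_def\<close>)
    show ?thesis
      using outer_code unfolding D_def error_prob_eq[symmetric] leakage_eq[symmetric] r_def l_def by blast
  qed
  then obtain \<rho> where rho: "\<And>n. outer P1 P2 C1 C2 g (r (Suc n)) (l (Suc n)) (\<rho> n)" by metis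
  then have "\<rho> n \<in> {-1..1}" for n unfolding outer_def Let_def by (auto simp: abs_le_iff)
  moreover have "compact {-1..1::real}" by (rule compact_Icc)
  \<comment> \<open>The correlations of the codes need not converge; compactness provides a
    subsequence.\<close>
  ultimately obtain \<rho>0 f where f: "strict_mono f" "(\<rho> \<circ> f) \<longlonglongrightarrow> \<rho>0"
    unfolding compact_eq_seq_compact_metric seq_compact_def by blast
  have lnN: "(\<lambda>n. ln (real (num_msgs n R)) / real n) \<longlonglongrightarrow> R * ln 2"
  proof (rule tendsto_sandwich[where f="\<lambda>n. R * ln 2 - ln 2 / real n" and h="\<lambda>n. R * ln 2"])
    have "R * ln 2 - ln 2 / real n \<le> ln (real (num_msgs n R)) / real n" if "n > 0" for n
      using divide_right_mono[OF ln_num_msgs_ge[OF R, of n], of "real n"] that by (simp add: diff_divide_distrib)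
    then show "\<forall>\<^sub>F n in sequentially. R * ln 2 - ln 2 / real n \<le> ln (real (num_msgs n R)) / real n"
      using eventually_gt_at_top[of 0] by (rule eventually_mono[rotated])
    have "ln (real (num_msgs n R)) / real n \<le> R * ln 2" if "n > 0" for n
      using divide_right_mono[OF ln_num_msgs_le[OF R, of n], of "real n"] that by simp
    then show "\<forall>\<^sub>F n in sequentially. ln (real (num_msgs n R)) / real n \<le> R * ln 2"
      using eventually_gt_at_top[of 0] by (rule eventually_mono[rotated])
    have "(\<lambda>n. R * ln 2 - ln 2 / real n) \<longlonglongrightarrow> R * ln 2 - 0"
      by (intro tendsto_diff tendsto_const lim_const_over_n)
    then show "(\<lambda>n. R * ln 2 - ln 2 / real n) \<longlonglongrightarrow> R * ln 2" by simp
  qed simp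
  have "(\<lambda>n. (1 - error_prob g R' R n (c n)) * (ln (real (num_msgs n R)) / real n) - ln 2 / real n) \<longlonglongrightarrow> (1 - 0) * (R * ln 2) - 0"
    by (intro tendsto_diff tendsto_mult tendsto_const err lnN lim_const_over_n)
  then have r: "r \<longlonglongrightarrow> R * ln 2" by (simp add: r_def[abs_def] diff_divide_distrib)
  have "(\<lambda>n. (1 / real n) * leakage g R' R n (c n) * ln 2) \<longlonglongrightarrow> 0 * ln 2"
    by (intro tendsto_mult leak tendsto_const)
  then have l: "l \<longlonglongrightarrow> 0" by (simp add: l_def[abs_def])
  have sub: "(\<lambda>n. X (Suc (f n))) \<longlonglongrightarrow> x" if "X \<longlonglongrightarrow> x" for X :: "nat \<Rightarrow> real" and x
    using LIMSEQ_subseq_LIMSEQ[OF LIMSEQ_Suc[OF that] f(1)] by (simp add: o_def)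
  have "outer P1 P2 C1 C2 g (R * ln 2) 0 \<rho>0"
    by (rule outer_closed[OF P g(1) rho sub[OF r] sub[OF l]]) (use f(2) in \<open>simp add: o_def\<close>)
  then show ?thesis by blast
qed

section \<open>The correlation coefficient\<close>

text \<open>The bounds for codes require a noise density, hence \<open>v > 0\<close>, while Ozarow's
  variance vanishes at \<open>rho_star\<close>; continuity closes the gap.\<close>

lemma limit_at_0:
  fixes h :: "real \<Rightarrow> real"
  assumes "\<And>v. v > 0 \<Longrightarrow> x \<le> h v" "isCont h 0" "v \<ge> 0"
  shows "x \<le> h v"
proof (cases "v = 0")
  case True
  have "(h \<longlongrightarrow> h 0) (at_right 0)"
    using assms(2) by (auto simp: isCont_def intro: tendsto_mono[OF at_le])
  moreover have "\<forall>\<^sub>F v in at_right 0. x \<le> h v"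
    using assms(1) eventually_at_right_less[of 0] by (auto elim: eventually_mono)
  ultimately show ?thesis using True by (auto intro: tendsto_lowerbound)
qed (use assms in auto)

text \<open>With \<open>s = sqrt (P1 * P2)\<close>, \<open>rho_star\<close> is the nonnegative root
  of \<open>s * x\<^sup>2 + x = s\<close>; up to it Ozarow's variance
  \<open>s * (1 / x - x) - 1\<close> is nonnegative.\<close>

lemma rho_star_props:
  assumes P: "P1 > 0" "P2 > 0"
  shows "0 \<le> rho_star P1 P2" "rho_star P1 P2 < 1"
    "0 < x \<Longrightarrow> x \<le> rho_star P1 P2 \<Longrightarrow> sqrt (P1 * P2) * (1 / x - x) - 1 \<ge> 0"
proof -
  define s where "s = sqrt (P1 * P2)"
  have s: "s > 0" "P1 * P2 = s\<^sup>2" using P by (auto simp: s_def)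
  have rs: "rho_star P1 P2 = sqrt (1 + (1 / (2 * s))\<^sup>2) - 1 / (2 * s)"
    unfolding rho_star_def s_def[symmetric] mult.assoc s(2) using s(1) by (simp add: power2_eq_square)
  have "1 / (2 * s) \<le> sqrt (1 + (1 / (2 * s))\<^sup>2)" by (rule real_le_rsqrt) simp
  then show "0 \<le> rho_star P1 P2" unfolding rs by simp
  have "sqrt (1 + (1 / (2 * s))\<^sup>2) < 1 + 1 / (2 * s)"
    by (rule real_less_lsqrt) (use s in \<open>auto simp: power2_sum\<close>)
  then show "rho_star P1 P2 < 1" unfolding rs by simp
  assume x: "0 < x" "x \<le> rho_star P1 P2"
  have "x + 1 / (2 * s) \<le> sqrt (1 + (1 / (2 * s))\<^sup>2)" using x(2) unfolding rs by simp
  then have "(x + 1 / (2 * s))\<^sup>2 \<le> (sqrt (1 + (1 / (2 * s))\<^sup>2))\<^sup>2"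
    using x s by (intro power_mono) auto
  then have "(x + 1 / (2 * s))\<^sup>2 \<le> 1 + (1 / (2 * s))\<^sup>2" by (simp add: add_nonneg_nonneg)
  then have "x\<^sup>2 + x / s \<le> 1" by (simp add: power2_sum)
  then have "s * x\<^sup>2 + x \<le> s" using s by (simp add: field_simps)
  then show "sqrt (P1 * P2) * (1 / x - x) - 1 \<ge> 0"
    unfolding s_def[symmetric] using x by (simp add: field_simps power2_eq_square)
qed

text \<open>For this variance of the auxiliary noise, the two Gaussian inputs of correlation \<open>x\<close> are
  independent given the noisy output.\<close>

lemma ozarow_identity:
  assumes P: "P1 > 0" "P2 > 0" and x: "0 < x" "x < 1"
  defines "v \<equiv> sqrt (P1 * P2) * (1 / x - x) - 1"
  assumes v: "v \<ge> 0"
  shows "ln (1 + v + (1 - x\<^sup>2) * P2) + ln (1 + v + (1 - x\<^sup>2) * P1) - ln (1 + v) =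
    ln (1 + (P1 + P2 + 2 * x * sqrt (P1 * P2)) + v) + ln (1 - x\<^sup>2)"
proof -
  define s where "s = sqrt (P1 * P2)"
  have s: "s > 0" "P1 * P2 = s * s" using P by (auto simp: s_def)
  define t where "t = 1 + v"
  \<comment> \<open>The defining property of \<open>v\<close>:
    \<open>x * t = s * (1 - x\<^sup>2)\<close> makes the product of the two prediction errors a
    multiple of the noise variance \<open>t\<close>.\<close>
  have t: "t > 0" "x * t = s * (1 - x\<^sup>2)"
    using v x by (auto simp: t_def v_def s_def[symmetric] field_simps power2_eq_square)
  have x2: "1 - x\<^sup>2 > 0" using x by (simp add: power_less_one_iff abs_square_less_1)
  define w where "w = 1 - x\<^sup>2"
  have "(t + w * P2) * (t + w * P1) = t\<^sup>2 + t * w * (P1 + P2) + (w * s) * (w * s)"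
    using s(2) by (simp add: algebra_simps power2_eq_square)
  also have "w * s = x * t" using t(2) by (simp add: w_def mult.commute)
  also have "t\<^sup>2 + t * w * (P1 + P2) + (x * t) * (x * t) = t * (w * (t + P1 + P2) + 2 * x * (x * t))"
    by (simp add: w_def power2_eq_square algebra_simps)
  also have "2 * x * (x * t) = w * (2 * x * s)" unfolding t(2) by (simp add: w_def algebra_simps)
  finally have eq: "(t + w * P2) * (t + w * P1) = t * (w * (t + P1 + P2 + 2 * x * s))"
    by (simp add: algebra_simps)
  have pos: "t + w * P2 > 0" "t + w * P1 > 0" "w > 0" "t + P1 + P2 + 2 * x * s > 0"
    using t x2 P s x by (auto simp: w_def intro!: add_pos_pos)
  have "ln (t + w * P2) + ln (t + w * P1) = ln ((t + w * P2) * (t + w * P1))" using pos by (simp add: ln_mult)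
  also have "\<dots> = ln t + (ln w + ln (t + P1 + P2 + 2 * x * s))"
    unfolding eq using pos t by (simp add: ln_mult)
  finally show ?thesis unfolding s_def[symmetric] t_def[symmetric] w_def[symmetric]
    by (simp add: t_def algebra_simps)
qed

lemma nats_to_bits:
  "r * ln 2 \<le> a * ln 2 + 1 / 2 * ln X \<Longrightarrow> r \<le> a + 1 / 2 * log 2 X"
  "r * ln 2 \<le> 1 / 2 * ln X \<Longrightarrow> r \<le> 1 / 2 * log 2 X"
  "r * ln 2 \<le> 1 / 2 * (ln X - ln Y) \<Longrightarrow> r \<le> 1 / 2 * log 2 X - 1 / 2 * log 2 Y"
  by (simp_all add: log_def field_simps)

lemma f3_0: "f3 C1 C2 0 = ereal (C1 + C2)" by (simp add: f3_def)

lemma f3_eq: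
  assumes "0 \<le> x" "x < 1"
  shows "f3 C1 C2 x = ereal (C1 + C2 + 1 / 2 * log 2 (1 - x\<^sup>2))"
proof -
  have "1 - x\<^sup>2 > 0" using assms by (simp add: abs_square_less_1)
  then have "log 2 (1 / (1 - x\<^sup>2)) = - log 2 (1 - x\<^sup>2)" by (simp add: log_divide)
  then show ?thesis using assms by (simp add: f3_def)
qed

section \<open>Evaluating the outer bound at suitable correlations\<close>

context
  fixes P1 P2 C1 C2 g R \<rho> :: real
  assumes P: "P1 > 0" "P2 > 0" and C: "C1 \<ge> 0" "C2 \<ge> 0" and g: "0 \<le> g" "g < 1"
    and o: "outer P1 P2 C1 C2 g (R * ln 2) 0 \<rho>"
begin

abbreviation "sg \<equiv> sqrt (P1 * P2)"
abbreviation "QQ x \<equiv> P1 + P2 + 2 * x * sg"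

lemma sg_pos: "sg > 0" using P by simp

lemma outer_ineqs:
  "\<bar>\<rho>\<bar> \<le> 1"
  "R * ln 2 \<le> C1 * ln 2 + 1 / 2 * ln (1 + (1 - \<rho>\<^sup>2) * P2)"
  "R * ln 2 \<le> C2 * ln 2 + 1 / 2 * ln (1 + (1 - \<rho>\<^sup>2) * P1)"
  "R * ln 2 \<le> (C1 + C2) * ln 2"
  "R * ln 2 \<le> 1 / 2 * ln (1 + QQ \<rho>)"
  "R * ln 2 \<le> 1 / 2 * (ln (1 + QQ \<rho>) - ln (1 + g * QQ \<rho>))"
  and o_var: "v > 0 \<Longrightarrow> 2 * (R * ln 2) \<le> (C1 + C2) * ln 2 + 1 / 2 *
    ((ln (1 + v + (1 - \<rho>\<^sup>2) * P2) + ln (1 + v + (1 - \<rho>\<^sup>2) * P1) - ln (1 + v)) + ln (1 + QQ \<rho>) - ln (1 + QQ \<rho> + v))"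
  and o_epi: "v > 0 \<Longrightarrow> 0 < \<mu> \<and> \<mu> < 1 \<Longrightarrow> (1 + \<mu>) * (R * ln 2) \<le> (C1 + C2) * ln 2 + 1 / 2 *
    ((ln (1 + v + (1 - \<rho>\<^sup>2) * P2) + ln (1 + v + (1 - \<rho>\<^sup>2) * P1) - ln (1 + v)) + \<mu> * ln \<mu> - (1 - \<mu>) * ln (v / (1 - \<mu>)))"
  using o[unfolded outer_def Let_def diff_0_right] by blast+

text \<open>\<open>f1\<close> decreases in the square of the correlation, so the bound at
  \<open>\<rho>\<close> carries over to points nearer to 0, also when \<open>\<rho>\<close> is
  negative.\<close>

lemma ge_f1: "0 \<le> x \<Longrightarrow> x\<^sup>2 \<le> \<rho>\<^sup>2 \<Longrightarrow> ereal R \<le> f1 C1 P2 x"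
proof -
  assume x: "0 \<le> x" "x\<^sup>2 \<le> \<rho>\<^sup>2"
  have "1 - \<rho>\<^sup>2 \<ge> 0" using outer_ineqs by (simp add: abs_square_le_1)
  then have "1 + (1 - \<rho>\<^sup>2) * P2 > 0" using P by (intro add_pos_nonneg) auto
  moreover have "(1 - \<rho>\<^sup>2) * P2 \<le> (1 - x\<^sup>2) * P2" using x P by (intro mult_right_mono) auto
  ultimately have "ln (1 + (1 - \<rho>\<^sup>2) * P2) \<le> ln (1 + (1 - x\<^sup>2) * P2)" by (intro ln_mono) auto
  then have "R * ln 2 \<le> C1 * ln 2 + 1 / 2 * ln (1 + (1 - x\<^sup>2) * P2)" using outer_ineqs by linarith
  from nats_to_bits(1)[OF this] show ?thesis by (simp add: f1_def)
qed

lemma ge_f2: "0 \<le> x \<Longrightarrow> x\<^sup>2 \<le> \<rho>\<^sup>2 \<Longrightarrow> ereal R \<le> f2 C2 P1 x"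
proof -
  assume x: "0 \<le> x" "x\<^sup>2 \<le> \<rho>\<^sup>2"
  have "1 - \<rho>\<^sup>2 \<ge> 0" using outer_ineqs by (simp add: abs_square_le_1)
  then have "1 + (1 - \<rho>\<^sup>2) * P1 > 0" using P by (intro add_pos_nonneg) auto
  moreover have "(1 - \<rho>\<^sup>2) * P1 \<le> (1 - x\<^sup>2) * P1" using x P by (intro mult_right_mono) auto
  ultimately have "ln (1 + (1 - \<rho>\<^sup>2) * P1) \<le> ln (1 + (1 - x\<^sup>2) * P1)" by (intro ln_mono) auto
  then have "R * ln 2 \<le> C2 * ln 2 + 1 / 2 * ln (1 + (1 - x\<^sup>2) * P1)" using outer_ineqs by linarith
  from nats_to_bits(1)[OF this] show ?thesis by (simp add: f2_def)
qed

lemma ge_f3_0: "ereal R \<le> f3 C1 C2 0"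
  using outer_ineqs by (simp add: f3_0)

lemma QQ_mono: "x \<le> y \<Longrightarrow> QQ x \<le> QQ y" using sg_pos by simp

lemma QQ_rho: "QQ \<rho> \<ge> 0" using Q_nonneg[OF P] outer_ineqs by simp

lemma ge_f4: "\<rho> \<le> x \<Longrightarrow> ereal R \<le> f4 P1 P2 x"
proof -
  assume "\<rho> \<le> x"
  then have "ln (1 + QQ \<rho>) \<le> ln (1 + QQ x)" using QQ_mono[of \<rho> x] QQ_rho by (intro ln_mono) auto
  then have "R * ln 2 \<le> 1 / 2 * ln (1 + QQ x)" using outer_ineqs by linarith
  from nats_to_bits(2)[OF this] show ?thesis by (simp add: f4_def add.assoc)
qed

text \<open>For \<open>g < 1\<close> the ratio of \<open>1 + QQ x\<close> to
  \<open>1 + g * QQ x\<close> grows with \<open>QQ x\<close>, so the bound moves upward from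
  \<open>\<rho>\<close>.\<close>

lemma ge_f45: "\<rho> \<le> x \<Longrightarrow> ereal R \<le> f4 P1 P2 x - f5 g P1 P2 x"
proof -
  assume x: "\<rho> \<le> x"
  have q: "QQ \<rho> \<le> QQ x" "0 \<le> QQ \<rho>" using QQ_mono[OF x] QQ_rho by auto
  have gq: "0 \<le> g * QQ \<rho>" "0 \<le> g * QQ x" using q g by (auto intro!: mult_nonneg_nonneg)
  have "g * (QQ x - QQ \<rho>) \<le> 1 * (QQ x - QQ \<rho>)" using q g by (intro mult_right_mono) auto
  then have "(1 + QQ \<rho>) * (1 + g * QQ x) \<le> (1 + QQ x) * (1 + g * QQ \<rho>)" by (simp add: algebra_simps)
  then have "ln ((1 + QQ \<rho>) * (1 + g * QQ x)) \<le> ln ((1 + QQ x) * (1 + g * QQ \<rho>))"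
    using q gq by (intro ln_mono mult_pos_pos) auto
  moreover have "ln ((1 + QQ \<rho>) * (1 + g * QQ x)) = ln (1 + QQ \<rho>) + ln (1 + g * QQ x)"
    "ln ((1 + QQ x) * (1 + g * QQ \<rho>)) = ln (1 + QQ x) + ln (1 + g * QQ \<rho>)"
    using q gq by (intro ln_mult_pos; linarith)+
  ultimately have m: "ln (1 + QQ \<rho>) + ln (1 + g * QQ x) \<le> ln (1 + QQ x) + ln (1 + g * QQ \<rho>)" by (simp only:)
  have "r \<le> 1 / 2 * (p - q) \<Longrightarrow> p + s \<le> t + q \<Longrightarrow> r \<le> 1 / 2 * (t - s)" for p q r s t :: real by simp
  from this[OF outer_ineqs(6) m] have "R * ln 2 \<le> 1 / 2 * (ln (1 + QQ x) - ln (1 + g * QQ x))" .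
  from nats_to_bits(3)[OF this] show ?thesis by (simp add: f4_def f5_def add.assoc)
qed

lemma isCont_A: "isCont (\<lambda>v. ln (1 + v + (1 - \<rho>\<^sup>2) * P2) + ln (1 + v + (1 - \<rho>\<^sup>2) * P1) - ln (1 + v)) 0"
proof -
  have "1 - \<rho>\<^sup>2 \<ge> 0" using outer_ineqs by (simp add: abs_square_le_1)
  then have "1 + (1 - \<rho>\<^sup>2) * P2 > 0" "1 + (1 - \<rho>\<^sup>2) * P1 > 0" using P by (auto intro!: add_pos_nonneg)
  then show ?thesis by (intro continuous_intros) auto
qed

text \<open>At Ozarow's variance for \<open>\<rho>\<close> the term
  \<open>ln (1 + QQ \<rho> + v)\<close> of the degraded bound cancels, leaving the logarithms of
  \<open>f3\<close> and \<open>f4\<close>.\<close>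

lemma ge_f34:
  assumes x: "0 \<le> \<rho>" "\<rho> \<le> rho_star P1 P2"
  shows "ereal R \<le> (f3 C1 C2 \<rho> + f4 P1 P2 \<rho>) / 2"
proof -
  have lt: "\<rho> < 1" using x rho_star_props(2)[OF P] by linarith
  have "2 * (R * ln 2) \<le> (C1 + C2) * ln 2 + 1 / 2 * (ln (1 - \<rho>\<^sup>2) + ln (1 + QQ \<rho>))"
  \<comment> \<open>At correlation 0 Ozarow's variance would be infinite; there the claim is the sum
    of the link cut and the \<open>f4\<close> bound.\<close>
  proof (cases "\<rho> = 0")
    case True
    then have l: "ln (1 - \<rho>\<^sup>2) = 0" by simp
    show ?thesis using add_mono[OF outer_ineqs(4,5)] unfolding l by (simp only: add_0 mult_2)
  next
    case False
    then have x0: "0 < \<rho>" using x by simp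
    let ?v = "sg * (1 / \<rho> - \<rho>) - 1"
    have v: "?v \<ge> 0" by (rule rho_star_props(3)[OF P x0 x(2)])
    have "2 * (R * ln 2) \<le> (\<lambda>v. (C1 + C2) * ln 2 + 1 / 2 * ((ln (1 + v + (1 - \<rho>\<^sup>2) * P2) + ln (1 + v + (1 - \<rho>\<^sup>2) * P1) - ln (1 + v)) + ln (1 + QQ \<rho>) - ln (1 + QQ \<rho> + v))) ?v"
    proof (rule limit_at_0[OF _ _ v])
      show "isCont (\<lambda>v. (C1 + C2) * ln 2 + 1 / 2 * ((ln (1 + v + (1 - \<rho>\<^sup>2) * P2) + ln (1 + v + (1 - \<rho>\<^sup>2) * P1) - ln (1 + v)) + ln (1 + QQ \<rho>) - ln (1 + QQ \<rho> + v))) 0"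
        by (intro isCont_diff isCont_add isCont_mult isCont_A continuous_const isCont_ln' continuous_ident) (use QQ_rho in auto)
    qed (rule o_var)
    then show ?thesis unfolding ozarow_identity[OF P x0 lt v] by simp
  qed
  then have "R \<le> ((C1 + C2 + 1 / 2 * log 2 (1 - \<rho>\<^sup>2)) + 1 / 2 * log 2 (1 + QQ \<rho>)) / 2"
    by (simp add: log_def field_simps)
  then have "ereal R \<le> ereal (((C1 + C2 + 1 / 2 * log 2 (1 - \<rho>\<^sup>2)) + 1 / 2 * log 2 (1 + QQ \<rho>)) / 2)" by simp
  also have "\<dots> = (f3 C1 C2 \<rho> + f4 P1 P2 \<rho>) / 2"
    unfolding f3_eq[OF x(1) lt] f4_def by (simp add: add.assoc)
  finally show ?thesis .
qed

text \<open>\<open>L\<close> says that \<open>f4\<close> equals the rate at \<open>x\<close>. The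
  entropy power inequality then makes the noisier output at least as powerful as for Gaussian inputs
  of correlation \<open>x\<close>, so Ozarow's identity can be used at \<open>x\<close> instead of
  \<open>\<rho>\<close>.\<close>

lemma ge_f3:
  assumes x: "0 < x" "x \<le> rho_star P1 P2" "x \<le> \<rho>" and L: "exp (2 * (R * ln 2)) = 1 + QQ x"
  shows "ereal R \<le> f3 C1 C2 x"
proof -
  have lt: "x < 1" using x rho_star_props(2)[OF P] by linarith
  define \<Lambda> where "\<Lambda> = 1 + QQ x"
  have Lp: "\<Lambda> > 0" using L by (metis \<Lambda>_def exp_gt_zero)
  have lnL: "ln \<Lambda> = 2 * (R * ln 2)" unfolding \<Lambda>_def L[symmetric] by simp
  let ?A = "\<lambda>v. ln (1 + v + (1 - \<rho>\<^sup>2) * P2) + ln (1 + v + (1 - \<rho>\<^sup>2) * P1) - ln (1 + v)"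
  let ?v = "sg * (1 / x - x) - 1"
  have v: "?v \<ge> 0" by (rule rho_star_props(3)[OF P x(1,2)])
  have pos: "R * ln 2 \<le> (C1 + C2) * ln 2 + 1 / 2 * (?A v - ln (\<Lambda> + v))" if v: "v > 0" for v
  proof -
    \<comment> \<open>The optimal weight for entropy powers \<open>\<Lambda>\<close> and
      \<open>v\<close>: it turns Lieb's linear form into the exponential one, with total power
      \<open>\<Lambda> + v\<close>.\<close>
    define \<mu> where "\<mu> = \<Lambda> / (\<Lambda> + v)"
    have mu: "0 < \<mu>" "\<mu> < 1" "v / (1 - \<mu>) = \<Lambda> + v"
      using Lp v by (auto simp: \<mu>_def field_simps)
    have lnm: "ln \<mu> = 2 * (R * ln 2) - ln (\<Lambda> + v)" using Lp v by (simp add: \<mu>_def ln_div lnL)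
    have e: "\<mu> * ln \<mu> - (1 - \<mu>) * ln (v / (1 - \<mu>)) = \<mu> * (2 * (R * ln 2)) - ln (\<Lambda> + v)"
      unfolding mu(3) lnm by (simp add: algebra_simps)
    have "(1 + \<mu>) * (R * ln 2) \<le> (C1 + C2) * ln 2 + 1 / 2 * (?A v + \<mu> * ln \<mu> - (1 - \<mu>) * ln (v / (1 - \<mu>)))"
      using o_epi v mu by blast
    then show ?thesis using e by (simp add: algebra_simps)
  qed
  have "R * ln 2 \<le> (\<lambda>v. (C1 + C2) * ln 2 + 1 / 2 * (?A v - ln (\<Lambda> + v))) ?v"
  proof (rule limit_at_0[OF pos _ v])
    show "isCont (\<lambda>v. (C1 + C2) * ln 2 + 1 / 2 * (?A v - ln (\<Lambda> + v))) 0"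
      by (intro isCont_diff[OF isCont_A] isCont_add isCont_mult continuous_const isCont_ln' continuous_ident) (use Lp in auto)
  qed
  \<comment> \<open>The prediction errors shrink as the squared correlation grows, so
    \<open>\<rho>\<close> may be replaced by the smaller \<open>x\<close>.\<close>
  also have "\<dots> \<le> (C1 + C2) * ln 2 + 1 / 2 * ((ln (1 + ?v + (1 - x\<^sup>2) * P2) + ln (1 + ?v + (1 - x\<^sup>2) * P1) - ln (1 + ?v)) - ln (\<Lambda> + ?v))"
  proof -
    have "1 - \<rho>\<^sup>2 \<ge> 0" using outer_ineqs by (simp add: abs_square_le_1)
    moreover have "x\<^sup>2 \<le> \<rho>\<^sup>2" using x by (intro power_mono) auto
    ultimately have "(1 - \<rho>\<^sup>2) * P2 \<le> (1 - x\<^sup>2) * P2" "(1 - \<rho>\<^sup>2) * P1 \<le> (1 - x\<^sup>2) * P1" "0 \<le> (1 - \<rho>\<^sup>2) * P2" "0 \<le> (1 - \<rho>\<^sup>2) * P1"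
      using P by (auto intro!: mult_right_mono)
    then have "ln (1 + ?v + (1 - \<rho>\<^sup>2) * P2) \<le> ln (1 + ?v + (1 - x\<^sup>2) * P2)" "ln (1 + ?v + (1 - \<rho>\<^sup>2) * P1) \<le> ln (1 + ?v + (1 - x\<^sup>2) * P1)"
      using v by (intro ln_mono; linarith)+
    then show ?thesis by simp
  qed
  also have "\<dots> = (C1 + C2) * ln 2 + 1 / 2 * ln (1 - x\<^sup>2)"
    unfolding ozarow_identity[OF P x(1) lt v] \<Lambda>_def by simp
  finally have "R \<le> C1 + C2 + 1 / 2 * log 2 (1 - x\<^sup>2)" by (rule nats_to_bits(1))
  then show ?thesis using f3_eq[of x] x lt by simp
qed

text \<open>The point of evaluation is \<open>\<rho>\<close>, or 0 if it is negative: moving a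
  negative correlation to 0 relaxes every bound, and at 0 the averaged term follows from f3(0) and
  \<open>f4\<close>.\<close>

lemma le_S34: "ereal R \<le> max (S3 P1 P2 C1 C2 g) (S4 P1 P2 C1 C2 g)"
proof (cases "\<rho> > rho_star P1 P2")
  case True
  then have r: "0 \<le> \<rho>" "\<rho> \<in> {rho_star P1 P2<..1}" using rho_star_props(1)[OF P] outer_ineqs by auto
  have "ereal R \<le> S4 P1 P2 C1 C2 g"
    unfolding S4_def by (rule SUP_upper2[OF r(2)]) (use ge_f1 ge_f2 ge_f3_0 ge_f45 r in auto)
  then show ?thesis by (simp add: le_max_iff_disj)
next
  case False
  show ?thesis
  proof (cases "\<rho> \<ge> 0")
    case True
    then have r: "\<rho> \<in> {0..rho_star P1 P2}" using False by auto
    have "ereal R \<le> S3 P1 P2 C1 C2 g"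
      unfolding S3_def by (rule SUP_upper2[OF r]) (use ge_f1 ge_f2 ge_f3_0 ge_f45 ge_f34 r in auto)
    then show ?thesis by (simp add: le_max_iff_disj)
  next
    case neg: False
    have r: "0 \<in> {0..rho_star P1 P2}" using rho_star_props(1)[OF P] by auto
    have f4: "ereal R \<le> f4 P1 P2 0" using ge_f4 neg by simp
    have "ereal R \<le> (f3 C1 C2 0 + f4 P1 P2 0) / 2"
      using f4 ge_f3_0 unfolding f3_0 f4_def by simp
    then have "ereal R \<le> S3 P1 P2 C1 C2 g"
      unfolding S3_def by (intro SUP_upper2[OF r]) (use ge_f1 ge_f2 ge_f3_0 ge_f45 neg in auto)
    then show ?thesis by (simp add: le_max_iff_disj)
  qed
qed

lemma le_S12: "ereal R \<le> max (S1 P1 P2 C1 C2) (S2 P1 P2 C1 C2)"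
proof -
  \<comment> \<open>The correlation at which \<open>f4\<close> equals the rate, possibly negative.
    It serves S1 if it lies in \<open>{0..rho_star P1 P2}\<close>; below 0 the point 0 is used, and
    if \<open>x\<close> exceeds \<open>rho_star\<close> then so does \<open>\<rho>\<close>, which
    serves S2.\<close>
  define x where "x = (exp (2 * (R * ln 2)) - 1 - P1 - P2) / (2 * sg)"
  have "2 * x * sg = exp (2 * (R * ln 2)) - 1 - P1 - P2" using P by (simp add: x_def)
  then have L: "exp (2 * (R * ln 2)) = 1 + QQ x" by simp
  have xr: "x \<le> \<rho>"
  proof -
    have "exp (2 * (R * ln 2)) \<le> exp (ln (1 + QQ \<rho>))" using outer_ineqs by (subst exp_le_cancel_iff) linarith
    then have "QQ x \<le> QQ \<rho>" unfolding L using QQ_rho by simp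
    then show ?thesis using sg_pos by simp
  qed
  have f4x: "ereal R \<le> f4 P1 P2 y" if "x \<le> y" for y
  proof -
    have "1 + QQ x \<le> 1 + QQ y" "0 < 1 + QQ x" using QQ_mono[OF that] L[symmetric] by (auto simp del: mult_le_cancel_right)
    then have "ln (1 + QQ x) \<le> ln (1 + QQ y)" by (intro ln_mono) auto
    moreover have "ln (1 + QQ x) = 2 * (R * ln 2)" unfolding L[symmetric] by simp
    ultimately have "R * ln 2 \<le> 1 / 2 * ln (1 + QQ y)" by simp
    from nats_to_bits(2)[OF this] show ?thesis by (simp add: f4_def add.assoc)
  qed
  consider "x \<le> 0" | "0 < x" "x \<le> rho_star P1 P2" | "0 < x" "rho_star P1 P2 < x" by linarith
  then show ?thesis
  proof cases
    case 1
    have r: "0 \<in> {0..rho_star P1 P2}" using rho_star_props(1)[OF P] by auto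
    have "ereal R \<le> S1 P1 P2 C1 C2"
      unfolding S1_def by (rule SUP_upper2[OF r]) (use ge_f1 ge_f2 ge_f3_0 f4x 1 in auto)
    then show ?thesis by (simp add: le_max_iff_disj)
  next
    case 2
    then have r: "x \<in> {0..rho_star P1 P2}" by auto
    have "x\<^sup>2 \<le> \<rho>\<^sup>2" using 2 xr by (intro power_mono) auto
    then have "ereal R \<le> S1 P1 P2 C1 C2"
      unfolding S1_def by (intro SUP_upper2[OF r]) (use ge_f1 ge_f2 ge_f3[OF 2 xr L] f4x 2 in auto)
    then show ?thesis by (simp add: le_max_iff_disj)
  next
    case 3
    then have r: "\<rho> \<in> {rho_star P1 P2<..1}" "0 \<le> \<rho>" using xr outer_ineqs by auto
    have "ereal R \<le> S2 P1 P2 C1 C2"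
      unfolding S2_def by (rule SUP_upper2[OF r(1)]) (use ge_f1 ge_f2 ge_f3_0 ge_f4 r in auto)
    then show ?thesis by (simp add: le_max_iff_disj)
  qed
qed

end

theorem theorem1:
  fixes P1 P2 C1 C2 g R' :: real
  assumes "P1 > 0" and "P2 > 0" and "C1 \<ge> 0" and "C2 \<ge> 0"
    and "0 \<le> g" and "g < 1" and "R' \<ge> 0"
  shows "secrecy_capacity P1 P2 C1 C2 g R' \<le>
    min (max (S1 P1 P2 C1 C2) (S2 P1 P2 C1 C2)) (max (S3 P1 P2 C1 C2 g) (S4 P1 P2 C1 C2 g))"
  unfolding secrecy_capacity_def
proof (rule SUP_least)
  fix R assume "R \<in> {R. achievable P1 P2 C1 C2 g R' R}"
  then obtain \<rho> where "outer P1 P2 C1 C2 g (R * ln 2) 0 \<rho>"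
    using achievable_outer[OF assms] by blast
  from le_S12[OF assms(1-6) this] le_S34[OF assms(1-6) this]
  show "ereal R \<le> min (max (S1 P1 P2 C1 C2) (S2 P1 P2 C1 C2)) (max (S3 P1 P2 C1 C2 g) (S4 P1 P2 C1 C2 g))"
    by simp
qed

end
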